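(* Let $\phi:\mathbb{R}\to\mathbb{R}$ be a $\mathbb{Z}$-periodic, non-constant $C^2$ function and let $b\ge 2$ be an integer. Then there exists $K_0=K_0(\phi,b)>1$ such that for every $\lambda\in(0,1)$ with $1<\lambda b<K_0$, the graph of the function $f^\phi_{\lambda,b}(x)=\sum_{n=0}^\infty\lambda^n\phi(b^nx)$, $x\in\mathbb{R}$, has Hausdorff dimension $D=2+\frac{\log\lambda}{\log b}$. *)

theory Defs
  imports "HOL-Analysis.Analysis"
begin

definition diam_pow :: "real \<Rightarrow> real \<Rightarrow> real" where
  "diam_pow s d = (if s = 0 then 1 else d powr s)"

definition hausdorff_content ::
    "real \<Rightarrow> real \<Rightarrow> 'a::metric_space set \<Rightarrow> ennreal" where
  "hausdorff_content s \<delta> A =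
     (INF U \<in> {U :: nat \<Rightarrow> 'a set. A \<subseteq> (\<Union>i. U i) \<and>
                 (\<forall>i. bounded (U i) \<and> diameter (U i) \<le> \<delta>)}.
        (\<Sum>i. ennreal (if U i = {} then 0 else diam_pow s (diameter (U i)))))"

definition hausdorff_measure :: "real \<Rightarrow> 'a::metric_space set \<Rightarrow> ennreal" where
  "hausdorff_measure s A = (SUP \<delta> \<in> {0<..}. hausdorff_content s \<delta> A)"

definition hausdorff_dim :: "'a::metric_space set \<Rightarrow> real" where
  "hausdorff_dim A = Inf {s. 0 \<le> s \<and> hausdorff_measure s A = 0}"

definition weierstrass_fun :: "(real \<Rightarrow> real) \<Rightarrow> real \<Rightarrow> nat \<Rightarrow> real \<Rightarrow> real" where
  "weierstrass_fun \<phi> l b x = (\<Sum>n. l ^ n * \<phi> (real b ^ n * x))"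

definition graph_of :: "(real \<Rightarrow> real) \<Rightarrow> (real \<times> real) set" where
  "graph_of f = {(x, f x) | x. True}"

end

theory Submission
  imports Defs "HOL-Complex_Analysis.Complex_Analysis"
begin

text \<open>
  The upper bound is the usual box count for a Hoelder function. For the lower bound, put
  \<open>\<gamma> = 1 / (l b)\<close>. Blowing up by \<open>b ^ n\<close> turns a pair of points of the graph at distance
  \<open>b powr - (n + N)\<close> into a pair \<open>u, v\<close> at distance \<open>b powr - N\<close> together with a random word \<open>j\<close> of \<open>n\<close> digits,
  and the difference of the values becomes \<open>f u - f v\<close> plus \<open>u - v\<close> times the slope
  \<open>\<Sum>k\<le>n. \<gamma> ^ k * \<phi>' ((u + j) / b ^ k)\<close>, up to an error of second order. If the distribution of this slope
  has a density in \<open>L\<^sup>2\<close>, then discarding a small set of words leaves a proportion at most about \<open>\<gamma> ^ n\<close> of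
  the words for which the values stay close. With \<open>n = N\<close> this improves a local dimension \<open>\<delta>\<close> of the lifted
  Lebesgue measure to \<open>(D + \<delta>) / 2\<close>, where \<open>D = 2 + ln l / ln b\<close>, and iteration gives \<open>D\<close>.

  The \<open>L\<^sup>2\<close> bound follows Tsujii: pairs of words whose slope functions are transversal have a bounded correlation,
  and the others are absorbed by Cauchy--Schwarz as long as every word of length \<open>q\<close> has a transversal partner and
  \<open>b ^ q - 1 < (\<gamma> b) ^ q\<close>, which holds for \<open>\<gamma>\<close> near 1. Transversality fails only if
  \<open>\<phi> x = g (b x) / b - g x + c\<close> for another \<open>C\<^sup>2\<close> function \<open>g\<close>. In that case the graph for \<open>\<phi>\<close> is a
  bi-Lipschitz image of the graph for \<open>g\<close>, and this replacement cannot go on forever unless \<open>\<phi>\<close> is constant.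
\<close>

section \<open>Hausdorff dimension of graphs\<close>

text \<open>The difficulty is a threshold \<open>K0\<close> that is the same for all
  \<open>l\<close>. Transversality is therefore studied only at \<open>\<gamma> = 1\<close>, where
  the derivative of the slope is \<open>curv\<close>; compactness then yields one \<open>q\<close>
  and one gap \<open>d\<close> serving every \<open>\<gamma>\<close> with
  \<open>1 - b^(-q) < \<gamma>^q\<close>. That same inequality makes the correlation recursion
  contract, and it determines \<open>K0\<close>; all later constants may depend on \<open>l\<close>.
  No limit measure is formed: the slope distribution is used at finite \<open>n\<close> and at
  scales at least \<open>\<gamma>^n\<close>, the order of the precision to which one pair of points
  determines a slope. Its smoothed L2 norm is a sum of overlap lengths of intervals, so that
  Cauchy--Schwarz is the positivity of an integral. One degenerate point spoils transversality
  there, but it also makes \<open>curv\<close> periodic everywhere, because degeneracy passes to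
  preimages, which are dense; integrating \<open>curv\<close> twice gives \<open>g\<close>. An
  endless sequence of such replacements is excluded by generating functions of the values of the
  derivatives at the points \<open>i / b^j\<close>: each replacement splits off a factor
  \<open>z - 1\<close>.\<close>

lemma hausdorff_content_le_finite_cover:
  fixes A :: "'a::metric_space set"
  assumes "s > 0" "d > 0" "d \<le> \<delta>"
    and cover: "A \<subseteq> (\<Union>p<m. U p)"
    and U: "\<And>p. p < m \<Longrightarrow> bounded (U p) \<and> diameter (U p) \<le> d"
  shows "hausdorff_content s \<delta> A \<le> ennreal (real m * d powr s)"
proof -
  define V where "V p = (if p < m then U p else {})" for p
  have "hausdorff_content s \<delta> A \<le> (\<Sum>i. ennreal (if V i = {} then 0 else diam_pow s (diameter (V i))))"
    unfolding hausdorff_content_def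
  proof (rule INF_lower, safe)
    fix x assume "x \<in> A"
    then obtain p where "p < m" "x \<in> U p" using cover by blast
    then have "x \<in> V p" by (simp add: V_def)
    then show "x \<in> \<Union> (range V)" by blast
  next
    show "bounded (V i)" "diameter (V i) \<le> \<delta>" for i
      using U[of i] assms(2,3) by (auto simp: V_def)
  qed
  also have "\<dots> = (\<Sum>i<m. ennreal (if V i = {} then 0 else diam_pow s (diameter (V i))))"
    by (rule suminf_finite) (auto simp: V_def)
  also have "\<dots> \<le> (\<Sum>i<m. ennreal (d powr s))"
  proof (intro sum_mono ennreal_leI)
    fix i assume "i \<in> {..<m}"
    then have "bounded (V i)" "diameter (V i) \<le> d" using U[of i] by (auto simp: V_def)
    then show "(if V i = {} then 0 else diam_pow s (diameter (V i))) \<le> d powr s"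
      using \<open>s > 0\<close> diameter_ge_0[of "V i"] by (auto simp: diam_pow_def intro!: powr_mono2)
  qed
  also have "\<dots> = ennreal (real m * d powr s)"
    by (simp add: ennreal_mult ennreal_of_nat_eq_real_of_nat)
  finally show ?thesis .
qed

lemma hausdorff_content_countable_Union_zero:
  fixes A :: "nat \<Rightarrow> 'a::metric_space set"
  assumes z: "\<And>i. hausdorff_content s \<delta> (A i) = 0"
  shows "hausdorff_content s \<delta> (\<Union>i. A i) = 0"
proof -
  let ?w = "\<lambda>V::'a set. ennreal (if V = {} then 0 else diam_pow s (diameter V))"
  have "hausdorff_content s \<delta> (\<Union>i. A i) \<le> 0 + ennreal e" if "e > 0" for e
  proof -
    have "\<forall>i. \<exists>U. A i \<subseteq> (\<Union>j. U j) \<and> (\<forall>j. bounded (U j) \<and> diameter (U j) \<le> \<delta>) \<and>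
        (\<Sum>j. ?w (U j)) < ennreal (e * (1/2)^Suc i)"
    proof
      fix i
      have "hausdorff_content s \<delta> (A i) < ennreal (e * (1/2)^Suc i)"
        using z that by simp
      then show "\<exists>U. A i \<subseteq> (\<Union>j. U j) \<and> (\<forall>j. bounded (U j) \<and> diameter (U j) \<le> \<delta>) \<and>
        (\<Sum>j. ?w (U j)) < ennreal (e * (1/2)^Suc i)"
        unfolding hausdorff_content_def INF_less_iff by blast
    qed
    from choice[OF this] obtain U where U: "\<And>i. A i \<subseteq> (\<Union>j. U i j)"
        "\<And>i j. bounded (U i j) \<and> diameter (U i j) \<le> \<delta>"
        "\<And>i. (\<Sum>j. ?w (U i j)) < ennreal (e * (1/2)^Suc i)"
      by blast
    define V where "V k = (case prod_decode k of (i, j) \<Rightarrow> U i j)" for k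
    have V: "V (prod_encode (i, j)) = U i j" for i j by (simp add: V_def)
    have "hausdorff_content s \<delta> (\<Union>i. A i) \<le> (\<Sum>k. ?w (V k))"
      unfolding hausdorff_content_def
    proof (rule INF_lower, safe)
      fix x i assume "x \<in> A i"
      then obtain j where "x \<in> U i j" using U(1) by blast
      then show "x \<in> \<Union> (range V)" using V by blast
    next
      show "bounded (V i)" "diameter (V i) \<le> \<delta>" for i
        using U(2) by (auto simp: V_def split: prod.splits)
    qed
    also have "\<dots> = (\<Sum>i. \<Sum>j. ?w (U i j))"
    proof -
      have "(\<Sum>k. (\<lambda>(i,j). ?w (U i j)) (prod_decode k)) = (\<Sum>i. \<Sum>j. ?w (U i j))"
        by (rule suminf_ennreal_2dimen) auto
      moreover have "?w (V k) = (\<lambda>(i,j). ?w (U i j)) (prod_decode k)" for k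
        by (auto simp: V_def split: prod.splits)
      ultimately show ?thesis by simp
    qed
    also have "\<dots> \<le> (\<Sum>i. ennreal (e * (1/2)^Suc i))"
      by (intro suminf_le summableI less_imp_le U(3))
    also have "\<dots> = ennreal (e * 1)"
      by (rule suminf_ennreal_eq, use that in simp) (rule sums_mult[OF power_half_series])
    finally show ?thesis by simp
  qed
  then have "hausdorff_content s \<delta> (\<Union>i. A i) \<le> 0"
    by (rule ennreal_le_epsilon)
  then show ?thesis by simp
qed

text \<open>Over a column of width \<open>h = b^(-n)\<close> the graph lies in a strip of height
  \<open>2 * C * l^n\<close>, which takes about \<open>(l * b)^n\<close> squares of side
  \<open>h\<close>. With \<open>b^n\<close> columns per unit interval the sum of
  \<open>h powr s\<close> is of order \<open>q^n\<close>, and \<open>q < 1\<close> exactly for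
  \<open>s\<close> above the claimed dimension.\<close>

lemma hausdorff_measure_graph_eq_0:
  fixes F :: "real \<Rightarrow> real" and b :: nat
  assumes b: "b \<ge> 2" and l: "0 < l" "1 < l * real b"
    and holder: "\<And>x y n. \<bar>x - y\<bar> \<le> (1 / real b) ^ n \<Longrightarrow> \<bar>F x - F y\<bar> \<le> C * l ^ n"
    and s: "s > 2 + ln l / ln (real b)"
  shows "hausdorff_measure s (graph_of F) = 0"
proof -
  have C: "C \<ge> 0" using holder[of 0 0 0] by simp
  have bpos: "real b > 1" using b by simp
  have "ln l > - ln (real b)" using l bpos by (smt (verit, best) ln_gt_zero ln_mult)
  then have "ln l / ln (real b) > -1" using bpos by (simp add: field_simps)
  with s have s0: "s > 0" by linarith
  define q where "q = l * real b ^ 2 * real b powr (-s)"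
  have q0: "q > 0" using l b by (simp add: q_def)
  have "ln q = ln l + 2 * ln (real b) - s * ln (real b)"
    using l bpos by (simp add: q_def ln_mult ln_powr ln_realpow)
  also have "\<dots> < 0"
    using s bpos by (simp add: field_simps)
  finally have q1: "q < 1" using q0 by simp
  define A where "A m = {(x, F x) | x. real_of_int m \<le> x \<and> x \<le> real_of_int m + 1}" for m :: int
  have "hausdorff_content s \<delta> (A m) = 0" if "\<delta> > 0" for m \<delta>
  proof -
    have bound: "hausdorff_content s \<delta> (A m) \<le> ennreal ((2 * C + 2) * 2 powr s * q ^ n)"
      if n: "2 * (1 / real b) ^ n \<le> \<delta>" for n
    proof -
      define h where "h = (1 / real b) ^ n"
      have h0: "h > 0" using b by (simp add: h_def)
      have bh: "real b ^ n * h = 1" using b by (simp add: h_def power_one_over)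
      define K where "K = nat \<lceil>2 * C * l ^ n / h\<rceil>"
      have Kge: "real K \<ge> 2 * C * l ^ n / h" by (simp add: K_def real_nat_ceiling_ge)
      define a where "a i = real_of_int m + real i * h" for i :: nat
      \<comment> \<open>\<open>p\<close> codes a column \<open>i\<close> and a row \<open>k\<close>;
        the rows start at the lowest value that the Hoelder bound allows around the left end
        \<open>a i\<close>.\<close>
      define U where "U p = (let i = p div (K+1); k = p mod (K+1) in
          {a i .. a i + h} \<times> {F (a i) - C * l^n + real k * h .. F (a i) - C * l^n + real k * h + h})" for p
      have cover: "A m \<subseteq> (\<Union>p<b^n*(K+1). U p)"
      proof
        fix z assume "z \<in> A m"
        then obtain x where x: "z = (x, F x)" "real_of_int m \<le> x" "x \<le> real_of_int m + 1"
          by (auto simp: A_def)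
        \<comment> \<open>The floor would send the right end of the interval to a column of index
          \<open>b^n\<close>, so that point is put into the last column.\<close>
        define i where "i = (if x = real_of_int m + 1 then b^n - 1 else nat \<lfloor>(x - real_of_int m) / h\<rfloor>)"
        have i: "i < b ^ n \<and> a i \<le> x \<and> x \<le> a i + h"
        proof (cases "x = real_of_int m + 1")
          case True
          have "a i = real_of_int m + 1 - h"
            using True b bh by (simp add: a_def i_def of_nat_diff algebra_simps)
          then show ?thesis using True h0 b by (simp add: i_def)
        next
          case False
          have "(x - real_of_int m) / h \<ge> 0" using x h0 by simp
          then have *: "real i \<le> (x - real_of_int m) / h" "(x - real_of_int m) / h < real i + 1"
            using False by (auto simp: i_def)
          have "(x - real_of_int m) / h < real b ^ n"
            using False x h0 bh by (simp add: field_simps)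
          then have "real i < real (b ^ n)" using * unfolding of_nat_power by linarith
          then show ?thesis using * h0 by (auto simp: a_def field_simps)
        qed
        have "\<bar>F x - F (a i)\<bar> \<le> C * l ^ n"
          by (rule holder) (use i in \<open>auto simp: h_def\<close>)
        define t where "t = (F x - F (a i) + C * l ^ n) / h"
        have t: "0 \<le> t" "t \<le> 2 * C * l^n / h"
          using \<open>\<bar>F x - F (a i)\<bar> \<le> C * l ^ n\<close> h0 by (auto simp: t_def divide_right_mono)
        define k where "k = nat \<lfloor>t\<rfloor>"
        have k: "real k \<le> t" "t < real k + 1" using t by (auto simp: k_def)
        have "k < K + 1" using k t Kge by linarith
        define p where "p = i * (K+1) + k"
        have p: "p div (K+1) = i" "p mod (K+1) = k"
          using \<open>k < K+1\<close> unfolding p_def by (simp_all del: add_Suc_right add_Suc mult_Suc_right mult_Suc add.commute)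
        have "p < b^n * (K+1)"
          using p i by (metis less_mult_imp_div_less div_less_iff_less_mult zero_less_Suc Suc_eq_plus1)
        moreover have "z \<in> U p"
        proof -
          have "t * h = F x - F (a i) + C * l ^ n" using h0 by (simp add: t_def)
          moreover have "real k * h \<le> t * h" "t * h \<le> (real k + 1) * h"
            using k h0 by (auto intro!: mult_right_mono)
          ultimately show ?thesis
            using i unfolding U_def p x Let_def by (auto simp: algebra_simps)
        qed
        ultimately show "z \<in> (\<Union>p<b^n*(K+1). U p)" by blast
      qed
      have "hausdorff_content s \<delta> (A m) \<le> ennreal (real (b^n*(K+1)) * (2 * h) powr s)"
      proof (rule hausdorff_content_le_finite_cover[OF _ _ _ cover])
        show "bounded (U p) \<and> diameter (U p) \<le> 2 * h" for p
        proof
          show "bounded (U p)" by (auto simp: U_def Let_def intro!: bounded_Times)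
          show "diameter (U p) \<le> 2 * h"
          proof (rule diameter_le)
            fix x y assume "x \<in> U p" "y \<in> U p"
            then have "\<bar>fst x - fst y\<bar> \<le> h" "\<bar>snd x - snd y\<bar> \<le> h"
              by (auto simp: U_def Let_def)
            moreover have "norm (x - y) \<le> norm (fst (x - y)) + norm (snd (x - y))"
              by (metis norm_Pair_le prod.collapse)
            ultimately show "norm (x - y) \<le> 2 * h" by simp
          qed (use h0 in auto)
        qed
      qed (use s0 h0 n in \<open>auto simp: h_def\<close>)
      also have "\<dots> \<le> ennreal ((2 * C + 2) * 2 powr s * q ^ n)"
      proof (rule ennreal_leI)
        have lb: "(l * real b) ^ n \<ge> 1" using l by (simp add: one_le_power)
        have "real K + 1 \<le> 2 * C * l ^ n / h + 2"
          unfolding K_def using C l h0 by (simp add: of_nat_ceiling) linarith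
        have hl: "l ^ n / h = (l * real b) ^ n"
          by (simp add: h_def power_mult_distrib power_one_over)
        have "2 * C * l ^ n / h = 2 * C * (l * real b) ^ n"
          unfolding hl[symmetric] by simp
        then have "real K + 1 \<le> (2 * C + 2) * (l * real b) ^ n"
          using \<open>real K + 1 \<le> 2 * C * l ^ n / h + 2\<close> lb unfolding distrib_right by linarith
        have "h powr s = (real b powr (-s)) ^ n"
          using b by (simp add: h_def powr_minus powr_realpow[symmetric] powr_powr power_one_over
              powr_divide inverse_eq_divide mult.commute)
        then have hs: "(2 * h) powr s = 2 powr s * (real b powr (-s)) ^ n"
          using h0 by (simp add: powr_mult)
        have "real (b^n*(K+1)) * (2 * h) powr s = real b ^ n * ((real K + 1) * (2 powr s * (real b powr (-s)) ^ n))"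
          unfolding hs by (simp add: algebra_simps)
        also have "\<dots> \<le> real b ^ n * (((2 * C + 2) * (l * real b) ^ n) * (2 powr s * (real b powr (-s)) ^ n))"
          by (intro mult_left_mono mult_right_mono \<open>real K + 1 \<le> (2 * C + 2) * (l * real b) ^ n\<close>) auto
        also have "\<dots> = (2 * C + 2) * 2 powr s * q ^ n"
          unfolding q_def by (simp add: power_mult_distrib power2_eq_square mult_ac)
        finally show "real (b^n*(K+1)) * (2 * h) powr s \<le> (2 * C + 2) * 2 powr s * q ^ n" .
      qed
      finally show ?thesis .
    qed
    have lim: "(\<lambda>n. ennreal ((2 * C + 2) * 2 powr s * q ^ n)) \<longlonglongrightarrow> ennreal ((2 * C + 2) * 2 powr s * 0)"
      using q0 q1 by (intro tendsto_ennrealI tendsto_mult tendsto_const LIMSEQ_power_zero) auto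
    have "(\<lambda>n. 2 * (1 / real b) ^ n) \<longlonglongrightarrow> 2 * 0"
      using bpos by (intro tendsto_mult tendsto_const LIMSEQ_power_zero) auto
    then have "\<forall>\<^sub>F n in sequentially. 2 * (1 / real b) ^ n < \<delta>"
      using that by (intro order_tendstoD(2)[where y=0]) auto
    then have "\<forall>\<^sub>F n in sequentially. hausdorff_content s \<delta> (A m) \<le> ennreal ((2 * C + 2) * 2 powr s * q ^ n)"
      by (rule eventually_mono) (use bound in force)
    then have "hausdorff_content s \<delta> (A m) \<le> ennreal ((2 * C + 2) * 2 powr s * 0)"
      by (rule tendsto_lowerbound[OF lim]) auto
    then show ?thesis by simp
  qed
  moreover have "graph_of F = (\<Union>i. A (from_nat i))"
  proof safe
    fix x y assume "(x, y) \<in> graph_of F"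
    moreover have "real_of_int \<lfloor>x\<rfloor> \<le> x \<and> x \<le> real_of_int \<lfloor>x\<rfloor> + 1" by linarith
    ultimately have "(x, y) \<in> A \<lfloor>x\<rfloor>" by (auto simp: A_def graph_of_def)
    then show "(x, y) \<in> (\<Union>i. A (from_nat i))" by (metis UN_I UNIV_I from_nat_to_nat)
  qed (auto simp: A_def graph_of_def)
  ultimately have "hausdorff_content s \<delta> (graph_of F) = 0" if "\<delta> > 0" for \<delta>
    using that by (simp add: hausdorff_content_countable_Union_zero)
  then have "(SUP \<delta>\<in>{0<..}. hausdorff_content s \<delta> (graph_of F)) = (SUP \<delta>\<in>{0::real<..}. 0)"
    by (intro SUP_cong) auto
  then show ?thesis by (simp add: hausdorff_measure_def)
qed

text \<open>The hypothesis of the mass distribution principle for Lebesgue measure lifted to the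
  graph, with squares for balls. It is asked only at centres over a set \<open>E\<close> of positive
  measure, since the construction controls the mass only off a small exceptional set.\<close>

definition graph_frostman :: "(real \<Rightarrow> real) \<Rightarrow> real \<Rightarrow> bool" where
  "graph_frostman F D \<longleftrightarrow> (\<forall>s. 0 \<le> s \<and> s < D \<longrightarrow> (\<exists>E c. E \<in> sets lborel \<and> emeasure lborel E > 0 \<and>
     (\<forall>x\<in>E. \<forall>r. 0 < r \<longrightarrow> r \<le> 1 \<longrightarrow>
        emeasure lborel {y. \<bar>x - y\<bar> \<le> r \<and> \<bar>F x - F y\<bar> \<le> r} \<le> ennreal (c * r powr s))))"

text \<open>Mass distribution principle: a cover of small total weight would, through squares around
  points over \<open>E\<close>, cover \<open>E\<close> by sets of total measure less than
  \<open>e\<close>.\<close>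

lemma hausdorff_measure_graph_pos:
  fixes F :: "real \<Rightarrow> real"
  assumes cont: "continuous_on UNIV F" and fro: "graph_frostman F D" and s: "0 \<le> s" "s < D"
  shows "hausdorff_measure s (graph_of F) \<noteq> 0"
proof
  assume zero: "hausdorff_measure s (graph_of F) = 0"
  obtain E c0 where E: "E \<in> sets lborel" "emeasure lborel E > 0"
    and c0: "\<And>x r. x \<in> E \<Longrightarrow> 0 < r \<Longrightarrow> r \<le> 1 \<Longrightarrow>
        emeasure lborel {y. \<bar>x - y\<bar> \<le> r \<and> \<bar>F x - F y\<bar> \<le> r} \<le> ennreal (c0 * r powr s)"
  proof -
    from fro[unfolded graph_frostman_def, rule_format, OF conjI[OF s]]
    obtain E where "\<exists>c. E \<in> sets lborel \<and> emeasure lborel E > 0 \<and>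
       (\<forall>x\<in>E. \<forall>r. 0 < r \<longrightarrow> r \<le> 1 \<longrightarrow>
          emeasure lborel {y. \<bar>x - y\<bar> \<le> r \<and> \<bar>F x - F y\<bar> \<le> r} \<le> ennreal (c * r powr s))" ..
    then obtain c0 where *: "E \<in> sets lborel \<and> emeasure lborel E > 0 \<and>
       (\<forall>x\<in>E. \<forall>r. 0 < r \<longrightarrow> r \<le> 1 \<longrightarrow>
          emeasure lborel {y. \<bar>x - y\<bar> \<le> r \<and> \<bar>F x - F y\<bar> \<le> r} \<le> ennreal (c0 * r powr s))" ..
    show ?thesis
      by (rule that[of E c0]) (use * in simp_all)
  qed
  define c where "c = max c0 1"
  have c: "c > 0" by (simp add: c_def)
  have c_bd: "emeasure lborel {y. \<bar>x - y\<bar> \<le> r \<and> \<bar>F x - F y\<bar> \<le> r} \<le> ennreal (c * r powr s)"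
    if "x \<in> E" "0 < r" "r \<le> 1" for x r
    by (rule order_trans[OF c0[OF that]]) (auto simp: c_def intro!: ennreal_leI mult_right_mono)
  have "hausdorff_content s 1 (graph_of F) \<le> hausdorff_measure s (graph_of F)"
    unfolding hausdorff_measure_def by (rule SUP_upper) auto
  then have "hausdorff_content s 1 (graph_of F) = 0" using zero by simp
  \<comment> \<open>\<open>E\<close> may have infinite measure; any finite positive lower bound will
    do.\<close>
  define e where "e = (if emeasure lborel E = top then 1 else enn2real (emeasure lborel E))"
  have e: "e > 0" "ennreal e \<le> emeasure lborel E"
    using E(2) by (auto simp: e_def enn2real_positive_iff less_top[symmetric])
  have "hausdorff_content s 1 (graph_of F) < ennreal (e / c)"
    using e c \<open>hausdorff_content s 1 (graph_of F) = 0\<close> by simp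
  then have "\<exists>U\<in>{U. graph_of F \<subseteq> (\<Union>i. U i) \<and> (\<forall>i. bounded (U i) \<and> diameter (U i) \<le> 1)}.
      (\<Sum>i. ennreal (if U i = {} then 0 else diam_pow s (diameter (U i)))) < ennreal (e / c)"
    unfolding hausdorff_content_def INF_less_iff by simp
  then obtain U where U0: "U \<in> {U. graph_of F \<subseteq> (\<Union>i. U i) \<and> (\<forall>i. bounded (U i) \<and> diameter (U i) \<le> 1)}"
      "(\<Sum>i. ennreal (if U i = {} then 0 else diam_pow s (diameter (U i)))) < ennreal (e / c)" ..
  then have U: "graph_of F \<subseteq> (\<Union>i. U i)" "\<And>i. bounded (U i)" "\<And>i. diameter (U i) \<le> 1"
      "(\<Sum>i. ennreal (if U i = {} then 0 else diam_pow s (diameter (U i)))) < ennreal (e / c)"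
    by simp_all
  \<comment> \<open>A covering set is replaced by the square around one of its points over
    \<open>E\<close> with its diameter as radius, since the hypothesis speaks of such centres
    only.\<close>
  define N where "N i = (if \<exists>x\<in>E. (x, F x) \<in> U i
      then let x = (SOME x. x \<in> E \<and> (x, F x) \<in> U i); d = diameter (U i) in {y. \<bar>x - y\<bar> \<le> d \<and> \<bar>F x - F y\<bar> \<le> d}
      else {})" for i
  have closed_N: "closed {y. \<bar>x - y\<bar> \<le> d \<and> \<bar>F x - F y\<bar> \<le> d}" for x d
    by (intro closed_Collect_conj closed_Collect_le continuous_intros cont)
  then have N_meas: "N i \<in> sets lborel" for i
    by (auto simp: N_def Let_def)
  have "E \<subseteq> (\<Union>i. N i)"
  proof
    fix y assume y: "y \<in> E"
    then obtain i where i: "(y, F y) \<in> U i" using U(1) by (auto simp: graph_of_def)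
    define x where "x = (SOME x. x \<in> E \<and> (x, F x) \<in> U i)"
    have x: "x \<in> E" "(x, F x) \<in> U i" unfolding x_def by (rule someI2_ex; use y i in blast)+
    have "dist (x, F x) (y, F y) \<le> diameter (U i)"
      by (rule diameter_bounded_bound[OF U(2) x(2) i])
    then have "dist x y \<le> diameter (U i)" "dist (F x) (F y) \<le> diameter (U i)"
      using dist_fst_le[of "(x, F x)" "(y, F y)"] dist_snd_le[of "(x, F x)" "(y, F y)"] by auto
    then have "y \<in> N i" using y i by (auto simp: N_def x_def[symmetric] Let_def dist_real_def)
    then show "y \<in> (\<Union>i. N i)" by blast
  qed
  have N_le: "emeasure lborel (N i) \<le> ennreal c * ennreal (if U i = {} then 0 else diam_pow s (diameter (U i)))" for i
  proof (cases "\<exists>x\<in>E. (x, F x) \<in> U i")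
    case True
    define x where "x = (SOME x. x \<in> E \<and> (x, F x) \<in> U i)"
    have x: "x \<in> E" "(x, F x) \<in> U i" unfolding x_def by (rule someI2_ex; use True in blast)+
    define d where "d = diameter (U i)"
    have Ni: "N i = {y. \<bar>x - y\<bar> \<le> d \<and> \<bar>F x - F y\<bar> \<le> d}"
      using True by (simp add: N_def x_def d_def Let_def)
    show ?thesis
    \<comment> \<open>Diameter 0 is outside the Frostman bound, but then the square meets the graph
      in a single point, which has measure 0.\<close>
    proof (cases "d > 0")
      case True
      have "emeasure lborel (N i) \<le> ennreal (c * d powr s)"
        unfolding Ni using c_bd[OF x(1) True] U(3)[of i] by (simp add: d_def)
      then show ?thesis using x True c by (auto simp: diam_pow_def d_def[symmetric] ennreal_mult)
    next
      case False
      then have "N i \<subseteq> {x}" by (auto simp: Ni)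
      then have "emeasure lborel (N i) \<le> emeasure lborel {x}" by (intro emeasure_mono) auto
      then show ?thesis by simp
    qed
  next
    case False
    then have "N i = {}" by (simp add: N_def)
    then show ?thesis by simp
  qed
  have "emeasure lborel E \<le> emeasure lborel (\<Union>i. N i)"
    using \<open>E \<subseteq> (\<Union>i. N i)\<close> N_meas by (intro emeasure_mono) auto
  also have "\<dots> \<le> (\<Sum>i. emeasure lborel (N i))"
    using N_meas by (intro emeasure_subadditive_countably) auto
  also have "\<dots> \<le> (\<Sum>i. ennreal c * ennreal (if U i = {} then 0 else diam_pow s (diameter (U i))))"
    by (intro suminf_le summableI N_le)
  also have "\<dots> = ennreal c * (\<Sum>i. ennreal (if U i = {} then 0 else diam_pow s (diameter (U i))))"
    by simp
  also have "\<dots> < ennreal c * ennreal (e / c)"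
    using U(4) c by (intro ennreal_mult_strict_left_mono) auto
  also have "\<dots> = ennreal e" using c e by (simp add: ennreal_mult[symmetric])
  finally show False using e by simp
qed

lemma hausdorff_dim_graph_eq:
  fixes F :: "real \<Rightarrow> real" and b :: nat
  assumes "continuous_on UNIV F"
    and b: "b \<ge> 2" and l: "0 < l" "1 < l * real b"
    and holder: "\<And>x y n. \<bar>x - y\<bar> \<le> (1 / real b) ^ n \<Longrightarrow> \<bar>F x - F y\<bar> \<le> C * l ^ n"
    and fro: "graph_frostman F (2 + ln l / ln (real b))"
  shows "hausdorff_dim (graph_of F) = 2 + ln l / ln (real b)"
proof -
  let ?D = "2 + ln l / ln (real b)"
  let ?S = "{s. 0 \<le> s \<and> hausdorff_measure s (graph_of F) = 0}"
  have lower: "?D \<le> s" if "s \<in> ?S" for s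
    using hausdorff_measure_graph_pos[OF assms(1) fro, of s] that by force
  have "ln l > - ln (real b)" using l b by (smt (verit, best) ln_gt_zero ln_mult of_nat_0_less_iff)
  then have "ln l / ln (real b) > -1" using b by (simp add: field_simps)
  then have D0: "?D > 0" by linarith
  have upper: "s \<in> ?S" if "s > ?D" for s
    using hausdorff_measure_graph_eq_0[OF b l holder that] that D0 by simp
  show ?thesis unfolding hausdorff_dim_def
  proof (rule antisym)
    show "Inf ?S \<le> ?D"
    proof (rule field_le_epsilon)
      fix e :: real assume "e > 0"
      then have "?D + e \<in> ?S" by (intro upper) simp
      then show "Inf ?S \<le> ?D + e" by (intro cInf_lower bdd_belowI[of _ 0]) auto
    qed
    show "?D \<le> Inf ?S"
    proof (rule cInf_greatest)
      show "?S \<noteq> {}" using upper[of "?D + 1"] by auto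
    qed (use lower in auto)
  qed
qed

section \<open>Periodic functions and coboundaries\<close>

lemma shift_int_if_shift_1:
  fixes h :: "real \<Rightarrow> 'a"
  assumes "\<And>x. h (x + 1) = h x"
  shows "h (x + of_int k) = h x"
proof (induction k rule: int_induct[where k=0])
  case (step1 i)
  then show ?case using assms[of "x + of_int i"] by (simp add: add.assoc)
next
  case (step2 i)
  then show ?case using assms[of "x + of_int (i - 1)"] by (simp add: add.assoc)
qed simp

lemma bounded_if_shift_1:
  fixes h :: "real \<Rightarrow> real"
  assumes "\<And>x. h (x + 1) = h x" "continuous_on UNIV h"
  shows "\<exists>B. \<forall>x. \<bar>h x\<bar> \<le> B"
proof -
  have "compact (h ` {0..1})"
    using assms(2) by (intro compact_continuous_image continuous_on_subset[OF assms(2)]) auto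
  then obtain B where B: "\<And>x. x \<in> {0..1} \<Longrightarrow> \<bar>h x\<bar> \<le> B"
    using compact_imp_bounded[of "h ` {0..1}"] unfolding bounded_iff by force
  have "\<bar>h x\<bar> \<le> B" for x
    using shift_int_if_shift_1[of h "frac x" "\<lfloor>x\<rfloor>", OF assms(1)] B[of "frac x"] frac_lt_1[of x]
    by (simp add: frac_def)
  then show ?thesis by blast
qed

lemma uniformly_continuous_if_shift_1:
  fixes h :: "real \<Rightarrow> real"
  assumes per: "\<And>x. h (x + 1) = h x" and cont: "continuous_on UNIV h" and "e > 0"
  shows "\<exists>d>0. \<forall>x y. \<bar>x - y\<bar> < d \<longrightarrow> \<bar>h x - h y\<bar> < e"
proof -
  have "uniformly_continuous_on {-1..2} h"
    by (intro compact_uniformly_continuous continuous_on_subset[OF cont]) auto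
  then obtain d where d: "d > 0" "\<And>x y. x \<in> {-1..2} \<Longrightarrow> y \<in> {-1..2} \<Longrightarrow> \<bar>x - y\<bar> < d \<Longrightarrow> \<bar>h x - h y\<bar> < e"
    using \<open>e > 0\<close> unfolding uniformly_continuous_on_def dist_real_def by metis
  have "\<bar>h x - h y\<bar> < e" if "\<bar>x - y\<bar> < min d 1" for x y
  proof -
    \<comment> \<open>Both points are moved by the same integer, so the second may leave
      \<open>[0, 1]\<close> by less than 1; hence the larger interval.\<close>
    let ?x = "x + of_int (- \<lfloor>x\<rfloor>)" and ?y = "y + of_int (- \<lfloor>x\<rfloor>)"
    have "?x \<in> {0..1}" by (simp, linarith)
    moreover have "\<bar>?x - ?y\<bar> < d" "\<bar>?x - ?y\<bar> < 1" using that by simp_all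
    moreover from calculation have "?x \<in> {-1..2}" "?y \<in> {-1..2}"
      unfolding atLeastAtMost_iff by linarith+
    ultimately have "\<bar>h ?x - h ?y\<bar> < e" by (intro d(2))
    then show ?thesis
      using shift_int_if_shift_1[of h, OF per] by metis
  qed
  then show ?thesis using d(1) by (intro exI[of _ "min d 1"]) auto
qed

text \<open>The recursion says that the generating functions satisfy \<open>A k z = (z - 1) * A (k + 1) z\<close> on the disc of
  radius 2, so \<open>A 0\<close> has a zero of infinite order at 1.\<close>

lemma eq_0_if_divisible_by_all_powers:
  fixes a :: "nat \<Rightarrow> nat \<Rightarrow> complex"
  assumes a0: "\<And>k. a k 0 = 0"
    and rec: "\<And>k j. a k (Suc j) = a (Suc k) j - a (Suc k) (Suc j)"
    and bound: "\<And>k j. norm (a k j) \<le> C k * (1/2) ^ j"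
  shows "a 0 j = 0"
proof -
  define A where "A k z = (\<Sum>j. a k j * z ^ j)" for k and z :: complex
  have sumb: "summable (\<lambda>j. a k j * z ^ j)" if "z \<in> ball 0 2" for k z
  proof (rule summable_comparison_test')
    show "summable (\<lambda>j. C k * (norm z / 2) ^ j)"
      using that by (intro summable_mult summable_geometric) auto
    fix j :: nat assume "j \<ge> 0"
    have "norm (a k j * z ^ j) \<le> C k * (1/2)^j * norm z ^ j"
      unfolding norm_mult norm_power by (intro mult_right_mono bound) auto
    then show "norm (a k j * z ^ j) \<le> C k * (norm z / 2) ^ j"
      by (simp add: power_divide)
  qed
  then have sums: "(\<lambda>j. a k j * z ^ j) sums A k z" if "z \<in> ball 0 2" for k z
    using that unfolding A_def by (intro summable_sums) auto
  have holo: "A k holomorphic_on ball 0 2" for k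
    by (rule power_series_holomorphic[where a="a k"]) (use sums in auto)
  have step: "A k z = (z - 1) * A (Suc k) z" if z: "z \<in> ball 0 2" for k z
  proof -
    have "(\<lambda>j. a (Suc k) (Suc j) * z ^ Suc j) sums A (Suc k) z"
      using sums[OF z, of "Suc k"] by (subst sums_Suc_iff) (simp add: a0)
    moreover have "(\<lambda>j. a (Suc k) j * z ^ j * z) sums (A (Suc k) z * z)"
      using sums[OF z, of "Suc k"] by (rule sums_mult2)
    ultimately have "(\<lambda>j. a (Suc k) j * z ^ j * z - a (Suc k) (Suc j) * z ^ Suc j) sums (A (Suc k) z * z - A (Suc k) z)"
      by (intro sums_diff)
    moreover have "a (Suc k) j * z ^ j * z - a (Suc k) (Suc j) * z ^ Suc j = a k (Suc j) * z ^ Suc j" for j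
      unfolding rec[of k j] by (simp add: algebra_simps)
    moreover have "(\<lambda>j. a k (Suc j) * z ^ Suc j) sums A k z"
      using sums[OF z, of k] by (subst sums_Suc_iff) (simp add: a0)
    ultimately show ?thesis
      by (metis (no_types, lifting) sums_unique2 ext left_diff_distrib' mult.commute mult_1)
  qed
  have fac: "A 0 z = (z - 1) ^ k * A k z" if "z \<in> ball 0 2" for k z
  proof (induction k)
    case (Suc k)
    then show ?case unfolding step[OF that, of k] by (simp add: mult_ac)
  qed simp
  \<comment> \<open>If \<open>A 0\<close> were not constant, 1 would be a zero of finite order
    \<open>n\<close> with a cofactor \<open>g\<close> that is nonzero there; but
    \<open>n + 1\<close> factors split off, so \<open>g\<close> tends to 0 at 1.\<close>
  have "A 0 constant_on ball 0 2"
  proof (rule ccontr)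
    assume nc: "\<not> A 0 constant_on ball 0 2"
    have "A 0 1 = 0" using step[of 1 0] by simp
    obtain g r n where g: "0 < n" "0 < r" "ball 1 r \<subseteq> ball (0::complex) 2" "g holomorphic_on ball 1 r"
      "\<And>w. w \<in> ball 1 r \<Longrightarrow> A 0 w = (w - 1) ^ n * g w" "\<And>w. w \<in> ball 1 r \<Longrightarrow> g w \<noteq> 0"
      by (rule holomorphic_factor_zero_nonconstant[OF holo[of 0] _ _ _ \<open>A 0 1 = 0\<close> nc]) auto
    have eq: "g w = (w - 1) * A (Suc n) w" if "w \<in> ball 1 r - {1}" for w
    proof -
      have "w \<in> ball 0 2" using that g(3) by blast
      then have "(w - 1) ^ n * g w = (w - 1) ^ Suc n * A (Suc n) w"
        using fac[of w "Suc n"] g(5)[of w] that by simp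
      then have "(w - 1) ^ n * (g w - (w - 1) * A (Suc n) w) = 0" by (simp add: algebra_simps)
      then show ?thesis using that by simp
    qed
    have "isCont g 1"
      using g(2,4) by (metis centre_in_ball continuous_on_eq_continuous_at holomorphic_on_imp_continuous_on open_ball)
    then have "g \<midarrow>1\<rightarrow> g 1" by (simp add: isCont_def)
    moreover have "isCont (\<lambda>w. (w - 1) * A (Suc n) w) 1"
    proof -
      have "isCont (A (Suc n)) 1"
        using holo[of "Suc n"] by (intro continuous_on_interior[OF holomorphic_on_imp_continuous_on]) auto
      then show ?thesis by (intro continuous_intros)
    qed
    then have "(\<lambda>w. (w - 1) * A (Suc n) w) \<midarrow>1\<rightarrow> 0" by (simp add: isCont_def)
    then have "g \<midarrow>1\<rightarrow> 0"
    proof (rule Lim_transform_eventually)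
      show "\<forall>\<^sub>F w in at 1. (w - 1) * A (Suc n) w = g w"
        unfolding eventually_at using g(2) eq by (intro exI[of _ r]) (auto simp: dist_commute)
    qed
    ultimately have "g 1 = 0" using LIM_unique by blast
    then show False using g(2,6) by auto
  qed
  then have zero: "A 0 z = 0" if "z \<in> ball 0 2" for z
    using step[of 1 0] that unfolding constant_on_def by auto
  show ?thesis
  proof (rule ccontr)
    assume j: "a 0 j \<noteq> 0"
    then have "j > 0" using a0 by (cases j) auto
    obtain s where "0 < s" "\<And>z. z \<in> cball 0 s - {0} \<Longrightarrow> A 0 z \<noteq> 0"
      by (rule powser_0_nonzero[of 2 0 "a 0" "A 0" j]) (use sums[of _ 0] zero j \<open>j > 0\<close> in auto)
    moreover define z where "z = complex_of_real (min s 1)"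
    ultimately have "A 0 z \<noteq> 0" by auto
    moreover have "norm z \<le> 1" using \<open>0 < s\<close> unfolding z_def norm_of_real by simp
    then have "z \<in> ball 0 2" by simp
    ultimately show False using zero by blast
  qed
qed

text \<open>The derivatives are parameters because the replacement of \<open>\<phi>\<close> by
  \<open>g\<close> delivers the next triple directly, with \<open>curv\<close> as its second
  derivative.\<close>

locale c2_periodic =
  fixes \<phi> \<psi> \<theta> :: "real \<Rightarrow> real" and b :: nat
  assumes per: "\<phi> (x + 1) = \<phi> x"
    and deriv1: "(\<phi> has_real_derivative \<psi> x) (at x)"
    and deriv2: "(\<psi> has_real_derivative \<theta> x) (at x)"
    and cont2: "continuous_on UNIV \<theta>"
    and b2: "2 \<le> b"
begin

lemma per1: "\<psi> (x + 1) = \<psi> x"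
proof -
  have "((\<lambda>x. \<phi> (x + 1)) has_real_derivative \<psi> (x + 1)) (at x)"
    using deriv1[of "x + 1"] by (simp add: DERIV_shift)
  then show ?thesis using deriv1[of x] by (simp add: per DERIV_unique)
qed

lemma per2: "\<theta> (x + 1) = \<theta> x"
proof -
  have "((\<lambda>x. \<psi> (x + 1)) has_real_derivative \<theta> (x + 1)) (at x)"
    using deriv2[of "x + 1"] by (simp add: DERIV_shift)
  then show ?thesis using deriv2[of x] by (simp add: per1 DERIV_unique)
qed

lemma cont0: "continuous_on UNIV \<phi>" and cont1: "continuous_on UNIV \<psi>"
  using deriv1 deriv2 by (auto intro!: continuous_at_imp_continuous_on DERIV_isCont)

lemmas per_int = shift_int_if_shift_1[of \<phi>, OF per]
lemmas per1_int = shift_int_if_shift_1[of \<psi>, OF per1]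
lemmas per2_int = shift_int_if_shift_1[of \<theta>, OF per2]

lemma bounds:
  "\<exists>M>0. \<forall>x. \<bar>\<phi> x\<bar> \<le> M \<and> \<bar>\<psi> x\<bar> \<le> M \<and> \<bar>\<theta> x\<bar> \<le> M"
proof -
  obtain B0 B1 B2 where "\<And>x. \<bar>\<phi> x\<bar> \<le> B0" "\<And>x. \<bar>\<psi> x\<bar> \<le> B1" "\<And>x. \<bar>\<theta> x\<bar> \<le> B2"
    using bounded_if_shift_1[OF per cont0] bounded_if_shift_1[OF per1 cont1]
      bounded_if_shift_1[OF per2 cont2] by metis
  then show ?thesis
    by (intro exI[of _ "max 1 (max B0 (max B1 B2))"]) (auto simp: le_max_iff_disj)
qed

lemma b_pos: "real b > 0" "real b > 1" "real b \<ge> 2"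
  using b2 by auto

text \<open>\<open>curv (u + j)\<close> is the derivative in \<open>u\<close> of the slope along the digits of \<open>j\<close>, in the limit \<open>\<gamma> = 1\<close>.\<close>

definition curv :: "real \<Rightarrow> real" where
  "curv x = (\<Sum>k. (1 / real b) ^ Suc k * \<theta> (x / real b ^ Suc k))"

lemma geometric_sums_le_1:
  "summable (\<lambda>k. (1 / real b) ^ Suc k)" "(\<Sum>k. (1 / real b) ^ Suc k) \<le> 1"
proof -
  have "(\<lambda>k. (1 / real b) ^ k) sums (1 / (1 - 1 / real b))"
    using b_pos by (intro geometric_sums) auto
  then have *: "(\<lambda>k. (1 / real b) * (1 / real b) ^ k) sums ((1 / real b) * (1 / (1 - 1 / real b)))"
    by (rule sums_mult)
  then show "summable (\<lambda>k. (1 / real b) ^ Suc k)" by (simp add: sums_iff)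
  have "(\<Sum>k. (1 / real b) ^ Suc k) = (1 / real b) * (1 / (1 - 1 / real b))"
    using * by (simp add: sums_iff)
  also have "\<dots> \<le> 1" using b_pos by (simp add: divide_simps)
  finally show "(\<Sum>k. (1 / real b) ^ Suc k) \<le> 1" .
qed

lemma curv_summable: "summable (\<lambda>k. (1 / real b) ^ Suc k * \<theta> (x / real b ^ Suc k))"
proof -
  obtain M where M: "M > 0" "\<And>x. \<bar>\<theta> x\<bar> \<le> M" using bounds by blast
  show ?thesis
  proof (rule summable_comparison_test')
    show "summable (\<lambda>k. (1 / real b) ^ Suc k * M)"
      using geometric_sums_le_1(1) by (rule summable_mult2)
    show "norm ((1 / real b) ^ Suc k * \<theta> (x / real b ^ Suc k)) \<le> (1 / real b) ^ Suc k * M" if "k \<ge> 0" for k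
      unfolding norm_mult by (intro mult_mono) (use M in auto)
  qed
qed

text \<open>Read as \<open>\<theta> x = b * curv (b * x) - curv x\<close>, this is a cohomological
  equation for \<open>\<theta>\<close>; integrated twice it becomes one for \<open>\<phi>\<close>,
  up to affine terms.\<close>

lemma curv_rec: "curv (real b * x) = (\<theta> x + curv x) / real b"
proof -
  have "curv (real b * x) = (1 / real b) * \<theta> x + (\<Sum>k. (1 / real b) ^ Suc (Suc k) * \<theta> (real b * x / real b ^ Suc (Suc k)))"
    unfolding curv_def using suminf_split_head[OF curv_summable[of "real b * x"]] b_pos by simp
  also have "(\<Sum>k. (1 / real b) ^ Suc (Suc k) * \<theta> (real b * x / real b ^ Suc (Suc k))) = (1 / real b) * curv x"
    unfolding curv_def using curv_summable[of x] b_pos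
    by (subst suminf_mult[symmetric]) (auto simp: mult.assoc)
  finally show ?thesis by (simp add: add_divide_distrib)
qed

lemma curv_uniformly_continuous:
  assumes "e > 0"
  shows "\<exists>d>0. \<forall>x y. \<bar>x - y\<bar> < d \<longrightarrow> \<bar>curv x - curv y\<bar> \<le> e"
proof -
  obtain d where d: "d > 0" "\<And>x y. \<bar>x - y\<bar> < d \<Longrightarrow> \<bar>\<theta> x - \<theta> y\<bar> < e"
    using uniformly_continuous_if_shift_1[OF per2 cont2 assms] by blast
  have "\<bar>curv x - curv y\<bar> \<le> e" if xy: "\<bar>x - y\<bar> < d" for x y
  proof -
    let ?f = "\<lambda>k. (1 / real b) ^ Suc k * \<theta> (x / real b ^ Suc k) - (1 / real b) ^ Suc k * \<theta> (y / real b ^ Suc k)"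
    have le: "\<bar>?f k\<bar> \<le> (1 / real b) ^ Suc k * e" for k
    proof -
      have "real b ^ Suc k \<ge> 1" using b_pos by (intro one_le_power) auto
      then have "\<bar>x / real b ^ Suc k - y / real b ^ Suc k\<bar> \<le> \<bar>x - y\<bar>"
        by (simp add: diff_divide_distrib[symmetric] divide_le_eq mult_le_cancel_left1 del: power_Suc)
      then have "\<bar>\<theta> (x / real b ^ Suc k) - \<theta> (y / real b ^ Suc k)\<bar> \<le> e"
        using d(2) xy by (meson less_imp_le order_le_less_trans)
      then show ?thesis unfolding right_diff_distrib[symmetric] abs_mult
        by (intro mult_mono) auto
    qed
    have sm: "summable (\<lambda>k. (1 / real b) ^ Suc k * e)"
      by (rule summable_mult2[OF geometric_sums_le_1(1)])
    have "\<bar>curv x - curv y\<bar> = \<bar>\<Sum>k. ?f k\<bar>"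
      unfolding curv_def by (simp add: suminf_diff[OF curv_summable curv_summable] del: power_Suc)
    also have "\<dots> \<le> (\<Sum>k. (1 / real b) ^ Suc k * e)"
    proof -
      have s: "summable (\<lambda>k. \<bar>?f k\<bar>)"
        by (rule summable_comparison_test'[OF sm]) (use le in auto)
      then have "\<bar>\<Sum>k. ?f k\<bar> \<le> (\<Sum>k. \<bar>?f k\<bar>)" by (rule summable_rabs)
      also have "\<dots> \<le> (\<Sum>k. (1 / real b) ^ Suc k * e)" by (rule suminf_le[OF le s sm])
      finally show ?thesis .
    qed
    also have "\<dots> = (\<Sum>k. (1 / real b) ^ Suc k) * e"
      by (rule suminf_mult2[OF geometric_sums_le_1(1), symmetric])
    also have "\<dots> \<le> 1 * e" by (intro mult_right_mono geometric_sums_le_1) (use assms in auto)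
    finally show ?thesis by simp
  qed
  then show ?thesis using d(1) by blast
qed

lemma curv_continuous: "continuous_on UNIV curv"
  unfolding continuous_on_iff dist_real_def
proof (intro ballI allI impI)
  fix x e :: real assume "0 < e"
  then obtain d where "d > 0" "\<And>x y. \<bar>x - y\<bar> < d \<Longrightarrow> \<bar>curv x - curv y\<bar> \<le> e / 2"
    using curv_uniformly_continuous[of "e / 2"] by auto
  then show "\<exists>d>0. \<forall>y\<in>UNIV. \<bar>y - x\<bar> < d \<longrightarrow> \<bar>curv y - curv x\<bar> < e"
    using \<open>0 < e\<close> by (intro exI[of _ d]) (auto intro: le_less_trans[of _ "e / 2"])
qed

text \<open>In the limit \<open>\<gamma> = 1\<close> the slopes of all words have the same
  derivative at \<open>u\<close>, so no two words can be told apart there.\<close>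

definition degenerate_at :: "real \<Rightarrow> bool" where
  "degenerate_at u \<longleftrightarrow> (\<forall>j :: int. curv (u + of_int j) = curv u)"

text \<open>Multiplication by \<open>b\<close> turns integer shifts of the preimage into integer
  shifts of \<open>u\<close>. In \<open>curv_rec\<close> the periodic \<open>\<theta>\<close>
  cancels, which leaves the constancy of \<open>curv\<close> along the shifted preimage.\<close>

lemma degenerate_at_preimage:
  assumes "degenerate_at u"
  shows "degenerate_at ((u + of_int i) / real b)"
  unfolding degenerate_at_def
proof
  fix j :: int
  let ?y = "(u + of_int i) / real b"
  have "real b * (?y + of_int j) = u + of_int (i + int b * j)" "real b * ?y = u + of_int i"
    using b_pos by (auto simp: field_simps)
  then have "curv (real b * (?y + of_int j)) = curv (real b * ?y)"
    using assms unfolding degenerate_at_def by metis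
  then show "curv (?y + of_int j) = curv ?y"
    unfolding curv_rec per2_int using b_pos by simp
qed

lemma degenerate_at_preimages:
  assumes "degenerate_at u"
  shows "degenerate_at ((u + of_int i) / real b ^ n)"
proof (induction n arbitrary: i)
  case 0
  have "curv (u + of_int i + of_int j) = curv (u + of_int i)" for j :: int
    using assms unfolding degenerate_at_def by (metis add.assoc of_int_add)
  then show ?case by (simp add: degenerate_at_def)
next
  case (Suc n)
  have "degenerate_at (((u + of_int i) / real b ^ n + of_int 0) / real b)"
    by (rule degenerate_at_preimage[OF Suc])
  then show ?case by (simp add: mult.commute)
qed

lemma dense_preimages:
  "(\<lambda>n. (u + of_int \<lfloor>x * real b ^ n\<rfloor>) / real b ^ n) \<longlonglongrightarrow> x"
proof (rule LIMSEQ_I)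
  fix e :: real assume "e > 0"
  have "(\<lambda>n. (\<bar>u\<bar> + 1) * (1 / real b) ^ n) \<longlonglongrightarrow> (\<bar>u\<bar> + 1) * 0"
    using b_pos by (intro tendsto_mult tendsto_const LIMSEQ_power_zero) auto
  then have "\<forall>\<^sub>F n in sequentially. (\<bar>u\<bar> + 1) * (1 / real b) ^ n < e"
    using \<open>e > 0\<close> by (intro order_tendstoD) auto
  then obtain N where N: "\<And>n. n \<ge> N \<Longrightarrow> (\<bar>u\<bar> + 1) * (1 / real b) ^ n < e"
    unfolding eventually_sequentially by blast
  have "norm ((u + of_int \<lfloor>x * real b ^ n\<rfloor>) / real b ^ n - x) \<le> (\<bar>u\<bar> + 1) * (1 / real b) ^ n" for n
  proof -
    have p: "real b ^ n > 0" using b_pos by simp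
    have "(u + of_int \<lfloor>x * real b ^ n\<rfloor>) / real b ^ n - x = (u + of_int \<lfloor>x * real b ^ n\<rfloor> - x * real b ^ n) / real b ^ n"
      using p by (simp add: field_simps)
    moreover have "\<bar>u + of_int \<lfloor>x * real b ^ n\<rfloor> - x * real b ^ n\<bar> \<le> \<bar>u\<bar> + 1" by linarith
    ultimately show ?thesis using p by (simp add: power_one_over divide_right_mono)
  qed
  then show "\<exists>N. \<forall>n\<ge>N. norm ((u + of_int \<lfloor>x * real b ^ n\<rfloor>) / real b ^ n - x) < e"
    using N by (meson le_less_trans)
qed

text \<open>The points that powers of \<open>b\<close> multiply into \<open>u\<close> plus an
  integer are degenerate and dense; a shift by 1 leaves \<open>curv\<close> unchanged at them, hence
  everywhere by continuity.\<close>

lemma curv_periodic_if_degenerate: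
  assumes "degenerate_at u"
  shows "curv (x + 1) = curv x"
proof -
  let ?y = "\<lambda>n. (u + of_int \<lfloor>x * real b ^ n\<rfloor>) / real b ^ n"
  have c: "isCont curv z" for z using curv_continuous by (simp add: continuous_on_eq_continuous_at)
  have "(\<lambda>n. curv (?y n)) \<longlonglongrightarrow> curv x"
    by (rule isCont_tendsto_compose[OF c dense_preimages])
  moreover have "(\<lambda>n. curv (?y n + 1)) \<longlonglongrightarrow> curv (x + 1)"
    by (rule isCont_tendsto_compose[OF c]) (intro tendsto_add dense_preimages tendsto_const)
  moreover have "curv (?y n + 1) = curv (?y n)" for n
    using degenerate_at_preimages[OF assms, of "\<lfloor>x * real b ^ n\<rfloor>" n] unfolding degenerate_at_def
    by (metis of_int_1)
  ultimately show ?thesis using LIMSEQ_unique by fastforce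
qed

end

section \<open>The degenerate case: from periodic \<open>curv\<close> back to a coboundary\<close>

lemma real_antiderivative:
  fixes h :: "real \<Rightarrow> real"
  assumes "continuous_on UNIV h"
  obtains H where "\<And>x. (H has_real_derivative h x) (at x)"
  using einterval_antiderivative[of "-\<infinity>" "\<infinity>" h] assms
  by (auto simp: continuous_on_eq_continuous_at has_real_derivative_iff_has_vector_derivative)

lemma eq_if_derivative_0:
  fixes h :: "real \<Rightarrow> real"
  assumes "\<And>x. (h has_real_derivative 0) (at x)"
  shows "h x = h y"
  using DERIV_isconst_all[of h] assms by blast

context c2_periodic
begin

text \<open>Integrate \<open>curv_rec\<close> twice. Each integration may leave a nonperiodic part:
  periodicity of \<open>\<psi>\<close> kills the drift of \<open>V0\<close>, periodicity of
  \<open>\<phi>\<close> kills the term \<open>k * x\<close>, and the drift \<open>m\<close> of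
  \<open>G0\<close> is subtracted.\<close>

lemma coboundary_if_degenerate:
  assumes "degenerate_at u"
  shows "\<exists>g v c. c2_periodic g v curv b \<and> (\<forall>x. \<phi> x = g (real b * x) / real b - g x + c)"
proof -
  note p = curv_periodic_if_degenerate[OF assms]
  obtain V0 where V0: "\<And>x. (V0 has_real_derivative curv x) (at x)"
    using real_antiderivative[OF curv_continuous] by blast
  have chain: "((\<lambda>x. H (real b * x)) has_real_derivative h (real b * x) * real b) (at x)"
    if "\<And>x. (H has_real_derivative h x) (at x)" for H h x
    by (rule DERIV_chain2[where f=H and g="\<lambda>x. real b * x", OF that])
      (auto intro!: derivative_eq_intros)
  have shift: "((\<lambda>x. H (x + 1)) has_real_derivative h (x + 1)) (at x)"
    if "\<And>x. (H has_real_derivative h x) (at x)" for H h x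
    using that[of "x + 1"] by (simp add: DERIV_shift)
  obtain k where k: "\<And>x. \<psi> x = V0 (real b * x) - V0 x - k"
  proof -
    have "((\<lambda>x. V0 (real b * x) - V0 x - \<psi> x) has_real_derivative 0) (at x)" for x
      using b_pos by (auto intro!: derivative_eq_intros chain[OF V0] V0 deriv2 simp: curv_rec)
    from eq_if_derivative_0[OF this, of _ 0]
    have "V0 (real b * x) - V0 x - \<psi> x = - \<psi> 0" for x by simp
    then show ?thesis by (intro that[of "- \<psi> 0"]) (simp add: algebra_simps)
  qed
  have V0_per: "V0 (x + 1) = V0 x" for x
  proof -
    have "((\<lambda>x. V0 (x + 1) - V0 x) has_real_derivative 0) (at x)" for x
      by (auto intro!: derivative_eq_intros shift[OF V0] V0 simp: p)
    from eq_if_derivative_0[OF this, of _ 0]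
    have m: "V0 (x + 1) - V0 x = V0 1 - V0 0" for x by simp
    have "V0 (real n) = V0 0 + real n * (V0 1 - V0 0)" for n
    proof (induction n)
      case (Suc n) then show ?case using m[of "real n"] by (simp add: algebra_simps)
    qed simp
    from this[of b] have "V0 (real b) = V0 0 + real b * (V0 1 - V0 0)" .
    \<comment> \<open>The drift of \<open>V0\<close> over \<open>b\<close> periods is
      \<open>b\<close> times the one over a single period, while \<open>\<psi> 1 = \<psi> 0\<close>
      says that the two agree.\<close>
    moreover have "\<psi> 1 = \<psi> 0" using per1[of 0] by simp
    ultimately have "(real b - 1) * (V0 1 - V0 0) = 0"
      using k[of 0] k[of 1] by (simp add: algebra_simps)
    then show ?thesis using m[of x] b_pos by simp
  qed
  obtain G0 where G0: "\<And>x. (G0 has_real_derivative V0 x) (at x)"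
    using real_antiderivative[of V0] V0
    by (metis DERIV_isCont continuous_at_imp_continuous_on)
  define m where "m = G0 1 - G0 0"
  have G0_m: "G0 (x + 1) = G0 x + m" for x
  proof -
    have "((\<lambda>x. G0 (x + 1) - G0 x) has_real_derivative 0) (at x)" for x
      by (auto intro!: derivative_eq_intros shift[OF G0] G0 simp: V0_per)
    from eq_if_derivative_0[OF this, of x 0]
    show ?thesis by (simp add: m_def)
  qed
  have G0_n: "G0 (real n) = G0 0 + real n * m" for n
  proof (induction n)
    case (Suc n) then show ?case using G0_m[of "real n"] by (simp add: algebra_simps)
  qed simp
  obtain c where c: "\<And>x. \<phi> x = G0 (real b * x) / real b - G0 x - k * x + c"
  proof -
    have "((\<lambda>x. G0 (real b * x) / real b - G0 x - k * x - \<phi> x) has_real_derivative 0) (at x)" for x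
      using b_pos by (auto intro!: derivative_eq_intros chain[OF G0] G0 deriv1 simp: k)
    from eq_if_derivative_0[OF this, of _ 0]
    have "G0 (real b * x) / real b - G0 x - k * x - \<phi> x = G0 0 / real b - G0 0 - \<phi> 0" for x by simp
    then show ?thesis by (intro that[of "- (G0 0 / real b - G0 0 - \<phi> 0)"]) (simp add: algebra_simps)
  qed
  have "k = 0"
  proof -
    have "\<phi> 1 = \<phi> 0" using per[of 0] by simp
    moreover have "G0 (real b * 1) / real b = G0 0 / real b + m"
      using G0_n[of b] b_pos by (simp add: add_divide_distrib)
    moreover have "G0 1 = G0 0 + m" using G0_m[of 0] by simp
    ultimately show ?thesis using c[of 0] c[of 1] by simp
  qed
  \<comment> \<open>Since \<open>m * (b * x) / b = m * x\<close>, removing the linear part makes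
    \<open>g\<close> periodic without changing the coboundary.\<close>
  have "c2_periodic (\<lambda>x. G0 x - m * x) (\<lambda>x. V0 x - m) curv b"
  proof
    show "G0 (x + 1) - m * (x + 1) = G0 x - m * x" for x
      using G0_m[of x] by (simp add: algebra_simps)
  qed (use curv_continuous b2 in \<open>auto intro!: derivative_eq_intros G0 V0\<close>)
  moreover have "\<phi> x = (G0 (real b * x) - m * (real b * x)) / real b - (G0 x - m * x) + c" for x
    using c[of x] b_pos by (simp add: \<open>k = 0\<close> diff_divide_distrib)
  ultimately show ?thesis by blast
qed

end

text \<open>Fix \<open>i\<close> and let \<open>a k j\<close> be the derivative of the
  \<open>k\<close>-th function at \<open>i / b^j\<close>. The chain gives the recursion of
  \<open>eq_0_if_divisible_by_all_powers\<close> and the Lipschitz bound gives the geometric decay,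
  so the derivative of the first function vanishes on the dense set of all
  \<open>i / b^j\<close>.\<close>

lemma coboundary_chain_constant:
  fixes \<phi> \<psi> \<theta> :: "nat \<Rightarrow> real \<Rightarrow> real"
  assumes c2: "\<And>k. c2_periodic (\<phi> k) (\<psi> k) (\<theta> k) b"
    and chain: "\<And>k x. \<phi> k x = \<phi> (Suc k) (real b * x) / real b - \<phi> (Suc k) x + c k"
  shows "\<phi> 0 x = \<phi> 0 y"
proof -
  have bp: "real b > 0" "real b \<ge> 2" using c2_periodic.b2[OF c2] by (auto intro: less_le_trans[of 0 2])
  have psi: "\<psi> k x = \<psi> (Suc k) (real b * x) - \<psi> (Suc k) x" for k x
  proof (rule DERIV_unique)
    show "(\<phi> k has_real_derivative \<psi> k x) (at x)" by (rule c2_periodic.deriv1[OF c2])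
    have "((\<lambda>x. \<phi> (Suc k) (real b * x)) has_real_derivative \<psi> (Suc k) (real b * x) * real b) (at x)"
      by (rule DERIV_chain2[where f="\<phi> (Suc k)" and g="\<lambda>x. real b * x", OF c2_periodic.deriv1[OF c2]])
        (auto intro!: derivative_eq_intros)
    then have "((\<lambda>x. \<phi> (Suc k) (real b * x) / real b - \<phi> (Suc k) x + c k) has_real_derivative
       \<psi> (Suc k) (real b * x) - \<psi> (Suc k) x) (at x)"
      using bp by (auto intro!: derivative_eq_intros c2_periodic.deriv1[OF c2])
    then show "(\<phi> k has_real_derivative \<psi> (Suc k) (real b * x) - \<psi> (Suc k) x) (at x)"
      by (simp only: chain[symmetric])
  qed
  \<comment> \<open>At an integer \<open>x\<close> both \<open>x\<close> and \<open>b * x\<close>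
    are integers, where the periodic \<open>\<psi> (Suc k)\<close> takes the same value.\<close>
  have z0: "\<psi> k (of_int i) = 0" for k i
    using c2_periodic.per1_int[OF c2, of k 0 i] psi[of k 0] by simp
  have zero: "\<psi> 0 (of_int i / real b ^ j) = 0" for i j
  proof -
    define a where "a k j = complex_of_real (\<psi> k (of_int i / real b ^ j))" for k j
    have "\<exists>M. \<forall>j. norm (a k j) \<le> M * (1/2) ^ j" for k
    proof -
      interpret K: c2_periodic "\<phi> k" "\<psi> k" "\<theta> k" b by (rule c2)
      obtain M where M: "M > 0" "\<And>x. \<bar>\<theta> k x\<bar> \<le> M" using K.bounds by blast
      have lip: "\<bar>\<psi> k x - \<psi> k 0\<bar> \<le> M * \<bar>x - 0\<bar>" for x
        by (rule field_differentiable_bound[of UNIV "\<psi> k" "\<theta> k" M, simplified])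
          (use K.deriv2 M in auto)
      have "norm (a k j) \<le> M * \<bar>of_int i\<bar> * (1/2) ^ j" for j
      proof -
        have "\<bar>\<psi> k (of_int i / real b ^ j)\<bar> \<le> M * (\<bar>of_int i\<bar> / real b ^ j)"
          using lip[of "of_int i / real b ^ j"] z0[of k 0] bp by simp
        also have "\<dots> \<le> M * (\<bar>of_int i\<bar> / 2 ^ j)"
          using bp M by (intro mult_left_mono divide_left_mono power_mono) auto
        finally show ?thesis by (simp add: a_def power_one_over)
      qed
      then show ?thesis by blast
    qed
    then obtain C where C: "\<And>k j. norm (a k j) \<le> C k * (1/2) ^ j" by metis
    have "a 0 j = 0"
    proof (rule eq_0_if_divisible_by_all_powers[OF _ _ C])
      show "a k 0 = 0" for k by (simp add: a_def z0)
      show "a k (Suc j) = a (Suc k) j - a (Suc k) (Suc j)" for k j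
        using psi[of k "of_int i / real b ^ Suc j"] bp by (simp add: a_def)
    qed
    then show ?thesis by (simp add: a_def)
  qed
  interpret K: c2_periodic "\<phi> 0" "\<psi> 0" "\<theta> 0" b by (rule c2)
  have "\<psi> 0 z = 0" for z
  proof -
    have "(\<lambda>n. \<psi> 0 ((0 + of_int \<lfloor>z * real b ^ n\<rfloor>) / real b ^ n)) \<longlonglongrightarrow> \<psi> 0 z"
      by (rule isCont_tendsto_compose[OF _ K.dense_preimages]) (use K.cont1 in \<open>simp add: continuous_on_eq_continuous_at\<close>)
    then show ?thesis using zero LIMSEQ_unique[OF tendsto_const] by force
  qed
  then show ?thesis
    using eq_if_derivative_0[of "\<phi> 0"] K.deriv1 by simp
qed

section \<open>Transversality of the slopes\<close>

text \<open>Used with \<open>m = b^q\<close>: \<open>w\<close> is the block of the \<open>q\<close>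
  lowest digits of a word, \<open>i\<close> the block of the remaining ones.\<close>

lemma sum_lessThan_mult:
  fixes f :: "nat \<Rightarrow> 'a::comm_monoid_add"
  shows "(\<Sum>j<m*k. f j) = (\<Sum>w<m. \<Sum>i<k. f (w + m * i))"
proof -
  have "(\<Sum>j<m*k. f j) = (\<Sum>i<k. sum f {i*m..<i*m+m})"
    using sum.nat_group[of f m k] by (simp add: mult.commute)
  also have "\<dots> = (\<Sum>i<k. \<Sum>w<m. f (w + m * i))"
  proof (rule sum.cong[OF refl])
    fix i
    have "sum f {0 + i*m..<m + i*m} = (\<Sum>w\<in>{0..<m}. f (w + i*m))"
      by (rule sum.shift_bounds_nat_ivl)
    then show "sum f {i*m..<i*m+m} = (\<Sum>w<m. f (w + m * i))"
      by (simp add: add.commute mult.commute lessThan_atLeast0)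
  qed
  also have "\<dots> = (\<Sum>w<m. \<Sum>i<k. f (w + m * i))" by (rule sum.swap)
  finally show ?thesis .
qed

lemma indicator_unit_split:
  fixes x :: real
  assumes m: "m > 0"
  shows "(\<Sum>w<m. indicator {real w / real m..<(real w + 1) / real m} x) = (indicator {0..<1} x :: ennreal)"
proof -
  have iff: "x \<in> {real w / real m..<(real w + 1) / real m} \<longleftrightarrow> real w \<le> x * real m \<and> x * real m < real w + 1" for w
    using m by (auto simp: field_simps)
  show ?thesis
  proof (cases "x \<in> {0..<1}")
    case True
    define w0 where "w0 = nat \<lfloor>x * real m\<rfloor>"
    have "x * real m \<ge> 0" using True by simp
    then have w0: "real w \<le> x * real m \<and> x * real m < real w + 1 \<longleftrightarrow> w = w0" for w
      unfolding w0_def by linarith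
    have "x * real m < real m" using True m by simp
    then have "w0 < m" using w0[of w0] by linarith
    then show ?thesis using True unfolding indicator_def iff w0 by (simp add: sum.delta)
  next
    case False
    have "\<not> (real w \<le> x * real m \<and> x * real m < real w + 1)" if "w < m" for w
    proof
      assume *: "real w \<le> x * real m \<and> x * real m < real w + 1"
      then have "x \<ge> 0" using m by (metis of_nat_0_le_iff of_nat_0_less_iff order_trans zero_le_mult_iff not_le)
      moreover have "real w + 1 \<le> real m" using that by linarith
      then have "x * real m < 1 * real m" using * by linarith
      then have "x < 1" using m by (simp only: mult_less_cancel_right_pos of_nat_0_less_iff)
      ultimately show False using False by simp
    qed
    then have "(\<Sum>w<m. indicator {real w / real m..<(real w + 1) / real m} x) = (\<Sum>w<m. 0 :: ennreal)"
      unfolding indicator_def iff by (intro sum.cong) auto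
    then show ?thesis using False by simp
  qed
qed

text \<open>Invariance of Lebesgue measure on \<open>[0, 1)\<close> under multiplication by
  \<open>m\<close> modulo 1, stated through the inverse branches.\<close>

lemma nn_integral_unit_split:
  fixes F :: "real \<Rightarrow> ennreal"
  assumes F[measurable]: "F \<in> borel_measurable borel" and m: "m > 0"
  shows "(\<Sum>w<m. \<integral>\<^sup>+u\<in>{0..<1}. F ((u + real w) / real m) \<partial>lborel) = of_nat m * (\<integral>\<^sup>+u\<in>{0..<1}. F u \<partial>lborel)"
proof -
  have part: "(\<integral>\<^sup>+u\<in>{0..<1}. F ((u + real w) / real m) \<partial>lborel) =
      of_nat m * (\<integral>\<^sup>+x\<in>{real w / real m..<(real w + 1) / real m}. F x \<partial>lborel)" for w
  proof -
    let ?f = "\<lambda>x. F x * indicator {real w / real m..<(real w + 1) / real m} x"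
    have "(\<integral>\<^sup>+x. ?f x \<partial>lborel) = ennreal \<bar>1 / real m\<bar> * (\<integral>\<^sup>+u. ?f (real w / real m + (1 / real m) * u) \<partial>lborel)"
      by (rule nn_integral_real_affine) (use m in auto)
    also have "(\<lambda>u. ?f (real w / real m + (1 / real m) * u)) = (\<lambda>u. F ((u + real w) / real m) * indicator {0..<1} u)"
      using m by (intro ext) (auto simp: indicator_def field_simps)
    finally have "of_nat m * (\<integral>\<^sup>+x. ?f x \<partial>lborel) =
        (of_nat m * ennreal (1 / real m)) * (\<integral>\<^sup>+u\<in>{0..<1}. F ((u + real w) / real m) \<partial>lborel)"
      by (simp add: mult.assoc)
    also have "of_nat m * ennreal (1 / real m) = ennreal (real m * (1 / real m))"
      by (subst ennreal_mult) (auto simp: ennreal_of_nat_eq_real_of_nat)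
    also have "\<dots> = 1" using m by simp
    finally show ?thesis by simp
  qed
  have "(\<Sum>w<m. \<integral>\<^sup>+u\<in>{0..<1}. F ((u + real w) / real m) \<partial>lborel) =
     of_nat m * (\<Sum>w<m. \<integral>\<^sup>+x\<in>{real w / real m..<(real w + 1) / real m}. F x \<partial>lborel)"
    by (simp only: part sum_distrib_left)
  also have "(\<Sum>w<m. \<integral>\<^sup>+x\<in>{real w / real m..<(real w + 1) / real m}. F x \<partial>lborel) =
     (\<integral>\<^sup>+x. (\<Sum>w<m. F x * indicator {real w / real m..<(real w + 1) / real m} x) \<partial>lborel)"
    by (rule nn_integral_sum[symmetric]) (use F in measurable)
  also have "\<dots> = (\<integral>\<^sup>+u\<in>{0..<1}. F u \<partial>lborel)"
    by (simp only: sum_distrib_left[symmetric] indicator_unit_split[OF m])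
  finally show ?thesis .
qed

text \<open>The length of the overlap of two intervals of radius \<open>r\<close> whose centres
  differ by \<open>s\<close>, as \<open>tent_integral\<close> shows. This kernel is positive
  definite, which a sharp cut-off of \<open>\<bar>s\<bar>\<close> would not be.\<close>

definition tent :: "real \<Rightarrow> real \<Rightarrow> real" where
  "tent r s = max 0 (2 * r - \<bar>s\<bar>)"

lemma tent_nonneg: "tent r s \<ge> 0"
  and tent_le: "r \<ge> 0 \<Longrightarrow> tent r s \<le> 2 * r"
  and tent_ge: "\<bar>s\<bar> \<le> r \<Longrightarrow> r \<le> tent r s"
  and tent_eq_0: "\<bar>s\<bar> > 2 * r \<Longrightarrow> tent r s = 0"
  by (auto simp: tent_def)

lemma tent_scale: "c > 0 \<Longrightarrow> tent r (c * s) = c * tent (r / c) s"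
  by (simp add: tent_def abs_mult max_mult_distrib_left right_diff_distrib)

lemma tent_measurable[measurable]: "(\<lambda>x. tent r (f x)) \<in> borel_measurable M" if [measurable]: "f \<in> borel_measurable M"
  unfolding tent_def by measurable

lemma tent_integral:
  "has_bochner_integral lborel (\<lambda>t. indicator {x-r..x+r} t * indicator {y-r..y+r} t :: real) (tent r (x - y))"
proof -
  have "(\<lambda>t. indicator {x-r..x+r} t * indicator {y-r..y+r} t :: real) = indicator {max x y - r..min x y + r}"
    by (auto simp: fun_eq_iff indicator_def)
  moreover have "has_bochner_integral lborel (indicator {max x y - r..min x y + r} :: real \<Rightarrow> real)
      (measure lborel {max x y - r..min x y + r})"
    by (rule has_bochner_integral_real_indicator) (auto simp: emeasure_lborel_Icc_eq)
  moreover have "measure lborel {max x y - r..min x y + r} = tent r (x - y)"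
    by (auto simp: tent_def measure_def emeasure_lborel_Icc_eq)
  ultimately show ?thesis by simp
qed

lemma has_bochner_integral_nonneg_real:
  fixes f :: "'a \<Rightarrow> real"
  assumes "has_bochner_integral M f x" "\<And>t. 0 \<le> f t"
  shows "0 \<le> x"
  using has_bochner_integral_integral_eq[OF assms(1)] Bochner_Integration.integral_nonneg[of M f] assms(2)
  by simp

text \<open>Right side minus left side is the integral of the square of \<open>F - G\<close>, where
  \<open>F\<close> and \<open>G\<close> count the intervals of either family that contain
  \<open>t\<close>.\<close>

lemma tent_sum_cross_le:
  fixes s s' :: "nat \<Rightarrow> real"
  shows "2 * (\<Sum>i<k. \<Sum>j<k. tent r (s i - s' j)) \<le>
    (\<Sum>i<k. \<Sum>j<k. tent r (s i - s j)) + (\<Sum>i<k. \<Sum>j<k. tent r (s' i - s' j))"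
proof -
  let ?I = "\<lambda>x t. indicator {x-r..x+r} t :: real"
  let ?F = "\<lambda>t. \<Sum>i<k. ?I (s i) t" and ?G = "\<lambda>t. \<Sum>i<k. ?I (s' i) t"
  have pairs: "has_bochner_integral lborel (\<lambda>t. (\<Sum>i<k. ?I (p i) t) * (\<Sum>i<k. ?I (p' i) t))
     (\<Sum>i<k. \<Sum>j<k. tent r (p i - p' j))" for p p' :: "nat \<Rightarrow> real"
    unfolding sum_product by (intro has_bochner_integral_sum tent_integral)
  have "has_bochner_integral lborel (\<lambda>t. ?F t * ?F t + ?G t * ?G t - 2 * (?F t * ?G t))
     ((\<Sum>i<k. \<Sum>j<k. tent r (s i - s j)) + (\<Sum>i<k. \<Sum>j<k. tent r (s' i - s' j))
        - 2 * (\<Sum>i<k. \<Sum>j<k. tent r (s i - s' j)))"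
    by (intro has_bochner_integral_diff[OF has_bochner_integral_add[OF pairs pairs]]
        has_bochner_integral_mult_right pairs)
  moreover have "?F t * ?F t + ?G t * ?G t - 2 * (?F t * ?G t) \<ge> 0" for t
    using zero_le_power2[of "?F t - ?G t"] by (simp add: power2_eq_square algebra_simps)
  ultimately have "0 \<le> (\<Sum>i<k. \<Sum>j<k. tent r (s i - s j)) + (\<Sum>i<k. \<Sum>j<k. tent r (s' i - s' j))
        - 2 * (\<Sum>i<k. \<Sum>j<k. tent r (s i - s' j))"
    by (rule has_bochner_integral_nonneg_real)
  then show ?thesis by simp
qed

section \<open>Slopes along words, their derivatives and their comparison with
  \<open>curv\<close>\<close>

context c2_periodic
begin

text \<open>At \<open>x = u + j\<close> the term \<open>k\<close> sees only the \<open>k + 1\<close>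
  lowest digits of \<open>j\<close>, by periodicity of \<open>\<psi>\<close>.\<close>

definition slope :: "real \<Rightarrow> nat \<Rightarrow> real \<Rightarrow> real" where
  "slope \<gamma> n x = (\<Sum>k<n. \<gamma> ^ Suc k * \<psi> (x / real b ^ Suc k))"

definition dslope :: "real \<Rightarrow> nat \<Rightarrow> real \<Rightarrow> real" where
  "dslope \<gamma> n x = (\<Sum>k<n. (\<gamma> / real b) ^ Suc k * \<theta> (x / real b ^ Suc k))"

lemma slope_deriv: "(slope \<gamma> n has_real_derivative dslope \<gamma> n x) (at x)"
proof -
  have "((\<lambda>x. \<psi> (x / real b ^ Suc k)) has_real_derivative \<theta> (x / real b ^ Suc k) * (1 / real b ^ Suc k)) (at x)" for k
    by (rule DERIV_chain2[where f=\<psi> and g="\<lambda>x. x / real b ^ Suc k", OF deriv2])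
      (use b_pos in \<open>auto intro!: derivative_eq_intros\<close>)
  then have "((\<lambda>x. \<Sum>k<n. \<gamma> ^ Suc k * \<psi> (x / real b ^ Suc k)) has_real_derivative
      (\<Sum>k<n. \<gamma> ^ Suc k * (\<theta> (x / real b ^ Suc k) * (1 / real b ^ Suc k)))) (at x)"
    by (intro DERIV_sum DERIV_cmult) blast
  moreover have "(\<Sum>k<n. \<gamma> ^ Suc k * (\<theta> (x / real b ^ Suc k) * (1 / real b ^ Suc k))) = dslope \<gamma> n x"
    unfolding dslope_def power_divide by (rule sum.cong) auto
  ultimately show ?thesis unfolding slope_def[abs_def] by simp
qed

lemma slope_continuous: "continuous_on S (slope \<gamma> n)"
  using slope_deriv by (auto intro!: continuous_at_imp_continuous_on DERIV_isCont)

lemma slope_measurable[measurable]: "slope \<gamma> n \<in> borel_measurable borel"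
  by (rule borel_measurable_continuous_onI[OF slope_continuous])

lemma slope_split: "slope \<gamma> (q + n) x = slope \<gamma> q x + \<gamma> ^ q * slope \<gamma> n (x / real b ^ q)"
proof -
  have "slope \<gamma> (q + n) x = slope \<gamma> q x + (\<Sum>k<n. \<gamma> ^ Suc (q + k) * \<psi> (x / real b ^ Suc (q + k)))"
    unfolding slope_def by (induction n) auto
  also have "(\<Sum>k<n. \<gamma> ^ Suc (q + k) * \<psi> (x / real b ^ Suc (q + k))) = \<gamma> ^ q * slope \<gamma> n (x / real b ^ q)"
    unfolding slope_def sum_distrib_left by (rule sum.cong) (auto simp: power_add mult_ac)
  finally show ?thesis .
qed

lemma dslope_split: "dslope \<gamma> (q + n) x = dslope \<gamma> q x + (\<gamma> / real b) ^ q * dslope \<gamma> n (x / real b ^ q)"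
proof -
  have "dslope \<gamma> (q + n) x = dslope \<gamma> q x + (\<Sum>k<n. (\<gamma> / real b) ^ Suc (q + k) * \<theta> (x / real b ^ Suc (q + k)))"
    unfolding dslope_def by (induction n) auto
  also have "(\<Sum>k<n. (\<gamma> / real b) ^ Suc (q + k) * \<theta> (x / real b ^ Suc (q + k))) = (\<gamma> / real b) ^ q * dslope \<gamma> n (x / real b ^ q)"
    unfolding dslope_def sum_distrib_left by (rule sum.cong) (auto simp: power_add mult_ac)
  finally show ?thesis .
qed

lemma digit_shift:
  assumes "k < q"
  shows "(x + real (b ^ q * i)) / real b ^ Suc k = x / real b ^ Suc k + of_int (int (b ^ (q - Suc k) * i))"
proof -
  have "real b ^ q = real b ^ (q - Suc k) * real b ^ Suc k"
    using assms by (simp add: power_add[symmetric] del: power_Suc)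
  then show ?thesis using b_pos by (simp add: add_divide_distrib del: power_Suc)
qed

lemma slope_shift: "slope \<gamma> q (x + real (b ^ q * i)) = slope \<gamma> q x"
  unfolding slope_def by (rule sum.cong) (simp_all only: digit_shift per1_int lessThan_iff)

lemma dslope_shift: "dslope \<gamma> q (x + real (b ^ q * i)) = dslope \<gamma> q x"
  unfolding dslope_def by (rule sum.cong) (simp_all only: digit_shift per2_int lessThan_iff)

text \<open>Self-similarity: the slopes of the words with low digits \<open>w\<close> are, up to a
  translation, a copy contracted by \<open>\<gamma>^q\<close> of the slopes over the preimage
  \<open>(u + w) / b^q\<close>.\<close>

lemma slope_split_word:
  "slope \<gamma> (q + n) (u + real (w + b ^ q * i)) =
    slope \<gamma> q (u + real w) + \<gamma> ^ q * slope \<gamma> n ((u + real w) / real b ^ q + real i)"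
proof -
  have "u + real (w + b ^ q * i) = (u + real w) + real (b ^ q * i)" by simp
  moreover have "((u + real w) + real (b ^ q * i)) / real b ^ q = (u + real w) / real b ^ q + real i"
    using b_pos by (simp add: add_divide_distrib)
  ultimately show ?thesis by (simp only: slope_split slope_shift)
qed

lemma weighted_sum_bound:
  assumes M: "\<And>x. \<bar>h x\<bar> \<le> M" and "0 \<le> M" and c: "\<And>k. k < n \<Longrightarrow> \<bar>c k\<bar> \<le> (1 / real b) ^ Suc k * a" "0 \<le> a"
  shows "\<bar>\<Sum>k<n. c k * h (f k)\<bar> \<le> M * a"
proof -
  have "\<bar>\<Sum>k<n. c k * h (f k)\<bar> \<le> (\<Sum>k<n. (1 / real b) ^ Suc k * a * M)"
    by (rule order_trans[OF sum_abs], rule sum_mono, unfold abs_mult)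
      (intro mult_mono M c, use assms in auto)
  also have "\<dots> = (\<Sum>k<n. (1 / real b) ^ Suc k) * (a * M)"
    by (simp add: sum_distrib_right mult.assoc)
  also have "\<dots> \<le> 1 * (a * M)"
  proof (rule mult_right_mono)
    have "(\<Sum>k<n. (1 / real b) ^ Suc k) \<le> (\<Sum>k. (1 / real b) ^ Suc k)"
      by (rule sum_le_suminf[OF geometric_sums_le_1(1)]) auto
    then show "(\<Sum>k<n. (1 / real b) ^ Suc k) \<le> 1" using geometric_sums_le_1(2) by linarith
  qed (use assms in auto)
  finally show ?thesis by (simp add: mult.commute)
qed

lemma dslope_bound:
  assumes "\<And>x. \<bar>\<theta> x\<bar> \<le> M" "0 \<le> M" "0 \<le> \<gamma>" "\<gamma> \<le> 1"
  shows "\<bar>dslope \<gamma> n x\<bar> \<le> M"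
proof -
  have "\<bar>(\<gamma> / real b) ^ Suc k\<bar> \<le> (1 / real b) ^ Suc k * 1" for k
    using assms b_pos by (simp add: abs_mult power_divide divide_right_mono mult_le_one power_le_one power_one_over field_simps del: power_Suc)
  then show ?thesis
    unfolding dslope_def
    using weighted_sum_bound[where M=M and a=1 and h=\<theta> and n=n and c="\<lambda>k. (\<gamma> / real b) ^ Suc k"
        and f="\<lambda>k. x / real b ^ Suc k", OF assms(1,2)] by simp
qed

lemma curv_split: "curv x = dslope 1 q x + (1 / real b) ^ q * curv (x / real b ^ q)"
proof (induction q)
  case (Suc q)
  have "curv (x / real b ^ q) = (\<theta> (x / real b ^ Suc q) + curv (x / real b ^ Suc q)) / real b"
    using curv_rec[of "x / real b ^ Suc q"] b_pos by simp
  then show ?case using Suc by (simp add: dslope_def algebra_simps add_divide_distrib)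
qed (simp add: dslope_def)

lemma curv_bound:
  assumes "\<And>x. \<bar>\<theta> x\<bar> \<le> M" "0 \<le> M"
  shows "\<bar>curv x\<bar> \<le> M"
proof (rule LIMSEQ_le_const2)
  show "(\<lambda>n. \<bar>dslope 1 n x\<bar>) \<longlonglongrightarrow> \<bar>curv x\<bar>"
    using summable_LIMSEQ[OF curv_summable[of x]] unfolding curv_def dslope_def by (intro tendsto_rabs)
  show "\<exists>N. \<forall>n\<ge>N. \<bar>dslope 1 n x\<bar> \<le> M" using dslope_bound[OF assms, of 1] by auto
qed

text \<open>The two translates share their \<open>q\<close> lowest digits, so the first
  \<open>q\<close> terms cancel and only a tail of weight \<open>b^(-q)\<close> is left.\<close>

lemma curv_shift_bound:
  assumes "\<And>x. \<bar>\<theta> x\<bar> \<le> M" "0 \<le> M"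
  shows "\<bar>curv (x + real (b ^ q * i)) - curv x\<bar> \<le> 2 * M * (1 / real b) ^ q"
proof -
  let ?y = "x + real (b ^ q * i)"
  have "curv ?y - curv x = (1 / real b) ^ q * (curv (?y / real b ^ q) - curv (x / real b ^ q))"
    using curv_split[of ?y q] curv_split[of x q] dslope_shift[of 1 q x i] by (simp add: algebra_simps)
  then have "\<bar>curv ?y - curv x\<bar> = (1 / real b) ^ q * \<bar>curv (?y / real b ^ q) - curv (x / real b ^ q)\<bar>"
    by (simp add: abs_mult)
  also have "\<dots> \<le> (1 / real b) ^ q * (2 * M)"
    using curv_bound[OF assms, of "?y / real b ^ q"] curv_bound[OF assms, of "x / real b ^ q"]
    by (intro mult_left_mono) auto
  finally show ?thesis by (simp add: mult_ac)
qed

text \<open>Three errors of size \<open>M * b^(-q)\<close>: replacing \<open>\<gamma>\<close> by 1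
  in the first \<open>q\<close> terms, where \<open>1 - \<gamma>^(k+1) \<le> b^(-q)\<close>, and
  cutting off the tail of either sum.\<close>

lemma dslope_curv_bound:
  assumes M: "\<And>x. \<bar>\<theta> x\<bar> \<le> M" "0 \<le> M" and \<gamma>: "0 \<le> \<gamma>" "\<gamma> \<le> 1" "1 - (1 / real b) ^ q \<le> \<gamma> ^ q" and n: "q \<le> n"
  shows "\<bar>dslope \<gamma> n x - curv x\<bar> \<le> 3 * M * (1 / real b) ^ q"
proof -
  obtain m where m: "n = q + m" using n le_Suc_ex by blast
  have "\<bar>dslope 1 q x - dslope \<gamma> q x\<bar> \<le> M * (1 / real b) ^ q"
  proof -
    have eq: "dslope 1 q x - dslope \<gamma> q x = (\<Sum>k<q. ((1 / real b) ^ Suc k * (1 - \<gamma> ^ Suc k)) * \<theta> (x / real b ^ Suc k))"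
      unfolding dslope_def sum_subtractf[symmetric] by (rule sum.cong) (simp_all add: power_divide algebra_simps diff_divide_distrib)
    show ?thesis unfolding eq
    proof (rule weighted_sum_bound[OF M])
      fix k assume "k < q"
      then have "\<gamma> ^ q \<le> \<gamma> ^ Suc k" using \<gamma> by (intro power_decreasing) auto
      moreover have "\<gamma> ^ Suc k \<le> 1" using \<gamma> by (intro power_le_one)
      ultimately have "\<bar>1 - \<gamma> ^ Suc k\<bar> \<le> (1 / real b) ^ q" using \<gamma>(3) by linarith
      then show "\<bar>(1 / real b) ^ Suc k * (1 - \<gamma> ^ Suc k)\<bar> \<le> (1 / real b) ^ Suc k * (1 / real b) ^ q"
        unfolding abs_mult by (intro mult_mono) auto
    qed auto
  qed
  moreover have "\<bar>(\<gamma> / real b) ^ q * dslope \<gamma> m (x / real b ^ q)\<bar> \<le> (1 / real b) ^ q * M"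
    unfolding abs_mult
    by (intro mult_mono dslope_bound[OF M \<gamma>(1,2)])
      (use \<gamma> b_pos in \<open>auto simp: power_abs[symmetric] intro!: power_mono divide_right_mono\<close>)
  moreover have "\<bar>(1 / real b) ^ q * curv (x / real b ^ q)\<bar> \<le> (1 / real b) ^ q * M"
    unfolding abs_mult by (intro mult_mono curv_bound[OF M]) auto
  ultimately show ?thesis
    using curv_split[of x q] dslope_split[of \<gamma> q m x] unfolding m mult.commute[of _ M] mult.assoc by linarith
qed

text \<open>Uniform in the continuations \<open>i\<close>, \<open>i'\<close> and in the length
  \<open>n\<close>, so that one pair of short words settles all pairs of long words extending
  it.\<close>

definition transversal :: "real \<Rightarrow> nat \<Rightarrow> real \<Rightarrow> real set \<Rightarrow> nat \<Rightarrow> nat \<Rightarrow> bool" where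
  "transversal \<gamma> q d I w w' \<longleftrightarrow> (\<forall>u\<in>I. \<forall>n\<ge>q. \<forall>i i'.
     d \<le> \<bar>dslope \<gamma> n (u + real (w + b ^ q * i)) - dslope \<gamma> n (u + real (w' + b ^ q * i'))\<bar>)"

lemma transversal_sym: "transversal \<gamma> q d I w w' \<longleftrightarrow> transversal \<gamma> q d I w' w"
  unfolding transversal_def by (subst (2) abs_minus_commute) blast

text \<open>By compactness: otherwise points with oscillation tending to 0 accumulate at some
  \<open>l\<close>, and continuity for each fixed \<open>j\<close> makes \<open>l\<close>
  degenerate.\<close>

lemma curv_oscillation:
  assumes nd: "\<And>u. \<not> degenerate_at u"
  shows "\<exists>e>0. \<forall>u\<in>{0..1}. \<exists>j::int. e \<le> \<bar>curv (u + of_int j) - curv u\<bar>"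
proof (rule ccontr)
  assume neg: "\<not> ?thesis"
  have "\<exists>u\<in>{0..1}. \<forall>j::int. \<bar>curv (u + of_int j) - curv u\<bar> < inverse (real (Suc m))" for m
    using neg by (metis inverse_positive_iff_positive not_le of_nat_0_less_iff zero_less_Suc)
  then obtain u where u: "\<And>m. u m \<in> {0..1}" "\<And>m (j::int). \<bar>curv (u m + of_int j) - curv (u m)\<bar> < inverse (real (Suc m))"
    by metis
  obtain l r where l: "l \<in> {0..1::real}" "strict_mono r" "(u \<circ> r) \<longlonglongrightarrow> l"
    using compact_Icc[of 0 "1::real"] u(1) unfolding compact_def by blast
  have c: "isCont curv z" for z using curv_continuous by (simp add: continuous_on_eq_continuous_at)
  have "curv (l + of_int j) = curv l" for j :: int
  proof -
    have "(\<lambda>m. \<bar>curv ((u \<circ> r) m + of_int j) - curv ((u \<circ> r) m)\<bar>) \<longlonglongrightarrow> \<bar>curv (l + of_int j) - curv l\<bar>"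
      by (intro tendsto_rabs tendsto_diff isCont_tendsto_compose[OF c] tendsto_add tendsto_const l(3))
    moreover have "(\<lambda>m. \<bar>curv ((u \<circ> r) m + of_int j) - curv ((u \<circ> r) m)\<bar>) \<longlonglongrightarrow> 0"
    proof (rule tendsto_sandwich[OF _ _ tendsto_const])
      show "(\<lambda>m. inverse (real (Suc (r m)))) \<longlonglongrightarrow> 0"
        using LIMSEQ_subseq_LIMSEQ[OF LIMSEQ_inverse_real_of_nat l(2)] by (simp add: o_def)
    qed (use u(2) in \<open>auto intro!: always_eventually less_imp_le\<close>)
    ultimately show ?thesis using LIMSEQ_unique by fastforce
  qed
  then show False using nd[of l] unfolding degenerate_at_def by blast
qed

lemma transversal_words:
  assumes nd: "\<And>u. \<not> degenerate_at u"
  shows "\<exists>q Q d. 0 < q \<and> 0 < Q \<and> 0 < d \<and> (\<forall>\<gamma>. 0 \<le> \<gamma> \<longrightarrow> \<gamma> \<le> 1 \<longrightarrow> 1 - (1 / real b) ^ q \<le> \<gamma> ^ q \<longrightarrow>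
    (\<forall>k<Q. \<forall>w<b^q. \<exists>w'<b^q. transversal \<gamma> q d {real k / real Q..<(real k + 1) / real Q} w w'))"
proof -
  obtain e where e: "e > 0" "\<And>u. u \<in> {0..1} \<Longrightarrow> \<exists>j::int. e \<le> \<bar>curv (u + of_int j) - curv u\<bar>"
    using curv_oscillation[OF nd] by blast
  obtain M where M: "M > 0" "\<And>x. \<bar>\<theta> x\<bar> \<le> M" using bounds by blast
  \<comment> \<open>The budget: reducing a shift to a word loses one \<open>d\<close>, any word is
    \<open>7 * d\<close> away from one of two words that are \<open>15 * d\<close> apart, and two
    approximations cost \<open>2 * d\<close> each, which leaves more than \<open>d\<close>.\<close>
  define d where "d = e / 16"
  have d: "d > 0" using e by (simp add: d_def)
  obtain \<rho> where \<rho>: "\<rho> > 0" "\<And>x y. \<bar>x - y\<bar> < \<rho> \<Longrightarrow> \<bar>curv x - curv y\<bar> \<le> d"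
    using curv_uniformly_continuous[OF d] by blast
  obtain Q :: nat where Q: "0 < Q" "1 / real Q < \<rho>"
    using reals_Archimedean[OF \<rho>(1)] by (metis inverse_eq_divide zero_less_Suc)
  have "(\<lambda>q. 5 * M * (1 / real b) ^ q) \<longlonglongrightarrow> 5 * M * 0"
    using b_pos by (intro tendsto_mult tendsto_const LIMSEQ_power_zero) auto
  then have "\<forall>\<^sub>F q in sequentially. 5 * M * (1 / real b) ^ q < d" using d by (intro order_tendstoD) auto
  then obtain q0 where q0: "\<And>q. q \<ge> q0 \<Longrightarrow> 5 * M * (1 / real b) ^ q < d"
    unfolding eventually_sequentially by blast
  define q where "q = Suc q0"
  have q: "5 * M * (1 / real b) ^ q < d" using q0[of q] by (simp add: q_def)
  have Bq: "0 \<le> M * (1 / real b) ^ q" using M(1) by simp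
  have "\<exists>w'<b^q. transversal \<gamma> q d {real k / real Q..<(real k + 1) / real Q} w w'"
    if \<gamma>: "0 \<le> \<gamma>" "\<gamma> \<le> 1" "1 - (1 / real b) ^ q \<le> \<gamma> ^ q" and k: "k < Q" for \<gamma> k w
  proof -
    define v where "v = real k / real Q"
    have "v \<in> {0..1}" using k by (auto simp: v_def)
    then obtain j :: int where j: "e \<le> \<bar>curv (v + of_int j) - curv v\<bar>" using e(2) by blast
    \<comment> \<open>Up to an error \<open>d\<close> only the residue of \<open>j\<close> modulo
      \<open>b^q\<close> matters; this turns an integer shift into a word.\<close>
    define a where "a = nat (j mod int (b ^ q))"
    have bq: "int (b ^ q) > 0" using b_pos by simp
    have a: "a < b ^ q" using bq unfolding a_def by (simp add: nat_less_iff del: of_nat_power)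
    have aj: "int a = j mod int (b^q)" using bq unfolding a_def by (simp del: of_nat_power)
    have shift: "\<bar>curv (v + of_int j) - curv (v + real a)\<bar> \<le> d"
    \<comment> \<open>\<open>curv_shift_bound\<close> moves upwards only, so the sign of
      \<open>j\<close> decides from which of the two points to start.\<close>
    proof (cases "j \<ge> 0")
      case True
      define i where "i = nat (j div int (b ^ q))"
      have "int i = j div int (b^q)" using True bq unfolding i_def by (simp add: pos_imp_zdiv_nonneg_iff del: of_nat_power)
      then have "j = int a + int (b ^ q * i)" using aj by (simp del: of_nat_power)
      then have eq: "v + of_int j = v + real a + real (b ^ q * i)" by simp
      show ?thesis unfolding eq
        using curv_shift_bound[OF M(2) less_imp_le[OF M(1)], of "v + real a" q i] q Bq by linarith
    next
      case False
      define i where "i = nat (- (j div int (b ^ q)))"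
      have "int i = - (j div int (b^q))" using False bq unfolding i_def by (simp add: pos_imp_zdiv_neg_iff less_imp_le del: of_nat_power)
      then have "int a = j + int (b ^ q * i)" using aj by (simp add: minus_mult_div_eq_mod[symmetric] del: of_nat_power)
      then have "of_int (int a) = (of_int (j + int (b ^ q * i)) :: real)" by (simp only:)
      then have eq: "v + real a = v + of_int j + real (b ^ q * i)" by simp
      show ?thesis unfolding eq
        using curv_shift_bound[OF M(2) less_imp_le[OF M(1)], of "v + of_int j" q i] q Bq by linarith
    qed
    then have "15 * d \<le> \<bar>curv (v + real a) - curv v\<bar>"
      using j d_def by linarith
    then have "15 * d \<le> \<bar>curv (v + real a) - curv (v + real 0)\<bar>" by simp
    then have "7 * d \<le> \<bar>curv (v + real w) - curv (v + real a)\<bar> \<or> 7 * d \<le> \<bar>curv (v + real w) - curv (v + real 0)\<bar>"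
      using d by linarith
    then obtain w' where w': "w' < b ^ q" "7 * d \<le> \<bar>curv (v + real w) - curv (v + real w')\<bar>"
      using a b_pos by (metis of_nat_0_less_iff zero_less_power)
    have approx: "\<bar>dslope \<gamma> n (u + real (x + b ^ q * i)) - curv (v + real x)\<bar> \<le> 2 * d"
      if u: "u \<in> {real k / real Q..<(real k + 1) / real Q}" and n: "q \<le> n" for u n x i
    proof -
      have "\<bar>u - v\<bar> < \<rho>" using u Q unfolding v_def by (auto simp: add_divide_distrib)
      then have "\<bar>(u + real x) - (v + real x)\<bar> < \<rho>" by simp
      then have "\<bar>curv (u + real x) - curv (v + real x)\<bar> \<le> d" by (rule \<rho>(2))
      moreover have "\<bar>curv ((u + real x) + real (b ^ q * i)) - curv (u + real x)\<bar> \<le> 2 * M * (1 / real b) ^ q"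
        by (rule curv_shift_bound) (use M in auto)
      moreover have "\<bar>dslope \<gamma> n ((u + real x) + real (b ^ q * i)) - curv ((u + real x) + real (b ^ q * i))\<bar> \<le> 3 * M * (1 / real b) ^ q"
        by (rule dslope_curv_bound[OF M(2) _ \<gamma> n]) (use M in auto)
      moreover have eq: "u + real (x + b ^ q * i) = (u + real x) + real (b ^ q * i)" by simp
      ultimately show ?thesis unfolding eq using q by linarith
    qed
    have "transversal \<gamma> q d {real k / real Q..<(real k + 1) / real Q} w w'"
      unfolding transversal_def
    proof (intro ballI allI impI)
      fix u n i i' assume u: "u \<in> {real k / real Q..<(real k + 1) / real Q}" and n: "q \<le> n"
      show "d \<le> \<bar>dslope \<gamma> n (u + real (w + b ^ q * i)) - dslope \<gamma> n (u + real (w' + b ^ q * i'))\<bar>"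
        using approx[OF u n, of w i] approx[OF u n, of w' i'] w'(2) d by linarith
    qed
    then show ?thesis using w'(1) by blast
  qed
  then show ?thesis using Q(1) d q_def by blast
qed

end

section \<open>Correlation of the slopes\<close>

text \<open>Nontransversal entries are bounded by averages of diagonal ones, and symmetry of
  \<open>T\<close> makes both halves equal. A row has at most \<open>N - 1\<close> such entries
  because it has a transversal one; this saving of one over the trivial \<open>N\<close> is what
  makes the recursion contract.\<close>

lemma sum_le_diagonal_if_cross_le:
  fixes B :: "nat \<Rightarrow> nat \<Rightarrow> real"
  assumes cross: "\<And>w w'. 2 * B w w' \<le> B w w + B w' w'" and pos: "\<And>w. 0 \<le> B w w"
    and sym: "\<And>w w'. T w w' \<longleftrightarrow> T w' w" and ex: "\<And>w. w < N \<Longrightarrow> \<exists>w'<N. T w w'"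
  shows "(\<Sum>w<N. \<Sum>w'<N. B w w') \<le> (\<Sum>w<N. \<Sum>w'<N. if T w w' then B w w' else 0) + (real N - 1) * (\<Sum>w<N. B w w)"
proof -
  let ?S = "\<lambda>f. \<Sum>w<N. \<Sum>w'<N. if T w w' then 0 else (f w w' :: real)"
  have "(\<Sum>w<N. \<Sum>w'<N. B w w') = (\<Sum>w<N. \<Sum>w'<N. if T w w' then B w w' else 0) + ?S B"
    unfolding sum.distrib[symmetric] by (intro sum.cong) auto
  moreover have "2 * ?S B \<le> ?S (\<lambda>w w'. B w w) + ?S (\<lambda>w w'. B w' w')"
    unfolding sum.distrib[symmetric] sum_distrib_left by (intro sum_mono) (use cross in auto)
  moreover have "?S (\<lambda>w w'. B w' w') = ?S (\<lambda>w w'. B w w)"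
    by (subst sum.swap) (simp only: sym)
  moreover have "?S (\<lambda>w w'. B w w) \<le> (\<Sum>w<N. (real N - 1) * B w w)"
  proof (rule sum_mono)
    fix w assume "w \<in> {..<N}"
    then obtain v where v: "v < N" "T w v" using ex by blast
    have "(\<Sum>w'<N. if T w w' then 0 else B w w) \<le> (\<Sum>w'\<in>{..<N} - {v}. B w w)"
    proof -
      have le: "(if T w w' then 0 else B w w) \<le> B w w" for w' using pos[of w] by simp
      have "(\<Sum>w'<N. if T w w' then 0 else B w w) = (\<Sum>w'\<in>{..<N} - {v}. if T w w' then 0 else B w w)"
        using v by (subst sum.remove[of _ v]) auto
      also have "\<dots> \<le> (\<Sum>w'\<in>{..<N} - {v}. B w w)" by (intro sum_mono le)
      finally show ?thesis .
    qed
    also have "\<dots> = (real N - 1) * B w w" using v by (simp add: of_nat_diff)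
    finally show "(\<Sum>w'<N. if T w w' then 0 else B w w) \<le> (real N - 1) * B w w" .
  qed
  ultimately show ?thesis unfolding sum_distrib_left[symmetric, of "real N - 1"] by linarith
qed

lemma ennreal_double_sum_mult:
  assumes "\<And>i j. 0 \<le> f i j"
  shows "ennreal (\<Sum>i\<in>A. \<Sum>j\<in>B. f i j) * c = (\<Sum>i\<in>A. \<Sum>j\<in>B. ennreal (f i j) * c)"
proof -
  have "(\<Sum>i\<in>A. \<Sum>j\<in>B. ennreal (f i j)) = ennreal (\<Sum>i\<in>A. \<Sum>j\<in>B. f i j)"
    by (simp add: sum_ennreal assms sum_nonneg)
  then show ?thesis by (simp only: sum_distrib_right[symmetric])
qed

lemma of_nat_mult_ennreal: "of_nat n * ennreal x = ennreal (real n * x)"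
  by (simp add: ennreal_mult' ennreal_of_nat_eq_real_of_nat)

text \<open>By the mean value theorem \<open>f\<close> moves at speed at least \<open>d\<close>, so
  the points with \<open>\<bar>f u\<bar> \<le> 2 * r\<close> lie within \<open>4 * r / d\<close> of
  any one of them; on this interval of length \<open>8 * r / d\<close> the integrand is at most
  \<open>2 * r\<close>.\<close>

lemma nn_integral_tent_le:
  fixes f f' :: "real \<Rightarrow> real"
  assumes f: "\<And>u. u \<in> {a..<c} \<Longrightarrow> (f has_real_derivative f' u) (at u)"
    and low: "\<And>u. u \<in> {a..<c} \<Longrightarrow> d \<le> \<bar>f' u\<bar>" and d: "0 < d" and r: "0 \<le> r"
  shows "(\<integral>\<^sup>+u\<in>{a..<c}. ennreal (tent r (f u)) \<partial>lborel) \<le> ennreal (16 * r\<^sup>2 / d)"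
proof (cases "\<exists>u0\<in>{a..<c}. \<bar>f u0\<bar> \<le> 2 * r")
  case False
  then have "ennreal (tent r (f u)) * indicator {a..<c} u = 0" for u
    by (auto simp: indicator_def tent_eq_0 not_le)
  then show ?thesis by (simp only:) simp
next
  case True
  then obtain u0 where u0: "u0 \<in> {a..<c}" "\<bar>f u0\<bar> \<le> 2 * r" by blast
  have near: "d * \<bar>u - v\<bar> \<le> \<bar>f u - f v\<bar>" if "u \<in> {a..<c}" "v \<in> {a..<c}" "u < v" for u v
  proof -
    have "\<exists>z>u. z < v \<and> f v - f u = (v - u) * f' z"
      by (rule MVT2) (use that f in auto)
    then obtain z where z: "u < z" "z < v" "f v - f u = (v - u) * f' z" by blast
    then have "d \<le> \<bar>f' z\<bar>" using low that by auto
    then have "(v - u) * d \<le> (v - u) * \<bar>f' z\<bar>" using that by (intro mult_left_mono) auto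
    then show ?thesis using z that by (simp add: abs_minus_commute[of "f u"] abs_mult mult.commute)
  qed
  have near': "d * \<bar>u - u0\<bar> \<le> \<bar>f u - f u0\<bar>" if "u \<in> {a..<c}" for u
    using near[OF that u0(1)] near[OF u0(1) that]
    by (cases u u0 rule: linorder_cases) (auto simp: abs_minus_commute)
  have le: "ennreal (tent r (f u)) * indicator {a..<c} u \<le> ennreal (2 * r) * indicator {u0 - 4 * r / d .. u0 + 4 * r / d} u" for u
  proof (cases "u \<in> {a..<c} \<and> \<bar>f u\<bar> \<le> 2 * r")
    case True
    then have "d * \<bar>u - u0\<bar> \<le> 4 * r" using near'[of u] u0(2) by linarith
    then have "\<bar>u - u0\<bar> \<le> 4 * r / d" using d by (simp add: field_simps)
    then have "u \<in> {u0 - 4 * r / d .. u0 + 4 * r / d}" unfolding atLeastAtMost_iff by linarith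
    then show ?thesis using tent_le[OF r, of "f u"] True by (simp add: ennreal_leI)
  next
    case False
    then have "ennreal (tent r (f u)) * indicator {a..<c} u = 0"
      by (auto simp: indicator_def tent_eq_0 not_le)
    then show ?thesis by (simp only:) simp
  qed
  have "(\<integral>\<^sup>+u\<in>{a..<c}. ennreal (tent r (f u)) \<partial>lborel) \<le>
      (\<integral>\<^sup>+u. ennreal (2 * r) * indicator {u0 - 4 * r / d .. u0 + 4 * r / d} u \<partial>lborel)"
    by (intro nn_integral_mono le)
  also have "\<dots> = ennreal (2 * r) * ennreal (8 * r / d)"
    using r d by (simp add: nn_integral_cmult_indicator emeasure_lborel_Icc_eq)
  also have "\<dots> = ennreal (16 * r\<^sup>2 / d)"
    using r d by (simp add: ennreal_mult[symmetric] power2_eq_square)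
  finally show ?thesis .
qed

section \<open>Correlation sums and their recursion in the number of digits\<close>

context c2_periodic
begin

text \<open>The squared L2 norm of the function that counts the slopes within \<open>r\<close> of
  \<open>t\<close>. Divided by \<open>4 * r^2 * b^(2 * n)\<close> it is that of the slope
  distribution smoothed at scale \<open>r\<close>, so a bound of order
  \<open>r^2 * b^(2 * n)\<close> stands for a density in L2.\<close>

definition corr :: "real \<Rightarrow> nat \<Rightarrow> real \<Rightarrow> real \<Rightarrow> real" where
  "corr \<gamma> n r u = (\<Sum>j<b^n. \<Sum>j'<b^n. tent r (slope \<gamma> n (u + real j) - slope \<gamma> n (u + real j')))"

definition corr_block :: "real \<Rightarrow> nat \<Rightarrow> nat \<Rightarrow> real \<Rightarrow> nat \<Rightarrow> nat \<Rightarrow> real \<Rightarrow> real" where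
  "corr_block \<gamma> q m r w w' u = (\<Sum>i<b^m. \<Sum>i'<b^m.
     tent r (slope \<gamma> (q + m) (u + real (w + b ^ q * i)) - slope \<gamma> (q + m) (u + real (w' + b ^ q * i'))))"

definition mean_corr :: "real \<Rightarrow> nat \<Rightarrow> real \<Rightarrow> ennreal" where
  "mean_corr \<gamma> n r = (\<integral>\<^sup>+u\<in>{0..<1}. ennreal (corr \<gamma> n r u) \<partial>lborel)"

lemma corr_nonneg: "0 \<le> corr \<gamma> n r u"
  by (simp add: corr_def sum_nonneg tent_nonneg)

lemma corr_block_nonneg: "0 \<le> corr_block \<gamma> q m r w w' u"
  by (simp add: corr_block_def sum_nonneg tent_nonneg)

lemma corr_measurable[measurable]: "corr \<gamma> n r \<in> borel_measurable borel"
  unfolding corr_def[abs_def] by measurable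

lemma corr_block_measurable[measurable]: "corr_block \<gamma> q m r w w' \<in> borel_measurable borel"
  unfolding corr_block_def[abs_def] by measurable

lemma corr_eq_blocks: "corr \<gamma> (q + m) r u = (\<Sum>w<b^q. \<Sum>w'<b^q. corr_block \<gamma> q m r w w' u)"
proof -
  have "corr \<gamma> (q + m) r u = (\<Sum>w<b^q. \<Sum>i<b^m. \<Sum>w'<b^q. \<Sum>i'<b^m.
     tent r (slope \<gamma> (q + m) (u + real (w + b ^ q * i)) - slope \<gamma> (q + m) (u + real (w' + b ^ q * i'))))"
    unfolding corr_def power_add[of b q m] sum_lessThan_mult ..
  also have "\<dots> = (\<Sum>w<b^q. \<Sum>w'<b^q. corr_block \<gamma> q m r w w' u)"
    unfolding corr_block_def by (rule sum.cong[OF refl], rule sum.swap)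
  finally show ?thesis .
qed

text \<open>Equal low digits cancel and the self-similar copy is left; the factor
  \<open>\<gamma>^q\<close> and the changed radius both come from \<open>tent_scale\<close>.\<close>

lemma corr_block_diagonal:
  assumes "0 < \<gamma>"
  shows "corr_block \<gamma> q m r w w u = \<gamma> ^ q * corr \<gamma> m (r / \<gamma> ^ q) ((u + real w) / real b ^ q)"
  unfolding corr_block_def corr_def sum_distrib_left slope_split_word
  using tent_scale[of "\<gamma> ^ q" r] assms
  by (intro sum.cong refl) (simp add: right_diff_distrib[symmetric])

lemma corr_block_cross_le:
  "2 * corr_block \<gamma> q m r w w' u \<le> corr_block \<gamma> q m r w w u + corr_block \<gamma> q m r w' w' u"
  unfolding corr_block_def by (rule tent_sum_cross_le)

lemma nn_integral_corr_block_le: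
  assumes "transversal \<gamma> q d {a..<c} w w'" and "0 < d" "0 \<le> r"
  shows "(\<integral>\<^sup>+u\<in>{a..<c}. ennreal (corr_block \<gamma> q m r w w' u) \<partial>lborel) \<le> ennreal ((real b ^ m)\<^sup>2 * (16 * r\<^sup>2 / d))"
proof -
  let ?H = "\<lambda>i i' u. slope \<gamma> (q + m) (u + real (w + b ^ q * i)) - slope \<gamma> (q + m) (u + real (w' + b ^ q * i'))"
  have deriv: "(?H i i' has_real_derivative
      dslope \<gamma> (q + m) (u + real (w + b ^ q * i)) - dslope \<gamma> (q + m) (u + real (w' + b ^ q * i'))) (at u)" for i i' u
    by (intro DERIV_diff) (simp_all only: DERIV_shift[symmetric] slope_deriv)
  have one: "(\<integral>\<^sup>+u\<in>{a..<c}. ennreal (tent r (?H i i' u)) \<partial>lborel) \<le> ennreal (16 * r\<^sup>2 / d)" for i i'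
    by (rule nn_integral_tent_le[OF deriv _ assms(2,3)])
      (use assms(1) in \<open>unfold transversal_def, auto\<close>)
  have "(\<integral>\<^sup>+u\<in>{a..<c}. ennreal (corr_block \<gamma> q m r w w' u) \<partial>lborel) =
     (\<integral>\<^sup>+u. (\<Sum>i<b^m. \<Sum>i'<b^m. ennreal (tent r (?H i i' u)) * indicator {a..<c} u) \<partial>lborel)"
    unfolding corr_block_def by (simp only: ennreal_double_sum_mult tent_nonneg)
  also have "\<dots> = (\<Sum>i<b^m. \<Sum>i'<b^m. \<integral>\<^sup>+u\<in>{a..<c}. ennreal (tent r (?H i i' u)) \<partial>lborel)"
    by (subst nn_integral_sum, measurable, intro sum.cong refl, subst nn_integral_sum, measurable)
  also have "\<dots> \<le> (\<Sum>i<b^m. \<Sum>i'<b^m. ennreal (16 * r\<^sup>2 / d))"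
    by (intro sum_mono one)
  also have "\<dots> = ennreal ((real b ^ m)\<^sup>2 * (16 * r\<^sup>2 / d))"
    by (simp only: sum_constant card_lessThan of_nat_mult_ennreal) (simp add: power2_eq_square mult.assoc)
  finally show ?thesis .
qed

text \<open>A transversal pair costs \<open>16 * r^2 / d\<close> on each of the \<open>Q\<close>
  subintervals, which are separate because the partner of a word may change from one to the next.
  The diagonal blocks reproduce \<open>corr\<close> at the preimages of \<open>u\<close>, and
  averaging over \<open>u\<close> gives \<open>mean_corr\<close> again.\<close>

lemma mean_corr_rec:
  assumes trans: "\<And>k w. k < Q \<Longrightarrow> w < b ^ q \<Longrightarrow>
      \<exists>w'<b^q. transversal \<gamma> q d {real k / real Q..<(real k + 1) / real Q} w w'"
    and "0 < Q" "0 < d" "0 < \<gamma>" "0 \<le> r"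
  shows "mean_corr \<gamma> (q + m) r \<le> ennreal (real Q * (16 / d) * r\<^sup>2 * (real b ^ (q + m))\<^sup>2) +
    ennreal ((real b ^ q - 1) * \<gamma> ^ q * real b ^ q) * mean_corr \<gamma> m (r / \<gamma> ^ q)"
proof -
  let ?I = "\<lambda>k. {real k / real Q..<(real k + 1) / real Q}"
  let ?B = "corr_block \<gamma> q m r"
  let ?T = "\<lambda>k. transversal \<gamma> q d (?I k)"
  let ?X = "\<lambda>k u. \<Sum>w<b^q. \<Sum>w'<b^q. if ?T k w w' then ?B w w' u else 0"
  let ?D = "\<lambda>u. (real b ^ q - 1) * (\<Sum>w<b^q. ?B w w u)"
  have bq: "real b ^ q \<ge> 1" using b_pos by (intro one_le_power) auto
  have X0: "0 \<le> ?X k u" for k u by (intro sum_nonneg) (simp add: corr_block_nonneg)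
  have D0: "0 \<le> ?D u" for u using bq by (intro mult_nonneg_nonneg sum_nonneg corr_block_nonneg) auto
  have pt: "corr \<gamma> (q + m) r u \<le> ?X k u + ?D u" if "k < Q" for k u
    unfolding corr_eq_blocks
    using sum_le_diagonal_if_cross_le[where N="b ^ q" and T="?T k" and B="\<lambda>w w'. ?B w w' u",
        OF corr_block_cross_le corr_block_nonneg transversal_sym trans[OF that]] by simp
  have "mean_corr \<gamma> (q + m) r = (\<integral>\<^sup>+u. (\<Sum>k<Q. ennreal (corr \<gamma> (q + m) r u) * indicator (?I k) u) \<partial>lborel)"
    unfolding mean_corr_def sum_distrib_left[symmetric] indicator_unit_split[OF \<open>0 < Q\<close>] ..
  also have "\<dots> \<le> (\<integral>\<^sup>+u. (\<Sum>k<Q. ennreal (?X k u) * indicator (?I k) u + ennreal (?D u) * indicator (?I k) u) \<partial>lborel)"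
    by (intro nn_integral_mono sum_mono, unfold distrib_right[symmetric], intro mult_right_mono)
      (use pt in \<open>simp_all add: ennreal_plus[symmetric] X0 D0 ennreal_leI del: ennreal_plus\<close>)
  also have "\<dots> = (\<integral>\<^sup>+u. (\<Sum>k<Q. ennreal (?X k u) * indicator (?I k) u) \<partial>lborel) +
      (\<integral>\<^sup>+u\<in>{0..<1}. ennreal (?D u) \<partial>lborel)"
    unfolding sum.distrib
    by (subst nn_integral_add) (simp_all only: sum_distrib_left[symmetric] indicator_unit_split[OF \<open>0 < Q\<close>], measurable)
  also have "(\<integral>\<^sup>+u. (\<Sum>k<Q. ennreal (?X k u) * indicator (?I k) u) \<partial>lborel) \<le>
      ennreal (real Q * (16 / d) * r\<^sup>2 * (real b ^ (q + m))\<^sup>2)"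
  proof -
    have "(\<integral>\<^sup>+u. (\<Sum>k<Q. ennreal (?X k u) * indicator (?I k) u) \<partial>lborel) =
       (\<Sum>k<Q. \<Sum>w<b^q. \<Sum>w'<b^q. \<integral>\<^sup>+u\<in>?I k. ennreal (if ?T k w w' then ?B w w' u else 0) \<partial>lborel)"
    proof -
      have "ennreal (?X k u) * indicator (?I k) u =
         (\<Sum>w<b^q. \<Sum>w'<b^q. ennreal (if ?T k w w' then ?B w w' u else 0) * indicator (?I k) u)" for k u
        by (rule ennreal_double_sum_mult) (simp add: corr_block_nonneg)
      then show ?thesis by (simp only:) (subst nn_integral_sum, measurable, intro sum.cong refl,
         subst nn_integral_sum, measurable, intro sum.cong refl, subst nn_integral_sum, measurable)
    qed
    also have "\<dots> \<le> (\<Sum>k<Q. \<Sum>w<b^q. \<Sum>w'<b^q. ennreal ((real b ^ m)\<^sup>2 * (16 * r\<^sup>2 / d)))"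
    proof (intro sum_mono)
      fix k w w'
      show "(\<integral>\<^sup>+u\<in>?I k. ennreal (if ?T k w w' then ?B w w' u else 0) \<partial>lborel) \<le> ennreal ((real b ^ m)\<^sup>2 * (16 * r\<^sup>2 / d))"
      proof (cases "?T k w w'")
        case True
        then show ?thesis using nn_integral_corr_block_le[OF True assms(3,5)] by simp
      qed simp
    qed
    also have "\<dots> = of_nat (Q * (b ^ q * b ^ q)) * ennreal ((real b ^ m)\<^sup>2 * (16 * r\<^sup>2 / d))"
      by (simp add: mult.assoc)
    also have "\<dots> = ennreal (real (Q * (b ^ q * b ^ q)) * ((real b ^ m)\<^sup>2 * (16 * r\<^sup>2 / d)))"
      by (simp only: ennreal_of_nat_eq_real_of_nat[symmetric] ennreal_mult'' ennreal_mult' of_nat_0_le_iff)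
    also have "real (Q * (b ^ q * b ^ q)) * ((real b ^ m)\<^sup>2 * (16 * r\<^sup>2 / d)) = real Q * (16 / d) * r\<^sup>2 * (real b ^ (q + m))\<^sup>2"
      by (simp add: power_add power2_eq_square mult_ac)
    finally show ?thesis .
  qed
  also have "(\<integral>\<^sup>+u\<in>{0..<1}. ennreal (?D u) \<partial>lborel) = ennreal ((real b ^ q - 1) * \<gamma> ^ q * real b ^ q) * mean_corr \<gamma> m (r / \<gamma> ^ q)"
  proof -
    let ?F = "\<lambda>u. ennreal (corr \<gamma> m (r / \<gamma> ^ q) u)"
    have "ennreal (?D u) = ennreal ((real b ^ q - 1) * \<gamma> ^ q) * (\<Sum>w<b^q. ?F ((u + real w) / real (b ^ q)))" for u
      using bq \<open>0 < \<gamma>\<close>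
      by (simp add: corr_block_diagonal sum_distrib_left[symmetric] ennreal_mult[symmetric] sum_nonneg corr_nonneg mult.assoc)
    then have "(\<integral>\<^sup>+u\<in>{0..<1}. ennreal (?D u) \<partial>lborel) =
       (\<integral>\<^sup>+u. ennreal ((real b ^ q - 1) * \<gamma> ^ q) * (\<Sum>w<b^q. ?F ((u + real w) / real (b ^ q)) * indicator {0..<1} u) \<partial>lborel)"
      by (simp only: mult.assoc sum_distrib_right)
    also have "\<dots> = ennreal ((real b ^ q - 1) * \<gamma> ^ q) * (\<Sum>w<b^q. \<integral>\<^sup>+u\<in>{0..<1}. ?F ((u + real w) / real (b ^ q)) \<partial>lborel)"
      by (subst nn_integral_cmult, measurable, subst nn_integral_sum, measurable)
    also have "(\<Sum>w<b^q. \<integral>\<^sup>+u\<in>{0..<1}. ?F ((u + real w) / real (b ^ q)) \<partial>lborel) = of_nat (b ^ q) * mean_corr \<gamma> m (r / \<gamma> ^ q)"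
      unfolding mean_corr_def by (rule nn_integral_unit_split) (use b_pos in auto)
    finally show ?thesis
      using bq \<open>0 < \<gamma>\<close> by (simp add: ennreal_mult ennreal_of_nat_eq_real_of_nat mult.assoc)
  qed
  finally show ?thesis by (simp add: add_right_mono)
qed

lemma mean_corr_trivial:
  assumes "0 \<le> r"
  shows "mean_corr \<gamma> n r \<le> ennreal (2 * r * (real b ^ n)\<^sup>2)"
proof -
  have le: "corr \<gamma> n r u \<le> 2 * r * (real b ^ n)\<^sup>2" for u
  proof -
    have "corr \<gamma> n r u \<le> (\<Sum>j<b^n. \<Sum>j'<b^n. 2 * r)"
      unfolding corr_def by (intro sum_mono tent_le assms)
    then show ?thesis by (simp add: power2_eq_square mult_ac)
  qed
  have "mean_corr \<gamma> n r \<le> (\<integral>\<^sup>+u. ennreal (2 * r * (real b ^ n)\<^sup>2) * indicator {0..<1::real} u \<partial>lborel)"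
    unfolding mean_corr_def by (intro nn_integral_mono mult_right_mono ennreal_leI le) auto
  also have "\<dots> = ennreal (2 * r * (real b ^ n)\<^sup>2) * emeasure lborel {0..<1::real}"
    by (rule nn_integral_cmult_indicator) simp
  finally show ?thesis by simp
qed

lemma mean_corr_bound:
  assumes nd: "\<And>u. \<not> degenerate_at u"
  shows "\<exists>K0>1. \<forall>\<gamma>. 1 / K0 < \<gamma> \<longrightarrow> \<gamma> < 1 \<longrightarrow>
    (\<exists>C\<ge>0. \<forall>n r. \<gamma> ^ n \<le> r \<longrightarrow> mean_corr \<gamma> n r \<le> ennreal (C * r\<^sup>2 * (real b ^ n)\<^sup>2))"
proof -
  obtain q Q d where q: "0 < q" "0 < Q" "0 < (d::real)" and trans: "\<And>\<gamma> k w. 0 \<le> \<gamma> \<Longrightarrow> \<gamma> \<le> 1 \<Longrightarrow>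
      1 - (1 / real b) ^ q \<le> \<gamma> ^ q \<Longrightarrow> k < Q \<Longrightarrow> w < b^q \<Longrightarrow>
      \<exists>w'<b^q. transversal \<gamma> q d {real k / real Q..<(real k + 1) / real Q} w w'"
    using transversal_words[OF nd] by metis
  have bq: "real b ^ q > 1" using b_pos q by simp
  \<comment> \<open>The threshold is where \<open>\<gamma>^q\<close> equals
    \<open>1 - b^(-q)\<close>: beyond it transversal words exist, and it is also exactly the
    condition for \<open>t < 1\<close> below.\<close>
  define x0 where "x0 = root q (1 - (1 / real b) ^ q)"
  have p: "0 < 1 - (1 / real b) ^ q" "1 - (1 / real b) ^ q < 1"
    using bq b_pos by (simp_all add: power_one_over)
  have x0: "0 < x0" "x0 < 1" "x0 ^ q = 1 - (1 / real b) ^ q"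
    using p q unfolding x0_def by (simp_all add: real_root_gt_zero)
  have "\<exists>C\<ge>0. \<forall>n r. \<gamma> ^ n \<le> r \<longrightarrow> mean_corr \<gamma> n r \<le> ennreal (C * r\<^sup>2 * (real b ^ n)\<^sup>2)"
    if \<gamma>: "x0 < \<gamma>" "\<gamma> < 1" for \<gamma>
  proof -
    have \<gamma>0: "0 < \<gamma>" using \<gamma> x0 by linarith
    have \<gamma>q: "1 - (1 / real b) ^ q < \<gamma> ^ q"
      using power_strict_mono[OF \<gamma>(1), of q] x0 q by simp
    \<comment> \<open>The factor of the recursion relative to \<open>r^2 * b^(2 * n)\<close>:
      replacing \<open>r\<close> by \<open>r / \<gamma>^q\<close> costs
      \<open>\<gamma>^(-2 * q)\<close>, dropping \<open>q\<close> digits gains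
      \<open>b^(-2 * q)\<close>.\<close>
    define t where "t = (real b ^ q - 1) / (\<gamma> ^ q * real b ^ q)"
    have t: "0 \<le> t" "t < 1"
    proof -
      show "0 \<le> t" using bq \<gamma>0 by (simp add: t_def)
      have "(1 - (1 / real b) ^ q) * real b ^ q = real b ^ q - 1"
        using bq b_pos by (simp add: power_one_over left_diff_distrib)
      moreover have "(1 - (1 / real b) ^ q) * real b ^ q < \<gamma> ^ q * real b ^ q"
        using \<gamma>q bq by (intro mult_strict_right_mono) linarith+
      ultimately show "t < 1" using \<gamma>0 bq by (simp add: t_def)
    qed
    define C1 where "C1 = real Q * (16 / d)"
    \<comment> \<open>The first entry solves \<open>C1 + t * C = C\<close>; the second covers
      \<open>n < q\<close>, where \<open>r \<ge> \<gamma>^q\<close> and the trivial bound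
      suffices.\<close>
    define C where "C = max (C1 / (1 - t)) (2 / \<gamma> ^ q)"
    have C: "C1 + t * C \<le> C" "2 / \<gamma> ^ q \<le> C"
    proof -
      have "C1 / (1 - t) \<le> C" by (simp add: C_def)
      then show "C1 + t * C \<le> C" using t by (simp add: field_simps)
    qed (simp add: C_def)
    have C0: "0 \<le> C" using C(2) \<gamma>0 by (smt (verit) divide_nonneg_pos zero_less_power)
    have "mean_corr \<gamma> n r \<le> ennreal (C * r\<^sup>2 * (real b ^ n)\<^sup>2)" if "\<gamma> ^ n \<le> r" for n r
      using that
    proof (induction n arbitrary: r rule: less_induct)
      case (less n)
      have r0: "0 < r" using less.prems \<gamma>0 by (meson less_le_trans zero_less_power)
      show ?case
      proof (cases "n < q")
        case True
        then have "\<gamma> ^ q \<le> \<gamma> ^ n" using \<gamma> \<gamma>0 by (intro power_decreasing) auto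
        then have "\<gamma> ^ q \<le> r" using less.prems by linarith
        then have "2 * r \<le> 2 / \<gamma> ^ q * r\<^sup>2" using r0 \<gamma>0 by (simp add: field_simps power2_eq_square)
        also have "\<dots> \<le> C * r\<^sup>2" using C(2) by (intro mult_right_mono) auto
        finally have "2 * r * (real b ^ n)\<^sup>2 \<le> C * r\<^sup>2 * (real b ^ n)\<^sup>2" by (intro mult_right_mono) auto
        then show ?thesis using mean_corr_trivial[of r \<gamma> n] r0 by (meson ennreal_leI less_imp_le order_trans)
      next
        case False
        then obtain m where m: "n = q + m" using le_Suc_ex not_less by metis
        have "\<gamma> ^ m \<le> r / \<gamma> ^ q" using less.prems \<gamma>0 by (simp add: m power_add field_simps)
        then have IH: "mean_corr \<gamma> m (r / \<gamma> ^ q) \<le> ennreal (C * (r / \<gamma> ^ q)\<^sup>2 * (real b ^ m)\<^sup>2)"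
          using less.IH[of m] m q by simp
        have "mean_corr \<gamma> n r \<le> ennreal (C1 * r\<^sup>2 * (real b ^ n)\<^sup>2) +
            ennreal ((real b ^ q - 1) * \<gamma> ^ q * real b ^ q) * mean_corr \<gamma> m (r / \<gamma> ^ q)"
          unfolding m C1_def
          by (rule mean_corr_rec[OF trans]) (use q \<gamma> \<gamma>0 \<gamma>q r0 in auto)
        also have "\<dots> \<le> ennreal (C1 * r\<^sup>2 * (real b ^ n)\<^sup>2) +
            ennreal ((real b ^ q - 1) * \<gamma> ^ q * real b ^ q) * ennreal (C * (r / \<gamma> ^ q)\<^sup>2 * (real b ^ m)\<^sup>2)"
          by (intro add_left_mono mult_left_mono IH) auto
        also have "\<dots> = ennreal (C1 * r\<^sup>2 * (real b ^ n)\<^sup>2 +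
            ((real b ^ q - 1) * \<gamma> ^ q * real b ^ q) * (C * (r / \<gamma> ^ q)\<^sup>2 * (real b ^ m)\<^sup>2))"
          using bq \<gamma>0 C0 q by (subst ennreal_mult[symmetric]) (auto simp: C1_def ennreal_plus[symmetric] simp del: ennreal_plus)
        also have "((real b ^ q - 1) * \<gamma> ^ q * real b ^ q) * (C * (r / \<gamma> ^ q)\<^sup>2 * (real b ^ m)\<^sup>2) =
            t * C * r\<^sup>2 * (real b ^ n)\<^sup>2"
          using \<gamma>0 bq b_pos unfolding t_def m by (simp add: power_add power2_eq_square field_simps)
        also have "C1 * r\<^sup>2 * (real b ^ n)\<^sup>2 + t * C * r\<^sup>2 * (real b ^ n)\<^sup>2 = (C1 + t * C) * (r\<^sup>2 * (real b ^ n)\<^sup>2)"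
          by (simp add: algebra_simps)
        also have "ennreal \<dots> \<le> ennreal (C * (r\<^sup>2 * (real b ^ n)\<^sup>2))"
          by (intro ennreal_leI mult_right_mono C) auto
        finally show ?thesis by (simp add: mult.assoc)
      qed
    qed
    then show ?thesis using C0 by blast
  qed
  moreover have "1 / x0 > 1" using x0 by simp
  ultimately show ?thesis by (intro exI[of _ "1 / x0"]) auto
qed

end

section \<open>Rescaling the graph\<close>

locale weierstrass = c2_periodic +
  fixes l M :: real
  assumes l: "0 < l" "l < 1" "1 < l * real b"
    and M: "0 < M" "\<bar>\<phi> x\<bar> \<le> M" "\<bar>\<psi> x\<bar> \<le> M" "\<bar>\<theta> x\<bar> \<le> M"
begin

definition gam :: real where "gam = 1 / (l * real b)"

lemma gam: "0 < gam" "gam < 1" "1 / real b \<le> gam" "gam * l = 1 / real b"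
proof -
  show "0 < gam" "gam < 1" using l b_pos by (auto simp: gam_def)
  show "1 / real b \<le> gam" using l b_pos by (auto simp: gam_def intro!: divide_left_mono)
  show "gam * l = 1 / real b" using l b_pos by (auto simp: gam_def)
qed

abbreviation f :: "real \<Rightarrow> real" where "f \<equiv> weierstrass_fun \<phi> l b"

lemma f_summable: "summable (\<lambda>n. l ^ n * \<phi> (real b ^ n * x))"
proof (rule summable_comparison_test')
  show "summable (\<lambda>n. l ^ n * M)" using l by (intro summable_mult2 summable_geometric) auto
  show "norm (l ^ n * \<phi> (real b ^ n * x)) \<le> l ^ n * M" if "n \<ge> 0" for n
    using l M by (simp add: abs_mult power_abs[symmetric] mult_left_mono)
qed

lemma f_rec: "f x = \<phi> x + l * f (real b * x)"
proof -
  have "f x = \<phi> x + (\<Sum>n. l ^ Suc n * \<phi> (real b ^ Suc n * x))"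
    unfolding weierstrass_fun_def using suminf_split_head[OF f_summable[of x]] by simp
  also have "(\<Sum>n. l ^ Suc n * \<phi> (real b ^ Suc n * x)) = l * f (real b * x)"
    unfolding weierstrass_fun_def using f_summable[of "real b * x"]
    by (subst suminf_mult[symmetric]) (auto simp: mult_ac)
  finally show ?thesis .
qed

lemma f_periodic: "f (x + 1) = f x"
proof -
  have "\<phi> (real b ^ n * (x + 1)) = \<phi> (real b ^ n * x)" for n
    using per_int[of "real b ^ n * x" "int (b ^ n)"] by (simp add: distrib_left)
  then show ?thesis unfolding weierstrass_fun_def by simp
qed

lemma f_bound: "\<bar>f x\<bar> \<le> M / (1 - l)"
proof -
  have s: "summable (\<lambda>n. l ^ n * M)" using l by (intro summable_mult2 summable_geometric) auto
  have le: "\<bar>l ^ n * \<phi> (real b ^ n * x)\<bar> \<le> l ^ n * M" for n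
    using l M by (simp add: abs_mult power_abs[symmetric] mult_left_mono)
  have a: "summable (\<lambda>n. \<bar>l ^ n * \<phi> (real b ^ n * x)\<bar>)"
    by (rule summable_comparison_test'[OF s]) (use le in auto)
  have "\<bar>f x\<bar> \<le> (\<Sum>n. \<bar>l ^ n * \<phi> (real b ^ n * x)\<bar>)"
    unfolding weierstrass_fun_def by (rule summable_rabs[OF a])
  also have "\<dots> \<le> (\<Sum>n. l ^ n * M)" by (rule suminf_le[OF le a s])
  also have "\<dots> = (\<Sum>n. l ^ n) * M"
    using l by (intro suminf_mult2[symmetric] summable_geometric) auto
  also have "\<dots> = M / (1 - l)" using l by (simp add: suminf_geometric)
  finally show ?thesis .
qed

lemma lip_phi: "\<bar>\<phi> x - \<phi> y\<bar> \<le> M * \<bar>x - y\<bar>"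
  by (rule field_differentiable_bound[of UNIV \<phi> \<psi> M, simplified]) (use deriv1 M in auto)

text \<open>The first \<open>n\<close> terms have Lipschitz constants growing like
  \<open>(l * b)^k\<close>, a geometric sum comparable to its last term; the remaining terms are
  \<open>l^n\<close> times a bounded function.\<close>

lemma f_holder:
  assumes "\<bar>x - y\<bar> \<le> (1 / real b) ^ n"
  shows "\<bar>f x - f y\<bar> \<le> (M / (l * real b - 1) + 2 * M / (1 - l)) * l ^ n"
proof -
  have "\<bar>f x - f y\<bar> \<le> M / (l * real b - 1) * ((l * real b) ^ n - 1) * \<bar>x - y\<bar> + l ^ n * (2 * M / (1 - l))" for x y n
  proof (induction n arbitrary: x y)
    case 0
    then show ?case using f_bound[of x] f_bound[of y] by simp
  next
    case (Suc n)
    let ?D = "\<bar>x - y\<bar>" and ?q = "l * real b"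
    have bD: "\<bar>real b * x - real b * y\<bar> = real b * ?D"
      by (simp add: abs_mult right_diff_distrib[symmetric])
    have "f x - f y = (\<phi> x - \<phi> y) + l * (f (real b * x) - f (real b * y))"
      using f_rec[of x] f_rec[of y] by (simp add: algebra_simps)
    then have "\<bar>f x - f y\<bar> \<le> \<bar>\<phi> x - \<phi> y\<bar> + l * \<bar>f (real b * x) - f (real b * y)\<bar>"
      using l abs_triangle_ineq[of "\<phi> x - \<phi> y" "l * (f (real b * x) - f (real b * y))"] by (simp add: abs_mult)
    also have "\<dots> \<le> M * ?D + l * (M / (?q - 1) * (?q ^ n - 1) * (real b * ?D) + l ^ n * (2 * M / (1 - l)))"
      using Suc[of "real b * x" "real b * y"] l unfolding bD by (intro add_mono lip_phi mult_left_mono) auto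
    also have "\<dots> = (M + M / (?q - 1) * (?q ^ n - 1) * ?q) * ?D + l ^ Suc n * (2 * M / (1 - l))"
      by (simp add: algebra_simps)
    also have "M + M / (?q - 1) * (?q ^ n - 1) * ?q = M / (?q - 1) * (?q ^ Suc n - 1)"
      using l by (simp add: field_simps)
    finally show ?case .
  qed
  from this[of x y n]
  have "\<bar>f x - f y\<bar> \<le> M / (l * real b - 1) * ((l * real b) ^ n - 1) * \<bar>x - y\<bar> + l ^ n * (2 * M / (1 - l))" .
  also have "\<dots> \<le> M / (l * real b - 1) * (l * real b) ^ n * (1 / real b) ^ n + l ^ n * (2 * M / (1 - l))"
    using l M assms by (intro add_right_mono mult_mono) (auto simp: one_le_power)
  also have "\<dots> = M / (l * real b - 1) * (l * real b * (1 / real b)) ^ n + l ^ n * (2 * M / (1 - l))"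
    by (simp only: mult.assoc power_mult_distrib)
  also have "l * real b * (1 / real b) = l" using b_pos by simp
  finally show ?thesis by (simp add: algebra_simps)
qed

lemma f_continuous: "continuous_on S f"
proof (rule continuous_on_subset[OF _ subset_UNIV], unfold continuous_on_iff dist_real_def, intro ballI allI impI)
  fix x e :: real assume e: "0 < e"
  let ?C = "M / (l * real b - 1) + 2 * M / (1 - l)"
  have "(\<lambda>n. ?C * l ^ n) \<longlonglongrightarrow> ?C * 0"
    using l by (intro tendsto_mult tendsto_const LIMSEQ_power_zero) auto
  then have "\<forall>\<^sub>F n in sequentially. ?C * l ^ n < e" using e by (intro order_tendstoD) auto
  then obtain n where n: "?C * l ^ n < e" by (auto simp: eventually_sequentially)
  have "\<bar>f y - f x\<bar> < e" if "\<bar>y - x\<bar> < (1 / real b) ^ n" for y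
    using f_holder[of y x n] that n by linarith
  then show "\<exists>d>0. \<forall>y\<in>UNIV. \<bar>y - x\<bar> < d \<longrightarrow> \<bar>f y - f x\<bar> < e"
    using b_pos by (intro exI[of _ "(1 / real b) ^ n"]) auto
qed

lemma f_measurable[measurable]: "f \<in> borel_measurable borel"
  by (rule borel_measurable_continuous_onI[OF f_continuous])

text \<open>Weighted Birkhoff sum along the backward orbit \<open>x / b\<close>,
  \<open>x / b^2\<close>, ...; by \<open>f_unscale\<close> it is what distinguishes the blown-up
  graph from the graph itself. Its derivative is \<open>slope gam n\<close> because
  \<open>1 / (l * b) = gam\<close>.\<close>

definition birk :: "nat \<Rightarrow> real \<Rightarrow> real" where
  "birk n x = (\<Sum>k<n. (1 / l) ^ Suc k * \<phi> (x / real b ^ Suc k))"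

lemma birk_deriv: "(birk n has_real_derivative slope gam n x) (at x)"
proof -
  have d: "((\<lambda>x. \<phi> (x / real b ^ Suc k)) has_real_derivative \<psi> (x / real b ^ Suc k) * (1 / real b ^ Suc k)) (at x)" for k
    by (rule DERIV_chain2[where f=\<phi> and g="\<lambda>x. x / real b ^ Suc k", OF deriv1])
      (use b_pos in \<open>auto intro!: derivative_eq_intros\<close>)
  have "((\<lambda>x. \<Sum>k<n. (1 / l) ^ Suc k * \<phi> (x / real b ^ Suc k)) has_real_derivative
      (\<Sum>k<n. (1 / l) ^ Suc k * (\<psi> (x / real b ^ Suc k) * (1 / real b ^ Suc k)))) (at x)"
    by (intro DERIV_sum DERIV_cmult d)
  moreover have "(\<Sum>k<n. (1 / l) ^ Suc k * (\<psi> (x / real b ^ Suc k) * (1 / real b ^ Suc k))) = slope gam n x"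
    unfolding slope_def gam_def by (rule sum.cong) (auto simp: power_divide power_mult_distrib)
  ultimately show ?thesis unfolding birk_def[abs_def] by simp
qed

lemma birk_measurable[measurable]: "birk n \<in> borel_measurable borel"
  using birk_deriv by (auto intro!: borel_measurable_continuous_onI continuous_at_imp_continuous_on DERIV_isCont)

lemma f_unscale: "f (y / real b ^ n) = l ^ n * (f y + birk n y)"
proof (induction n)
  case (Suc n)
  have "f (y / real b ^ Suc n) = \<phi> (y / real b ^ Suc n) + l * f (y / real b ^ n)"
    using f_rec[of "y / real b ^ Suc n"] b_pos by simp
  then show ?case using Suc l by (simp add: birk_def field_simps)
qed (simp add: birk_def)

text \<open>The factor \<open>1 - gam^n\<close> is kept because it is what lets the tolerance
  \<open>C\<close> reproduce itself under blow-up.\<close>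

lemma slope_bound: "\<bar>slope gam n x\<bar> \<le> M / (1 - gam) * (1 - gam ^ n)"
proof -
  have "\<bar>slope gam n x\<bar> \<le> (\<Sum>k<n. gam ^ Suc k * M)"
    unfolding slope_def using gam M
    by (intro order_trans[OF sum_abs] sum_mono) (auto simp: abs_mult power_abs[symmetric] intro!: mult_left_mono simp del: power_Suc)
  also have "\<dots> \<le> (\<Sum>k<n. gam ^ k * M)"
    using gam M by (intro sum_mono mult_right_mono power_decreasing) auto
  also have "\<dots> = (\<Sum>k<n. gam ^ k) * M" by (rule sum_distrib_right[symmetric])
  also have "(\<Sum>k<n. gam ^ k) = (1 - gam ^ n) / (1 - gam)" using gam by (simp add: sum_gp_strict)
  finally show ?thesis by (simp add: mult.commute)
qed

lemma birk_diff: "\<bar>birk n x - birk n y\<bar> \<le> M / (1 - gam) * (1 - gam ^ n) * \<bar>x - y\<bar>"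
  by (rule field_differentiable_bound[of UNIV "birk n" "slope gam n", simplified])
    (use birk_deriv slope_bound in auto)

text \<open>\<open>dslope\<close> is bounded by \<open>M\<close> for all \<open>n\<close> at once,
  so the quadratic error does not grow with the depth of the blow-up.\<close>

lemma birk_taylor: "\<bar>birk n x - birk n y - (x - y) * slope gam n x\<bar> \<le> M * \<bar>x - y\<bar> * \<bar>x - y\<bar>"
proof -
  let ?g = "\<lambda>z. birk n z - z * slope gam n x"
  have "\<bar>?g x - ?g y\<bar> \<le> M * \<bar>x - y\<bar> * \<bar>x - y\<bar>"
  proof (rule field_differentiable_bound[of "closed_segment x y" ?g "\<lambda>z. slope gam n z - slope gam n x", simplified])
    fix z assume z: "z \<in> closed_segment x y"
    show "(?g has_field_derivative slope gam n z - slope gam n x) (at z within closed_segment x y)"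
      by (rule has_field_derivative_at_within) (auto intro!: derivative_eq_intros birk_deriv)
    have "\<bar>slope gam n z - slope gam n x\<bar> \<le> M * \<bar>z - x\<bar>"
      by (rule field_differentiable_bound[of UNIV "slope gam n" "dslope gam n", simplified])
        (use slope_deriv dslope_bound[of M gam n] M gam in auto)
    also have "\<dots> \<le> M * \<bar>x - y\<bar>"
      using z M by (intro mult_left_mono) (auto simp: closed_segment_eq_real_ivl split: if_splits)
    finally show "\<bar>slope gam n z - slope gam n x\<bar> \<le> M * \<bar>x - y\<bar>" .
  qed auto
  then show ?thesis by (simp add: algebra_simps)
qed

text \<open>This choice makes the condition \<open>\<bar>f x - f y\<bar> \<le> C * (1 / b) ^ N\<close> reproduce itself under blow-up:
  \<open>C * \<gamma> ^ n\<close> plus the slope bound \<open>M / (1 - \<gamma>) * (1 - \<gamma> ^ n)\<close> is at most \<open>C\<close>.\<close>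

definition C where "C = M / (1 - gam) + 1"

lemma C_pos: "0 < C" using M gam by (simp add: C_def add_pos_pos)

text \<open>The distance of \<open>x\<close> and \<open>y\<close> is bounded below as well, since
  the condition on the values is later divided by it to read off a slope.\<close>

definition annulus :: "nat \<Rightarrow> real \<Rightarrow> real set" where
  "annulus N x = {y. (1 / real b) ^ Suc N < \<bar>x - y\<bar> \<and> \<bar>x - y\<bar> \<le> (1 / real b) ^ N \<and>
     \<bar>f x - f y\<bar> \<le> C * (1 / real b) ^ N}"

definition amass :: "nat \<Rightarrow> real \<Rightarrow> ennreal" where
  "amass N x = emeasure lborel (annulus N x)"

lemma annulus_sets[measurable]: "annulus N x \<in> sets borel"
  unfolding annulus_def by measurable

lemma amass_measurable[measurable]: "amass N \<in> borel_measurable borel"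
proof -
  have "{z \<in> space (borel \<Otimes>\<^sub>M lborel). (1 / real b) ^ Suc N < \<bar>fst z - snd z\<bar> \<and> \<bar>fst z - snd z\<bar> \<le> (1 / real b) ^ N \<and>
     \<bar>f (fst z) - f (snd z)\<bar> \<le> C * (1 / real b) ^ N} \<in> sets (borel \<Otimes>\<^sub>M lborel)" (is "?S \<in> _")
    by measurable
  then have "(\<lambda>x. emeasure lborel (Pair x -` ?S)) \<in> borel_measurable borel"
    by (rule lborel.measurable_emeasure_Pair)
  moreover have "Pair x -` ?S = annulus N x" for x
    by (auto simp: annulus_def space_pair_measure)
  ultimately show ?thesis unfolding amass_def[abs_def] by (simp only:)
qed

lemma amass_le: "amass N x \<le> ennreal (2 * (1 / real b) ^ N)"
proof -
  have "amass N x \<le> emeasure lborel {x - (1 / real b) ^ N .. x + (1 / real b) ^ N}"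
    unfolding amass_def by (intro emeasure_mono) (auto simp: annulus_def abs_le_iff)
  then show ?thesis by (simp add: emeasure_lborel_Icc_eq)
qed

lemma emeasure_lborel_unscale:
  assumes [measurable]: "A \<in> sets borel" and m: "(0::real) < m"
  shows "emeasure lborel A = ennreal (1 / m) * emeasure lborel {v. (v + t) / m \<in> A}"
proof -
  have [measurable]: "{v. (v + t) / m \<in> A} \<in> sets borel" by measurable
  have "emeasure lborel A = (\<integral>\<^sup>+x. indicator A x \<partial>lborel)" by simp
  also have "\<dots> = ennreal \<bar>1 / m\<bar> * (\<integral>\<^sup>+v. indicator A (t / m + (1 / m) * v) \<partial>lborel)"
    by (rule nn_integral_real_affine) (use m in auto)
  also have "(\<lambda>v. indicator A (t / m + (1 / m) * v) :: ennreal) = indicator {v. (v + t) / m \<in> A}"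
    using m by (auto simp: fun_eq_iff indicator_def add_divide_distrib add.commute)
  finally show ?thesis using m by simp
qed

lemma amass_periodic: "amass N (x + 1) = amass N x"
proof -
  have "v + 1 \<in> annulus N (x + 1) \<longleftrightarrow> v \<in> annulus N x" for v
    by (simp add: annulus_def f_periodic)
  then show ?thesis
    unfolding amass_def by (subst emeasure_lborel_unscale[where m=1 and t=1]) auto
qed

text \<open>An annulus-type set around \<open>(u + j) / b^n\<close>, blown up by \<open>b^n\<close>.
  The tolerance \<open>\<rho>\<close> is measured after division by \<open>l^n\<close> and is left
  free because annuli and squares lead to different values of it.\<close>

definition pulled :: "nat \<Rightarrow> nat \<Rightarrow> real \<Rightarrow> real \<Rightarrow> nat \<Rightarrow> real set" where
  "pulled n N \<rho> u j = {v. (1 / real b) ^ Suc N < \<bar>u - v\<bar> \<and> \<bar>u - v\<bar> \<le> (1 / real b) ^ N \<and>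
     \<bar>(f u - f v) + (birk n (u + real j) - birk n (v + real j))\<bar> \<le> \<rho>}"

lemma pulled_sets[measurable]: "pulled n N \<rho> u j \<in> sets borel"
  unfolding pulled_def by measurable

lemma f_shift: "f (u + real j) = f u"
  using shift_int_if_shift_1[of f u "int j", OF f_periodic] by simp

lemma emeasure_pulled:
  "emeasure lborel {y. (1 / real b) ^ Suc (n + N) < \<bar>(u + real j) / real b ^ n - y\<bar> \<and>
      \<bar>(u + real j) / real b ^ n - y\<bar> \<le> (1 / real b) ^ (n + N) \<and>
      \<bar>f ((u + real j) / real b ^ n) - f y\<bar> \<le> l ^ n * \<rho>}
    = ennreal ((1 / real b) ^ n) * emeasure lborel (pulled n N \<rho> u j)"
proof -
  let ?A = "{y. (1 / real b) ^ Suc (n + N) < \<bar>(u + real j) / real b ^ n - y\<bar> \<and>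
      \<bar>(u + real j) / real b ^ n - y\<bar> \<le> (1 / real b) ^ (n + N) \<and>
      \<bar>f ((u + real j) / real b ^ n) - f y\<bar> \<le> l ^ n * \<rho>}"
  have bn: "0 < real b ^ n" using b_pos by simp
  have "emeasure lborel ?A = ennreal (1 / real b ^ n) * emeasure lborel {v. (v + real j) / real b ^ n \<in> ?A}"
    by (rule emeasure_lborel_unscale[OF _ bn]) measurable
  also have "{v. (v + real j) / real b ^ n \<in> ?A} = pulled n N \<rho> u j"
  proof (rule set_eqI)
    fix v
    have 1: "\<bar>(u + real j) / real b ^ n - (v + real j) / real b ^ n\<bar> = (1 / real b) ^ n * \<bar>u - v\<bar>"
      using bn by (simp add: diff_divide_distrib[symmetric] power_one_over)
    have 2: "\<bar>f ((u + real j) / real b ^ n) - f ((v + real j) / real b ^ n)\<bar> =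
        l ^ n * \<bar>(f u - f v) + (birk n (u + real j) - birk n (v + real j))\<bar>"
      unfolding f_unscale f_shift right_diff_distrib[symmetric] abs_mult using l by (simp add: algebra_simps)
    have 3: "0 < (1 / real b) ^ n" "0 < l ^ n" using l b_pos by auto
    have 4: "(1 / real b) ^ Suc (n + N) = (1 / real b) ^ n * (1 / real b) ^ Suc N"
      "(1 / real b) ^ (n + N) = (1 / real b) ^ n * (1 / real b) ^ N"
      by (simp_all only: power_add[symmetric] add_Suc_right)
    show "v \<in> {v. (v + real j) / real b ^ n \<in> ?A} \<longleftrightarrow> v \<in> pulled n N \<rho> u j"
      unfolding mem_Collect_eq pulled_def 1 2 4 mult_less_cancel_left_pos[OF 3(1)] mult_le_cancel_left_pos[OF 3(1)]
        mult_le_cancel_left_pos[OF 3(2)] ..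
  qed
  finally show ?thesis by (simp only: power_one_over)
qed

lemma amass_pulled:
  "amass (n + N) ((u + real j) / real b ^ n) =
    ennreal ((1 / real b) ^ n) * emeasure lborel (pulled n N (C * gam ^ n * (1 / real b) ^ N) u j)"
proof -
  have "l ^ n * (C * gam ^ n * (1 / real b) ^ N) = C * (gam * l) ^ n * (1 / real b) ^ N"
    by (simp add: power_mult_distrib mult_ac)
  also have "\<dots> = C * (1 / real b) ^ (n + N)" by (simp add: gam power_add)
  finally have eq: "l ^ n * (C * gam ^ n * (1 / real b) ^ N) = C * (1 / real b) ^ (n + N)" .
  show ?thesis unfolding amass_def annulus_def emeasure_pulled[symmetric] eq ..
qed

lemma pulled_subset_annulus:
  assumes "\<rho> \<le> (1 + (C - 1) * gam ^ n) * (1 / real b) ^ N"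
  shows "pulled n N \<rho> u j \<subseteq> annulus N u"
proof
  fix v assume v: "v \<in> pulled n N \<rho> u j"
  have "\<bar>birk n (u + real j) - birk n (v + real j)\<bar> \<le> M / (1 - gam) * (1 - gam ^ n) * \<bar>u - v\<bar>"
    using birk_diff[of n "u + real j" "v + real j"] by simp
  also have "\<dots> \<le> (C - 1) * (1 - gam ^ n) * (1 / real b) ^ N"
  proof -
    have "M / (1 - gam) = C - 1" "0 \<le> C - 1" using gam M by (simp_all add: C_def)
    then show ?thesis
      using v gam by (intro mult_mono mult_nonneg_nonneg) (auto simp: pulled_def power_le_one)
  qed
  finally have "\<bar>f u - f v\<bar> \<le> (1 + (C - 1) * gam ^ n) * (1 / real b) ^ N + (C - 1) * (1 - gam ^ n) * (1 / real b) ^ N"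
    using v assms unfolding pulled_def by (simp, linarith)
  also have "\<dots> = C * (1 / real b) ^ N" by (simp add: algebra_simps)
  finally show "v \<in> annulus N u" using v unfolding pulled_def annulus_def by simp
qed

end

section \<open>Improving the local dimension\<close>

context weierstrass
begin

text \<open>Dividing the tolerance \<open>C * gam^n * b^(-N)\<close> by a distance of at least
  \<open>b^(-N-1)\<close> gives the part with \<open>b * C\<close>; the Taylor error gives the part
  with \<open>M\<close>.\<close>

definition rad :: "nat \<Rightarrow> real" where "rad n = (real b * C + M) * gam ^ n"

lemma rad: "0 < rad n" "gam ^ n \<le> rad n"
proof -
  have "1 * 1 \<le> real b * C" using b_pos M gam by (intro mult_mono) (auto simp: C_def)
  then have "1 \<le> real b * C + M" using M by linarith
  then show "gam ^ n \<le> rad n" unfolding rad_def using gam mult_right_mono[of 1 _ "gam ^ n"] by simp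
  then show "0 < rad n" using gam by (meson less_le_trans zero_less_power)
qed

text \<open>At scales finer than \<open>gam ^ n\<close> the curves \<open>birk n (\<cdot> + j)\<close> are indistinguishable from straight lines,
  so a point of \<open>pulled\<close> pins down the slope of the curve.\<close>

lemma slope_if_pulled:
  assumes v: "v \<in> pulled n N (C * gam ^ n * (1 / real b) ^ N) u j" and n: "n \<le> N"
  shows "\<bar>(f u - f v) / (u - v) + slope gam n (u + real j)\<bar> \<le> rad n"
proof -
  let ?d = "\<bar>u - v\<bar>"
  have d: "0 < ?d" "(1 / real b) ^ N \<le> real b * ?d" "?d \<le> (1 / real b) ^ N"
    using v b_pos unfolding pulled_def by (auto simp: field_simps)
  \<comment> \<open>This is where \<open>n \<le> N\<close> enters: the distance is at most
    \<open>gam^n\<close>, so the quadratic error is at most \<open>M * gam^n\<close> times the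
    distance.\<close>
  have "(1 / real b) ^ N \<le> (1 / real b) ^ n" using n b_pos by (intro power_decreasing) auto
  also have "\<dots> \<le> gam ^ n" using gam b_pos by (intro power_mono) auto
  finally have dg: "?d \<le> gam ^ n" using d by linarith
  define X where "X = (f u - f v) + (birk n (u + real j) - birk n (v + real j))"
  define Y where "Y = birk n (u + real j) - birk n (v + real j) - (u - v) * slope gam n (u + real j)"
  have X: "\<bar>X\<bar> \<le> C * gam ^ n * (real b * ?d)"
  proof -
    have "\<bar>X\<bar> \<le> C * gam ^ n * (1 / real b) ^ N" using v by (simp add: pulled_def X_def)
    also have "\<dots> \<le> C * gam ^ n * (real b * ?d)"
      using C_pos gam by (intro mult_left_mono d) auto
    finally show ?thesis .
  qed
  have Y: "\<bar>Y\<bar> \<le> M * gam ^ n * ?d"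
  proof -
    have "\<bar>Y\<bar> \<le> M * ?d * ?d" using birk_taylor[of n "u + real j" "v + real j"] by (simp add: Y_def)
    also have "\<dots> \<le> M * gam ^ n * ?d" using dg M by (intro mult_right_mono mult_left_mono) auto
    finally show ?thesis .
  qed
  have "(f u - f v) / (u - v) + slope gam n (u + real j) = (X - Y) / (u - v)"
    using d(1) by (simp add: X_def Y_def field_simps)
  then have "\<bar>(f u - f v) / (u - v) + slope gam n (u + real j)\<bar> = \<bar>X - Y\<bar> / ?d" by simp
  also have "\<dots> \<le> (rad n * ?d) / ?d"
  proof (rule divide_right_mono)
    have "\<bar>X - Y\<bar> \<le> C * gam ^ n * (real b * ?d) + M * gam ^ n * ?d" using X Y by linarith
    then show "\<bar>X - Y\<bar> \<le> rad n * ?d" by (simp add: rad_def algebra_simps)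
  qed simp
  finally show ?thesis using d(1) by simp
qed

text \<open>Up to the radius as a factor, a smoothed count of the words whose slope is close to that
  of \<open>j\<close>; words with a large value will be discarded. Summed over \<open>j\<close> it
  is \<open>corr\<close>.\<close>

definition crowd :: "nat \<Rightarrow> real \<Rightarrow> nat \<Rightarrow> real" where
  "crowd n u j = (\<Sum>j'<b^n. tent (2 * rad n) (slope gam n (u + real j) - slope gam n (u + real j')))"

lemma crowd_nonneg: "0 \<le> crowd n u j"
  by (simp add: crowd_def sum_nonneg tent_nonneg)

lemma crowd_measurable[measurable]: "(\<lambda>u. crowd n u j) \<in> borel_measurable borel"
  unfolding crowd_def by measurable

text \<open>All these words have slopes within \<open>rad n\<close> of one number, minus the
  difference quotient, hence within \<open>2 * rad n\<close> of each other. Each of them adds at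
  least \<open>2 * rad n\<close> to the crowd of any one of them, which is at most
  \<open>\<tau>\<close>.\<close>

lemma card_pulled_le:
  assumes n: "n \<le> N" and \<tau>: "0 \<le> \<tau>"
  shows "real (card {j. j < b ^ n \<and> crowd n u j \<le> \<tau> \<and> v \<in> pulled n N (C * gam ^ n * (1 / real b) ^ N) u j}) \<le> \<tau> / (2 * rad n)"
    (is "real (card ?J) \<le> _")
proof (cases "?J = {}")
  case True
  then show ?thesis using \<tau> rad(1)[of n] by (simp only: card.empty) simp
next
  case False
  then obtain j0 where j0: "j0 \<in> ?J" by blast
  have "real (card ?J) * (2 * rad n) = (\<Sum>j\<in>?J. 2 * rad n)" by simp
  also have "\<dots> \<le> (\<Sum>j\<in>?J. tent (2 * rad n) (slope gam n (u + real j0) - slope gam n (u + real j)))"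
  proof (intro sum_mono tent_ge)
    fix j assume "j \<in> ?J"
    then show "\<bar>slope gam n (u + real j0) - slope gam n (u + real j)\<bar> \<le> 2 * rad n"
      using slope_if_pulled[OF _ n, of v u j] slope_if_pulled[OF _ n, of v u j0] j0 by auto
  qed
  also have "\<dots> \<le> crowd n u j0"
    unfolding crowd_def by (intro sum_mono2) (auto simp: tent_nonneg)
  also have "\<dots> \<le> \<tau>" using j0 by simp
  finally show ?thesis using rad(1)[of n] by (simp add: field_simps)
qed

lemma sum_pulled_le:
  assumes n: "n \<le> N" and \<tau>: "0 \<le> \<tau>"
  shows "(\<Sum>j | j < b ^ n \<and> crowd n u j \<le> \<tau>. emeasure lborel (pulled n N (C * gam ^ n * (1 / real b) ^ N) u j))
    \<le> ennreal (\<tau> / (2 * rad n)) * amass N u"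
proof -
  let ?P = "pulled n N (C * gam ^ n * (1 / real b) ^ N) u" and ?J = "{j. j < b ^ n \<and> crowd n u j \<le> \<tau>}"
  have sub: "?P j \<subseteq> annulus N u" for j
  proof (rule pulled_subset_annulus, rule mult_right_mono)
    show "C * gam ^ n \<le> 1 + (C - 1) * gam ^ n" using gam by (simp add: algebra_simps power_le_one)
  qed (use b_pos in auto)
  have "(\<Sum>j\<in>?J. emeasure lborel (?P j)) = (\<Sum>j\<in>?J. \<integral>\<^sup>+v. indicator (?P j) v \<partial>lborel)"
    by (intro sum.cong refl nn_integral_indicator[symmetric]) simp
  also have "\<dots> = (\<integral>\<^sup>+v. (\<Sum>j\<in>?J. indicator (?P j) v) \<partial>lborel)"
    by (rule nn_integral_sum[symmetric]) simp
  also have "\<dots> \<le> (\<integral>\<^sup>+v. ennreal (\<tau> / (2 * rad n)) * indicator (annulus N u) v \<partial>lborel)"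
  proof (rule nn_integral_mono)
    fix v :: real
    show "(\<Sum>j\<in>?J. indicator (?P j) v) \<le> ennreal (\<tau> / (2 * rad n)) * indicator (annulus N u) v"
    proof (cases "v \<in> annulus N u")
      case True
      have "(\<Sum>j\<in>?J. indicator (?P j) v :: ennreal) = of_nat (card (?J \<inter> {j. v \<in> ?P j}))"
        by (simp add: indicator_def sum.If_cases)
      also have "?J \<inter> {j. v \<in> ?P j} = {j. j < b ^ n \<and> crowd n u j \<le> \<tau> \<and> v \<in> ?P j}" by blast
      also have "(of_nat (card {j. j < b ^ n \<and> crowd n u j \<le> \<tau> \<and> v \<in> ?P j}) :: ennreal) \<le> ennreal (\<tau> / (2 * rad n))"
        unfolding ennreal_of_nat_eq_real_of_nat by (intro ennreal_leI card_pulled_le n \<tau>)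
      finally show ?thesis using True by simp
    next
      case False
      then have "v \<notin> ?P j" for j using sub by blast
      then show ?thesis by simp
    qed
  qed
  also have "\<dots> = ennreal (\<tau> / (2 * rad n)) * amass N u"
    unfolding amass_def by (rule nn_integral_cmult_indicator) simp
  finally show ?thesis .
qed

definition bad :: "nat \<Rightarrow> real \<Rightarrow> ennreal" where
  "bad N a = emeasure lborel {x \<in> {0..<1}. ennreal a < amass N x}"

lemma bad_eq: "bad N a = (\<integral>\<^sup>+x\<in>{0..<1}. indicator {x. ennreal a < amass N x} x \<partial>lborel)"
proof -
  have "bad N a = (\<integral>\<^sup>+x. indicator {x \<in> {0..<1}. ennreal a < amass N x} x \<partial>lborel)"
    unfolding bad_def by (rule nn_integral_indicator[symmetric]) measurable
  also have "\<dots> = (\<integral>\<^sup>+x\<in>{0..<1}. indicator {x. ennreal a < amass N x} x \<partial>lborel)"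
    by (intro nn_integral_cong) (auto simp: indicator_def)
  finally show ?thesis .
qed

text \<open>A word leads to a bad point for one of three reasons. Either \<open>u\<close> is already
  bad, and then all words are counted; or the word is crowded, which Markov's inequality charges to
  \<open>corr\<close>; or it is uncrowded, and Markov's inequality for the total mass over such
  words bounds their number.\<close>

lemma bad_count_le:
  assumes n: "n \<le> N" and a: "0 \<le> a" "0 < a'" and \<tau>: "0 < \<tau>"
  shows "(\<Sum>j<b^n. indicator {x. ennreal a' < amass (n + N) x} ((u + real j) / real (b ^ n))) \<le>
    of_nat (b ^ n) * indicator {x. ennreal a < amass N x} u + ennreal (1 / \<tau>) * ennreal (corr gam n (2 * rad n) u) +
    ennreal ((1 / real b) ^ n * (\<tau> / (2 * rad n)) * a / a')"
    (is "(\<Sum>j<b^n. ?ind j) \<le> ?R1 + ?R2 + ?R3")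
proof (cases "ennreal a < amass N u")
  case True
  have "(\<Sum>j<b^n. ?ind j) \<le> (\<Sum>j<b^n. 1 :: ennreal)" by (intro sum_mono) (simp add: indicator_def)
  also have "\<dots> = ?R1" using True by simp
  finally show ?thesis by (meson add_increasing2 order_trans zero_le)
next
  case False
  let ?J = "{j. j < b ^ n \<and> crowd n u j \<le> \<tau>}" and ?J' = "{j. j < b ^ n \<and> \<not> crowd n u j \<le> \<tau>}"
  have J: "{..<b^n} = ?J \<union> ?J'" by auto
  have "(\<Sum>j<b^n. ?ind j) = (\<Sum>j\<in>?J. ?ind j) + (\<Sum>j\<in>?J'. ?ind j)"
    unfolding J by (rule sum.union_disjoint) auto
  also have "(\<Sum>j\<in>?J'. ?ind j) \<le> ?R2"
  proof -
    have "(\<Sum>j\<in>?J'. ?ind j) \<le> (\<Sum>j\<in>?J'. ennreal (crowd n u j / \<tau>))"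
    proof (rule sum_mono)
      fix j assume "j \<in> ?J'"
      then have "1 \<le> crowd n u j / \<tau>" using \<tau> by simp
      then have "1 \<le> ennreal (crowd n u j / \<tau>)" by (metis ennreal_1 ennreal_leI)
      moreover have "?ind j \<le> 1" by (simp add: indicator_def)
      ultimately show "?ind j \<le> ennreal (crowd n u j / \<tau>)" by (rule order_trans[rotated])
    qed
    also have "\<dots> \<le> (\<Sum>j<b^n. ennreal (crowd n u j / \<tau>))"
      by (intro sum_mono2) auto
    also have "\<dots> = ennreal (\<Sum>j<b^n. crowd n u j / \<tau>)"
      using \<tau> crowd_nonneg by (intro sum_ennreal) simp
    also have "(\<Sum>j<b^n. crowd n u j / \<tau>) = 1 / \<tau> * corr gam n (2 * rad n) u"
      unfolding corr_def crowd_def[symmetric] by (simp add: sum_divide_distrib)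
    also have "ennreal \<dots> = ?R2" using \<tau> by (intro ennreal_mult') simp
    finally show ?thesis .
  qed
  also have "(\<Sum>j\<in>?J. ?ind j) \<le> ?R3"
  proof -
    have "ennreal a' * (\<Sum>j\<in>?J. ?ind j) \<le> (\<Sum>j\<in>?J. amass (n + N) ((u + real j) / real b ^ n))"
      unfolding sum_distrib_left by (intro sum_mono) (auto simp: indicator_def)
    also have "\<dots> \<le> ennreal ((1 / real b) ^ n) * (ennreal (\<tau> / (2 * rad n)) * amass N u)"
      unfolding amass_pulled sum_distrib_left[symmetric] by (intro mult_left_mono sum_pulled_le n) (use \<tau> in auto)
    also have "\<dots> \<le> ennreal ((1 / real b) ^ n) * (ennreal (\<tau> / (2 * rad n)) * ennreal a)"
      using False by (intro mult_left_mono) auto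
    also have "\<dots> = ennreal a' * ?R3"
      using a \<tau> rad(1)[of n] b_pos by (simp add: ennreal_mult[symmetric])
    finally have "ennreal a' * (\<Sum>j\<in>?J. ?ind j) \<le> ennreal a' * ?R3" .
    then show ?thesis using a by (simp add: ennreal_mult_le_mult_iff)
  qed
  finally have "(\<Sum>j<b^n. ?ind j) \<le> ?R3 + ?R2" by (simp add: add_mono)
  then show ?thesis by (simp add: False add.commute)
qed

lemma ennreal_power_cancel: "ennreal ((1 / real b) ^ n) * (of_nat (b ^ n) * z) = z"
proof -
  have "ennreal ((1 / real b) ^ n) * of_nat (b ^ n) = ennreal ((1 / real b) ^ n * real (b ^ n))"
    by (simp only: ennreal_of_nat_eq_real_of_nat) (rule ennreal_mult[symmetric], auto)
  also have "(1 / real b) ^ n * real (b ^ n) = 1" using b_pos by (simp add: power_one_over)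
  finally show ?thesis by (simp add: mult.assoc[symmetric])
qed

text \<open>\<open>bad_count_le\<close> averaged over \<open>u\<close>: the branches
  \<open>(u + j) / b^n\<close> tile \<open>[0, 1)\<close>, so the average proportion of counted
  words is the measure of the bad set at depth \<open>n + N\<close>.\<close>

lemma bad_step:
  assumes n: "n \<le> N" and a: "0 \<le> a" "0 < a'" and \<tau>: "0 < \<tau>"
  shows "bad (n + N) a' \<le> bad N a + ennreal ((1 / real b) ^ n / \<tau>) * mean_corr gam n (2 * rad n) +
    ennreal ((1 / real b) ^ n * ((1 / real b) ^ n * (\<tau> / (2 * rad n)) * a / a'))"
proof -
  let ?F = "indicator {x. ennreal a' < amass (n + N) x} :: real \<Rightarrow> ennreal"
  let ?G = "indicator {x. ennreal a < amass N x} :: real \<Rightarrow> ennreal"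
  let ?c = "(1 / real b) ^ n * (\<tau> / (2 * rad n)) * a / a'"
  have bn: "0 < b ^ n" "0 < real (b ^ n)" using b_pos by auto
  have c0: "0 \<le> ?c" using a \<tau> rad(1)[of n] b_pos by simp
  have [measurable]: "?F \<in> borel_measurable borel" "?G \<in> borel_measurable borel" by measurable
  have "of_nat (b ^ n) * bad (n + N) a' = (\<Sum>j<b^n. \<integral>\<^sup>+u\<in>{0..<1}. ?F ((u + real j) / real (b ^ n)) \<partial>lborel)"
    unfolding bad_eq by (rule nn_integral_unit_split[symmetric]) (use bn in auto)
  also have "\<dots> = (\<integral>\<^sup>+u. (\<Sum>j<b^n. ?F ((u + real j) / real (b ^ n)) * indicator {0..<1} u) \<partial>lborel)"
    by (rule nn_integral_sum[symmetric]) measurable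
  also have "\<dots> = (\<integral>\<^sup>+u\<in>{0..<1}. (\<Sum>j<b^n. ?F ((u + real j) / real (b ^ n))) \<partial>lborel)"
    by (simp only: sum_distrib_right)
  also have "\<dots> \<le> (\<integral>\<^sup>+u\<in>{0..<1}. (of_nat (b ^ n) * ?G u + ennreal (1 / \<tau>) * ennreal (corr gam n (2 * rad n) u) + ennreal ?c) \<partial>lborel)"
    by (intro nn_integral_mono mult_right_mono bad_count_le n a \<tau>) auto
  also have "\<dots> = (\<integral>\<^sup>+u. of_nat (b ^ n) * (?G u * indicator {0..<1} u) +
      ennreal (1 / \<tau>) * (ennreal (corr gam n (2 * rad n) u) * indicator {0..<1} u) + ennreal ?c * indicator {0..<1} u \<partial>lborel)"
    by (simp only: distrib_right mult.assoc)
  also have "\<dots> = of_nat (b ^ n) * bad N a + ennreal (1 / \<tau>) * mean_corr gam n (2 * rad n) + ennreal ?c"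
    unfolding bad_eq mean_corr_def
    by (simp add: nn_integral_add nn_integral_cmult nn_integral_cmult_indicator)
  finally have le: "of_nat (b ^ n) * bad (n + N) a' \<le> of_nat (b ^ n) * bad N a + ennreal (1 / \<tau>) * mean_corr gam n (2 * rad n) + ennreal ?c" .
  have "bad (n + N) a' = ennreal ((1 / real b) ^ n) * (of_nat (b ^ n) * bad (n + N) a')" by (simp only: ennreal_power_cancel)
  also have "\<dots> \<le> ennreal ((1 / real b) ^ n) * (of_nat (b ^ n) * bad N a + ennreal (1 / \<tau>) * mean_corr gam n (2 * rad n) + ennreal ?c)"
    by (intro mult_left_mono le) auto
  also have "\<dots> = bad N a + ennreal ((1 / real b) ^ n) * ennreal (1 / \<tau>) * mean_corr gam n (2 * rad n) + ennreal ((1 / real b) ^ n) * ennreal ?c"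
    by (simp only: distrib_left ennreal_power_cancel mult.assoc)
  also have "ennreal ((1 / real b) ^ n) * ennreal (1 / \<tau>) = ennreal ((1 / real b) ^ n / \<tau>)"
    using \<tau> by (subst ennreal_mult[symmetric]) auto
  also have "ennreal ((1 / real b) ^ n) * ennreal ?c = ennreal ((1 / real b) ^ n * ?c)"
    using c0 by (subst ennreal_mult[symmetric]) auto
  finally show ?thesis .
qed

end

section \<open>Exponents to base \<open>b\<close> and the bootstrap of the local dimension\<close>

context weierstrass
begin

abbreviation bpow :: "real \<Rightarrow> real" where "bpow t \<equiv> real b powr t"

lemma bpow_le: "bpow s \<le> bpow t \<longleftrightarrow> s \<le> t"
  using b_pos by simp

lemma bpow_minus_nat: "(1 / real b) ^ n = bpow (- real n)"
  using b_pos by (simp add: powr_minus powr_realpow power_one_over inverse_eq_divide)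

definition kap :: real where "kap = - log (real b) gam"

lemma gam_bpow: "gam ^ n = bpow (- (kap * real n))"
proof -
  have "bpow (- kap) = gam" using gam b_pos by (simp add: kap_def)
  then have "gam ^ n = (bpow (- kap)) powr real n" using gam by (simp add: powr_realpow)
  then show ?thesis by (simp add: powr_powr)
qed

lemma kap: "0 < kap" "kap < 1" and dimension_eq: "1 + kap = 2 + ln l / ln (real b)"
proof -
  have lnb: "0 < ln (real b)" using b_pos by simp
  have "ln gam = - (ln l + ln (real b))" using l b_pos by (simp add: gam_def ln_div ln_mult)
  then have "kap = (ln l + ln (real b)) / ln (real b)" unfolding kap_def log_def by (simp only: minus_divide_left minus_minus)
  then have *: "kap = 1 + ln l / ln (real b)" using lnb by (simp add: add_divide_distrib)
  then show "1 + kap = 2 + ln l / ln (real b)" by simp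
  have "ln l < 0" using l by simp
  then show "kap < 1" using * lnb by (simp add: divide_neg_pos)
  show "0 < kap" using gam b_pos by (simp add: kap_def log_less_zero_cancel_iff)
qed

text \<open>Local dimension at least \<open>\<delta>\<close> off exceptional sets that are
  exponentially small in the scale; this decay is what survives the final sum over all shells and
  scales.\<close>

definition rate :: "real \<Rightarrow> bool" where
  "rate \<delta> \<longleftrightarrow> (\<exists>A\<ge>0. \<exists>c>0. \<exists>B\<ge>0. \<forall>N. bad N (A * bpow (- (\<delta> * real N))) \<le> ennreal (B * bpow (- (c * real N))))"

lemma bad_antimono: "a \<le> a' \<Longrightarrow> bad N a' \<le> bad N a"
  unfolding bad_def by (intro emeasure_mono) (auto intro: le_less_trans[OF ennreal_leI])

lemma rate_1: "rate 1"
proof -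
  have "bad N (2 * bpow (- (1 * real N))) = 0" for N
    using amass_le[of N] unfolding bad_def bpow_minus_nat by (simp add: not_less[symmetric])
  then show ?thesis unfolding rate_def by (intro exI[of _ 2] exI[of _ 1] exI[of _ 0] conjI allI) auto
qed

lemma rate_mono:
  assumes "rate \<delta>" "\<delta>' \<le> \<delta>"
  shows "rate \<delta>'"
proof -
  obtain A c B where A: "0 \<le> A" "0 < c" "0 \<le> B" "\<And>N. bad N (A * bpow (- (\<delta> * real N))) \<le> ennreal (B * bpow (- (c * real N)))"
    using assms(1) unfolding rate_def by blast
  have "bad N (A * bpow (- (\<delta>' * real N))) \<le> ennreal (B * bpow (- (c * real N)))" for N
    by (rule order_trans[OF bad_antimono A(4)])
      (use A(1) assms(2) in \<open>auto intro!: mult_left_mono mult_right_mono simp: bpow_le\<close>)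
  then show ?thesis unfolding rate_def using A by blast
qed

text \<open>Splits \<open>N = n + L\<close> evenly: the \<open>n\<close> outer digits contribute dimension \<open>1 + kap\<close>, the inner scale \<open>L\<close> contributes \<open>\<delta>\<close>.\<close>

lemma rate_step:
  assumes corr: "0 \<le> K" "\<And>n r. gam ^ n \<le> r \<Longrightarrow> mean_corr gam n r \<le> ennreal (K * r\<^sup>2 * (real b ^ n)\<^sup>2)"
    and \<delta>: "rate \<delta>" "0 \<le> \<delta>" and \<eta>: "0 < \<eta>"
  shows "rate ((1 + kap + \<delta>) / 2 - \<eta>)"
proof -
  obtain A c B where A: "0 \<le> A" "0 < c" "0 \<le> B" "\<And>N. bad N (A * bpow (- (\<delta> * real N))) \<le> ennreal (B * bpow (- (c * real N)))"
    using \<delta>(1) unfolding rate_def by blast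
  define R where "R = real b * C + M"
  have R: "0 < R" using C_pos M b_pos by (simp add: R_def add_pos_pos)
  \<comment> \<open>One constant for each term of \<open>bad_step\<close>; the last factor pays for
    \<open>n\<close> being only at least \<open>(N - 1) / 2\<close>.\<close>
  define B' where "B' = B + 4 * K + R * A / 2 * bpow ((1 + kap) / 2)"
  \<comment> \<open>\<open>c / 2\<close> because the old estimate is used at the scale
    \<open>L \<ge> N / 2\<close>; \<open>\<eta> / 2\<close> because half of the loss
    \<open>\<eta>\<close> is spent on \<open>\<tau>\<close> and half remains.\<close>
  define c' where "c' = min (c / 2) (\<eta> / 2)"
  define \<delta>' where "\<delta>' = (1 + kap + \<delta>) / 2 - \<eta>"
  have c': "0 < c'" using A(2) \<eta> by (simp add: c'_def)
  have B': "0 \<le> B'" using A corr(1) R by (simp add: B'_def)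
  have "bad N (1 * bpow (- (\<delta>' * real N))) \<le> ennreal (B' * bpow (- (c' * real N)))" for N
  proof -
    define n where "n = N div 2"
    define L where "L = N - n"
    have N: "N = n + L" "n \<le> L" by (auto simp: n_def L_def)
    have nL: "(real N - 1) / 2 \<le> real n" "real N / 2 \<le> real L"
    proof -
      have "N \<le> 2 * n + 1" "N \<le> 2 * L" by (auto simp: n_def L_def)
      then have "real N \<le> real (2 * n + 1)" "real N \<le> real (2 * L)" by (simp_all only: of_nat_le_iff)
      then show "(real N - 1) / 2 \<le> real n" "real N / 2 \<le> real L" by simp_all
    qed
    \<comment> \<open>By the correlation bound the average crowd is at most of order
      \<open>rad^2 * b^n\<close>; the extra power makes crowded words exponentially rare.\<close>
    define \<tau> where "\<tau> = bpow (\<eta> * real N / 2) * (rad n)\<^sup>2 * real b ^ n"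
    have \<tau>: "0 < \<tau>" using rad(1)[of n] b_pos by (simp add: \<tau>_def)
    define a where "a = A * bpow (- (\<delta> * real L))"
    define a' where "a' = bpow (- (\<delta>' * real N))"
    have a: "0 \<le> a" "0 < a'" using A(1) b_pos by (simp_all add: a_def a'_def)
    have bnpos: "0 < real b ^ n" using b_pos by simp
    have t1: "bad L a \<le> ennreal (B * bpow (- (c' * real N)))"
    proof -
      have "c' * real N \<le> c / 2 * real N" by (intro mult_right_mono) (auto simp: c'_def)
      also have "c / 2 * real N = c * (real N / 2)" by simp
      also have "\<dots> \<le> c * real L" using nL A(2) by (intro mult_left_mono) auto
      finally have "B * bpow (- (c * real L)) \<le> B * bpow (- (c' * real N))"
        using A(3) by (intro mult_left_mono) (auto simp: bpow_le)
      then show ?thesis using A(4)[of L] unfolding a_def by (meson ennreal_leI order_trans)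
    qed
    have c'\<eta>: "c' * real N \<le> \<eta> * real N / 2"
    proof -
      have "c' * real N \<le> \<eta> / 2 * real N" by (intro mult_right_mono) (auto simp: c'_def)
      then show ?thesis by simp
    qed
    have t2: "ennreal ((1 / real b) ^ n / \<tau>) * mean_corr gam n (2 * rad n) \<le> ennreal (4 * K * bpow (- (c' * real N)))"
    proof -
      have "gam ^ n \<le> 2 * rad n" using rad[of n] by linarith
      then have "ennreal ((1 / real b) ^ n / \<tau>) * mean_corr gam n (2 * rad n) \<le>
         ennreal ((1 / real b) ^ n / \<tau>) * ennreal (K * (2 * rad n)\<^sup>2 * (real b ^ n)\<^sup>2)"
        by (intro mult_left_mono corr(2)) auto
      also have "\<dots> = ennreal ((1 / real b) ^ n / \<tau> * (K * (2 * rad n)\<^sup>2 * (real b ^ n)\<^sup>2))"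
        using \<tau> corr(1) by (intro ennreal_mult[symmetric]) auto
      also have "(1 / real b) ^ n / \<tau> * (K * (2 * rad n)\<^sup>2 * (real b ^ n)\<^sup>2) = 4 * K / bpow (\<eta> * real N / 2)"
        using rad(1)[of n] bnpos b_pos by (simp add: \<tau>_def power_one_over power2_eq_square field_simps)
      also have "\<dots> = 4 * K * bpow (- (\<eta> * real N / 2))"
        by (simp add: powr_minus_divide)
      also have "ennreal \<dots> \<le> ennreal (4 * K * bpow (- (c' * real N)))"
        using corr(1) c'\<eta> by (intro ennreal_leI mult_left_mono) (auto simp: bpow_le)
      finally show ?thesis .
    qed
    have t3: "(1 / real b) ^ n * ((1 / real b) ^ n * (\<tau> / (2 * rad n)) * a / a') \<le> R * A / 2 * bpow ((1 + kap) / 2) * bpow (- (c' * real N))"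
    proof -
      have "(1 / real b) ^ n * ((1 / real b) ^ n * (\<tau> / (2 * rad n)) * a / a') =
        (1 / real b) ^ n * bpow (\<eta> * real N / 2) * (rad n / 2) * a / a'"
        using rad(1)[of n] bnpos b_pos by (simp add: \<tau>_def power_one_over power2_eq_square field_simps)
      also have "\<dots> = R * A / 2 * (bpow (- real n) * bpow (\<eta> * real N / 2) * bpow (- (kap * real n)) * bpow (- (\<delta> * real L)) * bpow (\<delta>' * real N))"
        by (simp add: rad_def R_def[symmetric] gam_bpow bpow_minus_nat a_def a'_def powr_minus_divide mult_ac)
      also have "\<dots> = R * A / 2 * bpow (- real n + \<eta> * real N / 2 - kap * real n - \<delta> * real L + \<delta>' * real N)"
        by (simp add: powr_add[symmetric])
      also have "\<dots> \<le> R * A / 2 * bpow ((1 + kap) / 2 - c' * real N)"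
      proof (intro mult_left_mono)
        have "(1 + kap) * ((real N - 1) / 2) \<le> (1 + kap) * real n" using kap nL by (intro mult_left_mono) auto
        moreover have "\<delta> * (real N / 2) \<le> \<delta> * real L" using \<delta>(2) nL by (intro mult_left_mono) auto
        moreover have "\<delta>' * real N = (1 + kap) * ((real N - 1) / 2) + (1 + kap) / 2 + \<delta> * (real N / 2) - \<eta> * real N"
          by (simp add: \<delta>'_def field_simps)
        ultimately have "- real n + \<eta> * real N / 2 - kap * real n - \<delta> * real L + \<delta>' * real N \<le> (1 + kap) / 2 - \<eta> * real N / 2"
          unfolding distrib_right[of 1 kap "real n"] by linarith
        then show "bpow (- real n + \<eta> * real N / 2 - kap * real n - \<delta> * real L + \<delta>' * real N) \<le> bpow ((1 + kap) / 2 - c' * real N)"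
          using c'\<eta> unfolding bpow_le by linarith
      qed (use R A in auto)
      also have "bpow ((1 + kap) / 2 - c' * real N) = bpow ((1 + kap) / 2) * bpow (- (c' * real N))"
        by (simp add: powr_add[symmetric])
      finally show ?thesis by (simp only: mult.assoc)
    qed
    have "bad N (1 * bpow (- (\<delta>' * real N))) = bad (n + L) a'" using N by (simp add: a'_def)
    also have "\<dots> \<le> bad L a + ennreal ((1 / real b) ^ n / \<tau>) * mean_corr gam n (2 * rad n) +
       ennreal ((1 / real b) ^ n * ((1 / real b) ^ n * (\<tau> / (2 * rad n)) * a / a'))"
      by (rule bad_step[OF N(2) a \<tau>])
    also have "\<dots> \<le> ennreal (B * bpow (- (c' * real N))) + ennreal (4 * K * bpow (- (c' * real N))) +
        ennreal (R * A / 2 * bpow ((1 + kap) / 2) * bpow (- (c' * real N)))"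
      by (intro add_mono t1 t2 ennreal_leI t3)
    also have "\<dots> = ennreal (B' * bpow (- (c' * real N)))"
      using A corr(1) R by (simp add: ennreal_plus[symmetric] B'_def distrib_right del: ennreal_plus)
    finally show ?thesis .
  qed
  then show ?thesis
    unfolding rate_def \<delta>'_def[symmetric] using c' B' by (intro exI[of _ 1] exI[of _ c'] exI[of _ B'] conjI allI) auto
qed

lemma rate_below_dimension:
  assumes corr: "0 \<le> K" "\<And>n r. gam ^ n \<le> r \<Longrightarrow> mean_corr gam n r \<le> ennreal (K * r\<^sup>2 * (real b ^ n)\<^sup>2)"
    and \<delta>: "\<delta> < 1 + kap"
  shows "rate \<delta>"
proof -
  \<comment> \<open>The induction starts from the trivial \<open>\<delta> = 1\<close>, at distance
    \<open>kap\<close> from the goal. A step halves this distance and the loss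
    \<open>\<epsilon>\<close>, so that spending \<open>\<epsilon> / 2\<close> on
    \<open>\<eta>\<close> restores the latter.\<close>
  have iter: "rate (1 + kap - kap / 2 ^ k - \<epsilon>)" if "0 < \<epsilon>" "\<epsilon> \<le> 1" for k \<epsilon>
  proof (induction k)
    case 0
    then show ?case by (rule rate_mono[OF rate_1]) (use that in auto)
  next
    case (Suc k)
    have "kap / 2 ^ k \<le> kap / 1" using kap by (intro divide_left_mono) auto
    then have "0 \<le> 1 + kap - kap / 2 ^ k - \<epsilon>" using that by simp
    from rate_step[OF corr Suc this, of "\<epsilon> / 2"]
    have "rate ((1 + kap + (1 + kap - kap / 2 ^ k - \<epsilon>)) / 2 - \<epsilon> / 2)" using that by simp
    then show ?case by (rule rate_mono) (simp add: field_simps)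
  qed
  define \<epsilon> where "\<epsilon> = min 1 ((1 + kap - \<delta>) / 2)"
  have "\<epsilon> \<le> (1 + kap - \<delta>) / 2" unfolding \<epsilon>_def by (rule min.cobounded2)
  then have \<epsilon>: "0 < \<epsilon>" "\<epsilon> \<le> 1" "\<delta> + 2 * \<epsilon> \<le> 1 + kap" using \<delta> by (auto simp: \<epsilon>_def)
  have "(\<lambda>k. kap * (1/2) ^ k) \<longlonglongrightarrow> kap * 0"
    by (intro tendsto_mult tendsto_const LIMSEQ_power_zero) auto
  then have "\<forall>\<^sub>F k in sequentially. kap * (1/2) ^ k < \<epsilon>" using \<epsilon> by (intro order_tendstoD) auto
  then obtain k where "kap * (1/2) ^ k < \<epsilon>" by (auto simp: eventually_sequentially)
  then have "\<delta> \<le> 1 + kap - kap / 2 ^ k - \<epsilon>" using \<epsilon> by (simp add: power_one_over)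
  then show ?thesis using iter[OF \<epsilon>(1,2)] rate_mono by blast
qed

section \<open>From annuli to squares: invariance, shells and Borel--Cantelli\<close>

lemma bad_pullback: "emeasure lborel {x \<in> {0..<1}. ennreal a < amass N (real b ^ n * x)} = bad N a"
proof -
  let ?F = "indicator {x. ennreal a < amass N (real b ^ n * x)} :: real \<Rightarrow> ennreal"
  have bn: "0 < b ^ n" using b_pos by auto
  have [measurable]: "?F \<in> borel_measurable borel" by measurable
  have "?F ((u + real j) / real (b ^ n)) = indicator {x. ennreal a < amass N x} u" for u j
  proof -
    have "amass N (u + real j) = amass N u"
      using shift_int_if_shift_1[of "amass N" u "int j", OF amass_periodic] by simp
    then show ?thesis using b_pos by (simp add: indicator_def)
  qed
  then have "of_nat (b ^ n) * (\<integral>\<^sup>+x\<in>{0..<1}. ?F x \<partial>lborel) = of_nat (b ^ n) * bad N a"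
    using nn_integral_unit_split[of ?F "b ^ n"] bn by (simp add: bad_eq)
  then have "(\<integral>\<^sup>+x\<in>{0..<1}. ?F x \<partial>lborel) = bad N a"
    by (metis ennreal_power_cancel)
  moreover have "(\<integral>\<^sup>+x\<in>{0..<1}. ?F x \<partial>lborel) = (\<integral>\<^sup>+x. indicator {x \<in> {0..<1}. ennreal a < amass N (real b ^ n * x)} x \<partial>lborel)"
    by (intro nn_integral_cong) (auto simp: indicator_def)
  ultimately show ?thesis by simp
qed

text \<open>A pair at distance about \<open>b powr (- R - k)\<close> whose values differ by at most \<open>b powr (- R)\<close> is blown up
  by \<open>b ^ level k\<close>, which turns it into a pair counted by \<open>annulus\<close>.\<close>

definition level :: "nat \<Rightarrow> nat" where "level k = nat \<lceil>real k / kap\<rceil>"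

lemma level: "real k \<le> kap * real (level k)" "real (level k) < real k / kap + 1"
proof -
  have "0 \<le> real k / kap" using kap by simp
  then have "real (level k) = of_int \<lceil>real k / kap\<rceil>" by (simp add: level_def)
  then have "real k / kap \<le> real (level k)" "real (level k) < real k / kap + 1" by linarith+
  then show "real k \<le> kap * real (level k)" "real (level k) < real k / kap + 1"
    using kap by (simp_all add: field_simps)
qed

text \<open>The scale left after the blow-up is at least linear in \<open>R\<close>, uniformly in
  \<open>k\<close>, so the bad sets that it produces are exponentially small in
  \<open>R\<close>.\<close>

lemma level_le:
  assumes "real k \<le> kap * real R"
  shows "level k \<le> R" "kap * real R - 1 \<le> real (R + k - level k)"
proof -
  have kR: "real k / kap \<le> real R" using assms kap by (simp add: field_simps)
  show le: "level k \<le> R" using kR by (simp add: level_def ceiling_le_iff)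
  have "0 \<le> (1 - kap) * (real R - real k / kap)" using kap kR by (intro mult_nonneg_nonneg) auto
  also have "\<dots> = real R - real k / kap - kap * real R + real k" using kap by (simp add: field_simps)
  finally have "kap * real R - 1 \<le> real R + real k - real (level k)" using level(2)[of k] by linarith
  then show "kap * real R - 1 \<le> real (R + k - level k)" using le by (simp add: of_nat_diff)
qed

definition box :: "nat \<Rightarrow> real \<Rightarrow> real set" where
  "box R x = {y. \<bar>x - y\<bar> \<le> (1 / real b) ^ R \<and> \<bar>f x - f y\<bar> \<le> (1 / real b) ^ R}"

text \<open>As \<open>kap * level k \<ge> k\<close>, the tolerance after blow-up fits into an
  annulus at scale \<open>N\<close>. In the exponent
  \<open>(\<delta> - 1) * n - \<delta> * k\<close> is at most 1, because
  \<open>\<delta> - 1 \<le> kap\<close> and \<open>n\<close> exceeds \<open>k / kap\<close> by less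
  than 1; this costs the factor \<open>b\<close>.\<close>

lemma emeasure_shell_le:
  assumes k: "real k \<le> kap * real R" and \<delta>: "1 \<le> \<delta>" "\<delta> \<le> 1 + kap" and A: "0 \<le> A"
    and le: "amass (R + k - level k) (real b ^ level k * x) \<le> ennreal (A * bpow (- (\<delta> * real (R + k - level k))))"
  shows "emeasure lborel {y. (1 / real b) ^ Suc (R + k) < \<bar>x - y\<bar> \<and> \<bar>x - y\<bar> \<le> (1 / real b) ^ (R + k) \<and>
      \<bar>f x - f y\<bar> \<le> (1 / real b) ^ R} \<le> ennreal (A * real b * bpow (- (\<delta> * real R)))"
proof -
  define n where "n = level k"
  define N where "N = R + k - n"
  define u where "u = real b ^ n * x"
  define \<rho> where "\<rho> = (1 / real b) ^ R / l ^ n"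
  have n: "n \<le> R" using level_le[OF k] by (simp add: n_def)
  then have nN: "n + N = R + k" and N: "real N = real R + real k - real n" by (auto simp: N_def of_nat_diff)
  have x: "(u + real 0) / real b ^ n = x" using b_pos by (simp add: u_def)
  have \<rho>: "l ^ n * \<rho> = (1 / real b) ^ R" using l by (simp add: \<rho>_def)
  have "emeasure lborel {y. (1 / real b) ^ Suc (R + k) < \<bar>x - y\<bar> \<and> \<bar>x - y\<bar> \<le> (1 / real b) ^ (R + k) \<and>
      \<bar>f x - f y\<bar> \<le> (1 / real b) ^ R} = ennreal ((1 / real b) ^ n) * emeasure lborel (pulled n N \<rho> u 0)"
    using emeasure_pulled[of n N u 0 \<rho>] unfolding x nN \<rho> .
  also have "\<dots> \<le> ennreal ((1 / real b) ^ n) * amass N u"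
    unfolding amass_def
  proof (intro mult_left_mono emeasure_mono pulled_subset_annulus)
    have "\<rho> = (1 / real b) ^ R * (gam ^ n * real b ^ n)"
      using l b_pos by (simp add: \<rho>_def gam_def power_divide power_mult_distrib)
    also have "\<dots> = bpow (- real R - kap * real n + real n)"
      using b_pos by (simp add: bpow_minus_nat gam_bpow powr_realpow[symmetric] powr_add[symmetric] algebra_simps)
    also have "\<dots> \<le> bpow (- real N)" using level(1)[of k] unfolding bpow_le N n_def by simp
    also have "\<dots> = 1 * (1 / real b) ^ N" by (simp only: bpow_minus_nat mult_1)
    also have "\<dots> \<le> (1 + (C - 1) * gam ^ n) * (1 / real b) ^ N"
      using M gam by (intro mult_right_mono) (auto simp: C_def)
    finally show "\<rho> \<le> (1 + (C - 1) * gam ^ n) * (1 / real b) ^ N" .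
  qed auto
  also have "\<dots> \<le> ennreal ((1 / real b) ^ n) * ennreal (A * bpow (- (\<delta> * real N)))"
    using le by (intro mult_left_mono) (simp_all add: N_def n_def u_def)
  also have "\<dots> = ennreal (A * bpow (- real n - \<delta> * real N))"
    using A by (simp add: ennreal_mult[symmetric] bpow_minus_nat powr_add[symmetric] mult.left_commute)
  also have "\<dots> \<le> ennreal (A * bpow (1 - \<delta> * real R))"
  proof (intro ennreal_leI mult_left_mono A)
    have "(\<delta> - 1) * real n \<le> (\<delta> - 1) * (real k / kap + 1)"
      using level(2)[of k] \<delta> by (intro mult_left_mono) (auto simp: n_def)
    also have "\<dots> \<le> kap * (real k / kap + 1)"
      using \<delta> kap by (intro mult_right_mono) auto
    also have "\<dots> \<le> real k + 1" using kap by (simp add: distrib_left)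
    also have "real k \<le> \<delta> * real k" using \<delta> by (simp add: mult_le_cancel_right1)
    finally have "(\<delta> - 1) * real n \<le> \<delta> * real k + 1" by simp
    then show "bpow (- real n - \<delta> * real N) \<le> bpow (1 - \<delta> * real R)"
      unfolding bpow_le N by (simp add: algebra_simps)
  qed
  also have "A * bpow (1 - \<delta> * real R) = A * real b * bpow (- (\<delta> * real R))"
    using b_pos powr_add[of "real b" 1 "- (\<delta> * real R)"] by simp
  finally show ?thesis .
qed

text \<open>Shells are needed only down to distance about \<open>b^(-(1 + kap) * R)\<close>: an
  interval of that radius already satisfies the bound, whatever the values of \<open>f\<close>. This
  leaves at most \<open>R + 1\<close> shells.\<close>

lemma emeasure_box_le:
  assumes \<delta>: "1 \<le> \<delta>" "\<delta> \<le> 1 + kap" and A: "0 \<le> A"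
    and le: "\<And>k. real k \<le> kap * real R \<Longrightarrow>
      amass (R + k - level k) (real b ^ level k * x) \<le> ennreal (A * bpow (- (\<delta> * real (R + k - level k))))"
  shows "emeasure lborel (box R x) \<le> ennreal ((A * real b + 2) * real (Suc R) * bpow (- (\<delta> * real R)))"
proof -
  define m where "m = Suc (nat \<lfloor>kap * real R\<rfloor>)"
  have m: "kap * real R < real m" "\<And>k. k < m \<Longrightarrow> real k \<le> kap * real R"
  proof -
    have "0 \<le> kap * real R" using kap by simp
    then show "kap * real R < real m" "\<And>k. k < m \<Longrightarrow> real k \<le> kap * real R"
      unfolding m_def by linarith+
  qed
  have mR: "m \<le> Suc R"
  proof -
    have "kap * real R \<le> 1 * real R" using kap by (intro mult_right_mono) auto
    then show ?thesis unfolding m_def by linarith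
  qed
  let ?W = "\<lambda>k. {y. (1 / real b) ^ Suc (R + k) < \<bar>x - y\<bar> \<and> \<bar>x - y\<bar> \<le> (1 / real b) ^ (R + k) \<and>
      \<bar>f x - f y\<bar> \<le> (1 / real b) ^ R}"
  let ?I = "{x - (1 / real b) ^ (R + m) .. x + (1 / real b) ^ (R + m)}"
  have shell: "\<exists>k<m'. (1 / real b) ^ Suc (R + k) < d \<and> d \<le> (1 / real b) ^ (R + k)"
    if "(1 / real b) ^ (R + m') < d" "d \<le> (1 / real b) ^ R" for d m'
    using that
  proof (induction m')
    case (Suc m')
    then show ?case
      by (cases "(1 / real b) ^ (R + m') < d") (auto simp: less_Suc_eq not_less)
  qed auto
  have "box R x \<subseteq> (\<Union>k<m. ?W k) \<union> ?I"
  proof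
    fix y assume y: "y \<in> box R x"
    show "y \<in> (\<Union>k<m. ?W k) \<union> ?I"
    proof (cases "(1 / real b) ^ (R + m) < \<bar>x - y\<bar>")
      case True
      then show ?thesis using shell[of m "\<bar>x - y\<bar>"] y by (auto simp: box_def)
    next
      case False
      then show ?thesis by (auto simp: abs_le_iff)
    qed
  qed
  then have "emeasure lborel (box R x) \<le> emeasure lborel ((\<Union>k<m. ?W k) \<union> ?I)"
    by (intro emeasure_mono) auto
  also have "\<dots> \<le> emeasure lborel (\<Union>k<m. ?W k) + emeasure lborel ?I"
    by (intro emeasure_subadditive) auto
  also have "emeasure lborel (\<Union>k<m. ?W k) \<le> (\<Sum>k<m. emeasure lborel (?W k))"
    by (intro emeasure_subadditive_finite) auto
  also have "\<dots> \<le> (\<Sum>k<m. ennreal (A * real b * bpow (- (\<delta> * real R))))"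
    by (intro sum_mono emeasure_shell_le[OF _ \<delta> A le] m) auto
  also have "\<dots> = ennreal (real m * (A * real b * bpow (- (\<delta> * real R))))"
    by (simp only: sum_constant card_lessThan of_nat_mult_ennreal)
  also have "\<dots> \<le> ennreal (real (Suc R) * (A * real b * bpow (- (\<delta> * real R))))"
    using mR A by (intro ennreal_leI mult_right_mono) auto
  also have "emeasure lborel ?I = ennreal (2 * (1 / real b) ^ (R + m))"
    by (simp add: emeasure_lborel_Icc_eq)
  also have "\<dots> \<le> ennreal (2 * real (Suc R) * bpow (- (\<delta> * real R)))"
  proof (intro ennreal_leI mult_mono)
    have "\<delta> * real R \<le> (1 + kap) * real R" using \<delta> by (intro mult_right_mono) auto
    also have "\<dots> \<le> real (R + m)" using m(1) by (simp add: distrib_right)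
    finally show "(1 / real b) ^ (R + m) \<le> bpow (- (\<delta> * real R))" unfolding bpow_minus_nat bpow_le by simp
  qed auto
  finally show ?thesis
    using A by (simp add: ennreal_plus[symmetric] add_mono distrib_right distrib_left mult_ac del: ennreal_plus)
qed

lemma Suc_mult_power_le:
  fixes q :: real
  assumes "0 \<le> q" "q < 1"
  shows "real (Suc n) * q ^ n \<le> 1 / (1 - q)\<^sup>2"
proof -
  have s: "(\<lambda>n. real (Suc n) * q ^ n) sums (1 / (1 - q)\<^sup>2)" using geometric_deriv_sums[of q] assms by simp
  have "sum (\<lambda>n. real (Suc n) * q ^ n) {n} \<le> (\<Sum>n. real (Suc n) * q ^ n)"
    using s assms by (intro sum_le_suminf) (auto simp: sums_iff)
  then show ?thesis using s by (simp add: sums_iff)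
qed

text \<open>Quantitative Borel--Cantelli: scale \<open>R\<close> has at most \<open>R + 1\<close>
  exceptional sets, each exponentially small, and from some \<open>R0\<close> on their total is
  below 1, the measure of the unit interval.\<close>

lemma box_good_set:
  assumes \<delta>: "rate \<delta>"
  shows "\<exists>A\<ge>0. \<exists>R0. \<exists>E. E \<in> sets lborel \<and> 0 < emeasure lborel E \<and>
    (\<forall>x\<in>E. \<forall>R\<ge>R0. \<forall>k. real k \<le> kap * real R \<longrightarrow>
       amass (R + k - level k) (real b ^ level k * x) \<le> ennreal (A * bpow (- (\<delta> * real (R + k - level k)))))"
proof -
  obtain A c B where A: "0 \<le> A" "0 < c" "0 \<le> B" "\<And>N. bad N (A * bpow (- (\<delta> * real N))) \<le> ennreal (B * bpow (- (c * real N)))"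
    using \<delta> unfolding rate_def by blast
  define S where "S R k = (if real k \<le> kap * real R then
     {x \<in> {0..<1}. ennreal (A * bpow (- (\<delta> * real (R + k - level k)))) < amass (R + k - level k) (real b ^ level k * x)} else {})" for R k
  have [measurable]: "S R k \<in> sets borel" for R k
    by (cases "real k \<le> kap * real R") (simp_all add: S_def)
  define q where "q = bpow (- (c * kap))"
  have q: "0 \<le> q" "q < 1"
  proof -
    have "- (c * kap) < 0" using A(2) kap by simp
    then have "q < bpow 0" unfolding q_def using b_pos by (intro powr_less_mono) auto
    then show "q < 1" using b_pos by simp
  qed (simp add: q_def)
  define h where "h R = B * bpow c * (real (Suc R) * q ^ R)" for R
  have h0: "0 \<le> h R" for R using A(3) q by (simp add: h_def)
  have sm: "summable h"
    unfolding h_def using geometric_deriv_sums[of q] q by (intro summable_mult) (auto simp: sums_iff)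
  have S_le: "emeasure lborel (S R k) \<le> ennreal (B * bpow c * q ^ R)" for R k
  proof (cases "real k \<le> kap * real R")
    case True
    let ?N = "R + k - level k"
    have "emeasure lborel (S R k) = bad ?N (A * bpow (- (\<delta> * real ?N)))"
      using True by (simp only: S_def if_True bad_pullback)
    also have "\<dots> \<le> ennreal (B * bpow (- (c * real ?N)))" by (rule A(4))
    also have "\<dots> \<le> ennreal (B * bpow (c - c * kap * real R))"
    proof (intro ennreal_leI mult_left_mono A)
      have "c * (kap * real R - 1) \<le> c * real ?N" using level_le(2)[OF True] A(2) by (intro mult_left_mono) auto
      then show "bpow (- (c * real ?N)) \<le> bpow (c - c * kap * real R)" unfolding bpow_le by (simp add: algebra_simps)
    qed
    also have "bpow (c - c * kap * real R) = bpow c * q ^ R"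
      using b_pos by (simp add: q_def powr_realpow[symmetric] powr_powr powr_add[symmetric])
    finally show ?thesis by (simp add: mult.assoc)
  next
    case False
    then show ?thesis by (simp add: S_def)
  qed
  define SS where "SS R = (\<Union>k<Suc R. S R k)" for R
  have SS_all: "S R k \<subseteq> SS R" for R k
  proof (cases "real k \<le> kap * real R")
    case True
    have "kap * real R \<le> 1 * real R" using kap by (intro mult_right_mono) auto
    then have "k < Suc R" using True by linarith
    then show ?thesis by (auto simp: SS_def)
  qed (simp add: S_def)
  have [measurable]: "SS R \<in> sets borel" for R unfolding SS_def by measurable
  have SS_le: "emeasure lborel (SS R) \<le> ennreal (h R)" for R
  proof -
    have "emeasure lborel (SS R) \<le> (\<Sum>k<Suc R. emeasure lborel (S R k))"
      unfolding SS_def by (intro emeasure_subadditive_finite) auto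
    also have "\<dots> \<le> (\<Sum>k<Suc R. ennreal (B * bpow c * q ^ R))" by (intro sum_mono S_le)
    also have "\<dots> = ennreal (real (Suc R) * (B * bpow c * q ^ R))"
      by (simp only: sum_constant card_lessThan of_nat_mult_ennreal)
    also have "real (Suc R) * (B * bpow c * q ^ R) = h R" by (simp add: h_def)
    finally show ?thesis .
  qed
  obtain R0 where R0: "\<And>n. n \<ge> R0 \<Longrightarrow> norm (\<Sum>i. h (i + n)) < 1"
    using suminf_exist_split[OF zero_less_one sm] by blast
  define E where "E = {0..<1} - (\<Union>i. SS (i + R0))"
  have E[measurable]: "E \<in> sets borel" unfolding E_def by measurable
  have small: "emeasure lborel (\<Union>i. SS (i + R0)) < 1"
  proof -
    have "emeasure lborel (\<Union>i. SS (i + R0)) \<le> (\<Sum>i. emeasure lborel (SS (i + R0)))"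
      by (intro emeasure_subadditive_countably) auto
    also have "\<dots> \<le> (\<Sum>i. ennreal (h (i + R0)))"
      by (intro suminf_le summableI SS_le)
    also have "\<dots> = ennreal (\<Sum>i. h (i + R0))"
      by (intro suminf_ennreal_eq h0 summable_sums) (use sm in \<open>simp add: summable_iff_shift\<close>)
    also have "\<dots> < 1" using R0[of R0] h0 by (simp add: suminf_nonneg summable_iff_shift sm ennreal_less_one_iff)
    finally show ?thesis .
  qed
  have "0 < emeasure lborel E"
  proof (rule ccontr)
    assume "\<not> 0 < emeasure lborel E"
    then have "emeasure lborel E = 0" by simp
    have "1 = emeasure lborel {0..<1::real}" by simp
    also have "\<dots> \<le> emeasure lborel (E \<union> (\<Union>i. SS (i + R0)))"
      by (intro emeasure_mono) (auto simp: E_def)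
    also have "\<dots> \<le> emeasure lborel E + emeasure lborel (\<Union>i. SS (i + R0))"
      by (intro emeasure_subadditive) auto
    finally show False using small \<open>emeasure lborel E = 0\<close> by simp
  qed
  moreover have "amass (R + k - level k) (real b ^ level k * x) \<le> ennreal (A * bpow (- (\<delta> * real (R + k - level k))))"
    if x: "x \<in> E" and R: "R \<ge> R0" and k: "real k \<le> kap * real R" for x R k
  proof (rule ccontr)
    assume "\<not> ?thesis"
    then have "x \<in> S R k" using x k by (simp add: S_def E_def)
    then have "x \<in> SS ((R - R0) + R0)" using SS_all[of R k] R by auto
    then show False using x unfolding E_def by blast
  qed
  ultimately show ?thesis using A(1) E by (intro exI[of _ A] exI[of _ R0] exI[of _ E] conjI) auto
qed

lemma graph_frostman_f:
  assumes corr: "0 \<le> K" "\<And>n r. gam ^ n \<le> r \<Longrightarrow> mean_corr gam n r \<le> ennreal (K * r\<^sup>2 * (real b ^ n)\<^sup>2)"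
  shows "graph_frostman f (1 + kap)"
  unfolding graph_frostman_def
proof (intro allI impI, elim conjE)
  fix s assume s: "0 \<le> s" "s < 1 + kap"
  \<comment> \<open>Strictly above \<open>s\<close>, so that the factor \<open>R + 1\<close> can be
    absorbed, strictly below the dimension, and at least 1, as the shell estimate requires.\<close>
  define \<delta> where "\<delta> = (max s 1 + (1 + kap)) / 2"
  have \<delta>: "1 \<le> \<delta>" "s < \<delta>" "\<delta> < 1 + kap" using s kap by (auto simp: \<delta>_def max_def)
  obtain A R0 E where A: "0 \<le> A" and E: "E \<in> sets lborel" "0 < emeasure lborel E"
    and good: "\<And>x R k. x \<in> E \<Longrightarrow> R \<ge> R0 \<Longrightarrow> real k \<le> kap * real R \<Longrightarrow>
       amass (R + k - level k) (real b ^ level k * x) \<le> ennreal (A * bpow (- (\<delta> * real (R + k - level k))))"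
    using box_good_set[OF rate_below_dimension[OF corr \<delta>(3)]] by metis
  define q where "q = bpow (- (\<delta> - s))"
  have q: "0 \<le> q" "q < 1"
  proof -
    have "q < bpow 0" unfolding q_def using \<delta> b_pos by (intro powr_less_mono) auto
    then show "q < 1" using b_pos by simp
  qed (simp add: q_def)
  \<comment> \<open>The first part absorbs \<open>(R + 1) * q^R\<close>; the second makes the
    trivial bound 2 sufficient for \<open>R < R0\<close>.\<close>
  define c1 where "c1 = (A * real b + 2) * (1 / (1 - q)\<^sup>2) + 2 * bpow (s * real R0)"
  have c1: "0 \<le> c1" using A by (simp add: c1_def)
  have box_le: "emeasure lborel (box R x) \<le> ennreal (c1 * bpow (- (s * real R)))" if x: "x \<in> E" for x R
  proof (cases "R \<ge> R0")
    case True
    have "emeasure lborel (box R x) \<le> ennreal ((A * real b + 2) * real (Suc R) * bpow (- (\<delta> * real R)))"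
      by (rule emeasure_box_le) (use \<delta> A good[OF x True] in auto)
    also have "bpow (- (\<delta> * real R)) = q ^ R * bpow (- (s * real R))"
      using b_pos by (simp add: q_def powr_realpow[symmetric] powr_powr powr_add[symmetric] algebra_simps)
    also have "(A * real b + 2) * real (Suc R) * (q ^ R * bpow (- (s * real R))) =
        (A * real b + 2) * (real (Suc R) * q ^ R) * bpow (- (s * real R))" by (simp only: mult_ac)
    also have "ennreal \<dots> \<le> ennreal (c1 * bpow (- (s * real R)))"
    proof (intro ennreal_leI mult_right_mono)
      have "(A * real b + 2) * (real (Suc R) * q ^ R) \<le> (A * real b + 2) * (1 / (1 - q)\<^sup>2)"
        using A by (intro mult_left_mono Suc_mult_power_le q) auto
      then show "(A * real b + 2) * (real (Suc R) * q ^ R) \<le> c1" unfolding c1_def by (smt (verit) powr_ge_zero)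
    qed auto
    finally show ?thesis .
  next
    case False
    have "emeasure lborel (box R x) \<le> emeasure lborel {x - 1 .. x + 1}"
    proof (intro emeasure_mono subsetI)
      fix y assume "y \<in> box R x"
      then have "\<bar>x - y\<bar> \<le> (1 / real b) ^ R" by (simp add: box_def)
      also have "\<dots> \<le> 1" using b_pos by (intro power_le_one) auto
      finally show "y \<in> {x - 1 .. x + 1}" by (auto simp: abs_le_iff)
    qed auto
    also have "\<dots> = ennreal 2" by (simp add: emeasure_lborel_Icc_eq)
    also have "\<dots> \<le> ennreal (c1 * bpow (- (s * real R)))"
    proof (rule ennreal_leI)
      have "bpow 0 \<le> bpow (s * real R0 + - (s * real R))"
        using False s unfolding bpow_le by (simp add: mult_left_mono)
      then have "2 \<le> 2 * bpow (s * real R0) * bpow (- (s * real R))"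
        using b_pos unfolding powr_add by simp
      also have "\<dots> \<le> c1 * bpow (- (s * real R))"
        using A by (intro mult_right_mono) (auto simp: c1_def)
      finally show "2 \<le> c1 * bpow (- (s * real R))" .
    qed
    finally show ?thesis .
  qed
  have "emeasure lborel {y. \<bar>x - y\<bar> \<le> r \<and> \<bar>f x - f y\<bar> \<le> r} \<le> ennreal (c1 * bpow s * r powr s)"
    if x: "x \<in> E" and r: "0 < r" "r \<le> 1" for x r
  proof -
    obtain m where m: "(1 / real b) ^ m < r" using real_arch_pow_inv[OF r(1), of "1 / real b"] b_pos by auto
    \<comment> \<open>This places \<open>r\<close> between \<open>b^(-R-1)\<close> and
      \<open>b^(-R)\<close>, at the cost of a factor \<open>b powr s\<close>.\<close>
    define m0 where "m0 = (LEAST m. (1 / real b) ^ m < r)"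
    have m0: "(1 / real b) ^ m0 < r" unfolding m0_def by (rule LeastI[of "\<lambda>m. (1 / real b) ^ m < r", OF m])
    then have "m0 \<noteq> 0" using r by (intro notI) simp
    then obtain R where R: "m0 = Suc R" using not0_implies_Suc by blast
    have "r \<le> (1 / real b) ^ R"
      using not_less_Least[of R "\<lambda>m. (1 / real b) ^ m < r"] R unfolding m0_def[symmetric] by simp
    then have "emeasure lborel {y. \<bar>x - y\<bar> \<le> r \<and> \<bar>f x - f y\<bar> \<le> r} \<le> emeasure lborel (box R x)"
      by (intro emeasure_mono) (auto simp: box_def)
    also have "\<dots> \<le> ennreal (c1 * bpow (- (s * real R)))" by (rule box_le[OF x])
    also have "\<dots> \<le> ennreal (c1 * (bpow s * r powr s))"
    proof (intro ennreal_leI mult_left_mono c1)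
      have "bpow (- (s * real R)) = bpow s * bpow (- real (Suc R) * s)"
        by (simp add: powr_add[symmetric] algebra_simps)
      also have "bpow (- real (Suc R) * s) = ((1 / real b) ^ Suc R) powr s"
        by (simp only: bpow_minus_nat powr_powr)
      also have "bpow s * ((1 / real b) ^ Suc R) powr s \<le> bpow s * r powr s"
        using m0 R b_pos s by (intro mult_left_mono powr_mono2) auto
      finally show "bpow (- (s * real R)) \<le> bpow s * r powr s" by simp
    qed
    finally show ?thesis by (simp add: mult.assoc)
  qed
  then show "\<exists>E c. E \<in> sets lborel \<and> 0 < emeasure lborel E \<and> (\<forall>x\<in>E. \<forall>r. 0 < r \<longrightarrow> r \<le> 1 \<longrightarrow>
      emeasure lborel {y. \<bar>x - y\<bar> \<le> r \<and> \<bar>f x - f y\<bar> \<le> r} \<le> ennreal (c * r powr s))"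
    using E by blast
qed

end

section \<open>The lower bound near the critical parameter\<close>

text \<open>Passing between the graphs keeps the first coordinate, so a square of radius
  \<open>r\<close> for \<open>G\<close> sits inside one of radius \<open>L * r\<close> for
  \<open>F\<close>. When \<open>L * r > 1\<close> the hypothesis is silent and the trivial bound 2
  is enough.\<close>

lemma graph_frostman_bilipschitz:
  assumes F: "graph_frostman F D" and cont: "continuous_on UNIV F"
    and le: "\<And>x y. \<bar>F x - F y\<bar> \<le> K * (\<bar>x - y\<bar> + \<bar>G x - G y\<bar>)" and K: "0 \<le> K"
  shows "graph_frostman G D"
  unfolding graph_frostman_def
proof (intro allI impI)
  fix s assume s: "0 \<le> s \<and> s < D"
  from F[unfolded graph_frostman_def, rule_format, OF s]
  obtain E where "\<exists>c. E \<in> sets lborel \<and> emeasure lborel E > 0 \<and>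
     (\<forall>x\<in>E. \<forall>r. 0 < r \<longrightarrow> r \<le> 1 \<longrightarrow>
        emeasure lborel {y. \<bar>x - y\<bar> \<le> r \<and> \<bar>F x - F y\<bar> \<le> r} \<le> ennreal (c * r powr s))" ..
  then obtain c where E: "E \<in> sets lborel \<and> emeasure lborel E > 0 \<and>
     (\<forall>x\<in>E. \<forall>r. 0 < r \<longrightarrow> r \<le> 1 \<longrightarrow>
        emeasure lborel {y. \<bar>x - y\<bar> \<le> r \<and> \<bar>F x - F y\<bar> \<le> r} \<le> ennreal (c * r powr s))" ..
  define L where "L = max 1 (2 * K)"
  have L: "1 \<le> L" "2 * K \<le> L" by (auto simp: L_def)
  define c' where "c' = max (c * L powr s) (2 * L powr s)"
  have "emeasure lborel {y. \<bar>x - y\<bar> \<le> r \<and> \<bar>G x - G y\<bar> \<le> r} \<le> ennreal (c' * r powr s)"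
    if x: "x \<in> E" and r: "0 < r" "r \<le> 1" for x r
  proof (cases "L * r \<le> 1")
    case True
    have "emeasure lborel {y. \<bar>x - y\<bar> \<le> r \<and> \<bar>G x - G y\<bar> \<le> r} \<le>
        emeasure lborel {y. \<bar>x - y\<bar> \<le> L * r \<and> \<bar>F x - F y\<bar> \<le> L * r}"
    proof (rule emeasure_mono)
      have "closed {y. \<bar>x - y\<bar> \<le> L * r \<and> \<bar>F x - F y\<bar> \<le> L * r}"
        by (intro closed_Collect_conj closed_Collect_le continuous_intros cont)
      then show "{y. \<bar>x - y\<bar> \<le> L * r \<and> \<bar>F x - F y\<bar> \<le> L * r} \<in> sets lborel" by simp
      show "{y. \<bar>x - y\<bar> \<le> r \<and> \<bar>G x - G y\<bar> \<le> r} \<subseteq> {y. \<bar>x - y\<bar> \<le> L * r \<and> \<bar>F x - F y\<bar> \<le> L * r}"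
      proof safe
        fix y assume y: "\<bar>x - y\<bar> \<le> r" "\<bar>G x - G y\<bar> \<le> r"
        have "1 * r \<le> L * r" using L r by (intro mult_right_mono) auto
        then show "\<bar>x - y\<bar> \<le> L * r" using y by linarith
        have "K * (\<bar>x - y\<bar> + \<bar>G x - G y\<bar>) \<le> K * (2 * r)" using y K by (intro mult_left_mono) auto
        also have "\<dots> = 2 * K * r" by simp
        also have "\<dots> \<le> L * r" using L r by (intro mult_right_mono) auto
        finally show "\<bar>F x - F y\<bar> \<le> L * r" using le[of x y] by linarith
      qed
    qed
    also have "\<dots> \<le> ennreal (c * (L * r) powr s)"
      using E x r L True by simp
    also have "\<dots> \<le> ennreal (c' * r powr s)"
    proof (rule ennreal_leI)
      have "c * (L * r) powr s = c * L powr s * r powr s" using L r by (simp add: powr_mult)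
      also have "\<dots> \<le> c' * r powr s" by (intro mult_right_mono) (auto simp: c'_def)
      finally show "c * (L * r) powr s \<le> c' * r powr s" .
    qed
    finally show ?thesis .
  next
    case False
    have "emeasure lborel {y. \<bar>x - y\<bar> \<le> r \<and> \<bar>G x - G y\<bar> \<le> r} \<le> emeasure lborel {x - 1 .. x + 1}"
      using r by (intro emeasure_mono) (auto simp: abs_le_iff)
    also have "\<dots> = ennreal 2" by (simp add: emeasure_lborel_Icc_eq)
    also have "\<dots> \<le> ennreal (c' * r powr s)"
    proof (rule ennreal_leI)
      have "1 \<le> (L * r) powr s" using False s by (intro ge_one_powr_ge_zero) auto
      then have "2 \<le> 2 * L powr s * r powr s" using L r by (simp add: powr_mult)
      also have "\<dots> \<le> c' * r powr s" by (intro mult_right_mono) (auto simp: c'_def)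
      finally show "2 \<le> c' * r powr s" .
    qed
    finally show ?thesis .
  qed
  then show "\<exists>E c. E \<in> sets lborel \<and> emeasure lborel E > 0 \<and> (\<forall>x\<in>E. \<forall>r. 0 < r \<longrightarrow> r \<le> 1 \<longrightarrow>
        emeasure lborel {y. \<bar>x - y\<bar> \<le> r \<and> \<bar>G x - G y\<bar> \<le> r} \<le> ennreal (c * r powr s))"
    using E by (intro exI[of _ E] exI[of _ c']) simp
qed

text \<open>The property transported along coboundaries; its threshold passes from \<open>g\<close>
  to \<open>\<phi>\<close> unchanged.\<close>

definition near_critical_frostman :: "(real \<Rightarrow> real) \<Rightarrow> nat \<Rightarrow> bool" where
  "near_critical_frostman \<phi> b \<longleftrightarrow> (\<exists>K0>1. \<forall>l. 0 < l \<and> l < 1 \<and> 1 < l * real b \<and> l * real b < K0 \<longrightarrow>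
     graph_frostman (weierstrass_fun \<phi> l b) (2 + ln l / ln (real b)))"

section \<open>The two alternatives: transversality or a coboundary\<close>

context c2_periodic
begin

lemma weierstrass_locale:
  assumes "0 < l" "l < 1" "1 < l * real b"
  shows "\<exists>M. weierstrass \<phi> \<psi> \<theta> b l M"
proof -
  obtain M where "M > 0" "\<And>x. \<bar>\<phi> x\<bar> \<le> M \<and> \<bar>\<psi> x\<bar> \<le> M \<and> \<bar>\<theta> x\<bar> \<le> M" using bounds by blast
  then have "weierstrass \<phi> \<psi> \<theta> b l M" using assms by unfold_locales auto
  then show ?thesis ..
qed

lemma near_critical_frostman_if_nondegenerate:
  assumes nd: "\<And>u. \<not> degenerate_at u"
  shows "near_critical_frostman \<phi> b"
proof -
  obtain K0 where K0: "K0 > 1" "\<And>\<gamma>. 1 / K0 < \<gamma> \<Longrightarrow> \<gamma> < 1 \<Longrightarrow>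
    \<exists>C\<ge>0. \<forall>n r. \<gamma> ^ n \<le> r \<longrightarrow> mean_corr \<gamma> n r \<le> ennreal (C * r\<^sup>2 * (real b ^ n)\<^sup>2)"
    using mean_corr_bound[OF nd] by blast
  have "graph_frostman (weierstrass_fun \<phi> l b) (2 + ln l / ln (real b))"
    if l: "0 < l" "l < 1" "1 < l * real b" "l * real b < K0" for l
  proof -
    obtain M where "weierstrass \<phi> \<psi> \<theta> b l M" using weierstrass_locale[OF l(1-3)] by blast
    then interpret W: weierstrass \<phi> \<psi> \<theta> b l M .
    have "1 / K0 < W.gam" using l K0(1) unfolding W.gam_def by (intro divide_strict_left_mono) auto
    then obtain K where "K \<ge> 0" "\<And>n r. W.gam ^ n \<le> r \<Longrightarrow> mean_corr W.gam n r \<le> ennreal (K * r\<^sup>2 * (real b ^ n)\<^sup>2)"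
      using K0(2)[OF _ W.gam(2)] by blast
    from W.graph_frostman_f[OF this] show ?thesis by (simp only: W.dimension_eq)
  qed
  then show ?thesis unfolding near_critical_frostman_def using K0(1) by blast
qed

text \<open>As \<open>l^n / b = \<gamma> * l^(n+1)\<close>, summation nearly telescopes: the series
  for \<open>\<phi>\<close> is \<open>\<gamma> - 1\<close> times the one for \<open>g\<close>, minus
  \<open>\<gamma> * g\<close>, plus a constant. Since \<open>g\<close> is Lipschitz and
  \<open>\<gamma> < 1\<close>, the increments for \<open>g\<close> are controlled by those for
  \<open>\<phi>\<close>.\<close>

lemma near_critical_frostman_coboundary:
  assumes g: "c2_periodic g v w b" and cob: "\<And>x. \<phi> x = g (real b * x) / real b - g x + c"
    and fro: "near_critical_frostman g b"
  shows "near_critical_frostman \<phi> b"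
proof -
  obtain K0 where K0: "K0 > 1" "\<And>l. 0 < l \<Longrightarrow> l < 1 \<Longrightarrow> 1 < l * real b \<Longrightarrow> l * real b < K0 \<Longrightarrow>
     graph_frostman (weierstrass_fun g l b) (2 + ln l / ln (real b))"
    using fro unfolding near_critical_frostman_def by blast
  have "graph_frostman (weierstrass_fun \<phi> l b) (2 + ln l / ln (real b))"
    if l: "0 < l" "l < 1" "1 < l * real b" "l * real b < K0" for l
  proof -
    obtain M where "weierstrass g v w b l M" using c2_periodic.weierstrass_locale[OF g l(1-3)] by blast
    then interpret G: weierstrass g v w b l M .
    define \<gamma> where "\<gamma> = 1 / (l * real b)"
    have \<gamma>: "0 < \<gamma>" "\<gamma> < 1" using l b_pos by (auto simp: \<gamma>_def)
    have eq: "weierstrass_fun \<phi> l b x = (\<gamma> - 1) * G.f x - \<gamma> * g x + c / (1 - l)" for x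
    proof -
      have s0: "(\<lambda>n. l ^ n * g (real b ^ n * x)) sums G.f x"
        using G.f_summable[of x] unfolding weierstrass_fun_def by (rule summable_sums)
      then have "(\<lambda>n. l ^ Suc n * g (real b ^ Suc n * x)) sums (G.f x - g x)"
        by (subst sums_Suc_iff) simp
      then have s1: "(\<lambda>n. \<gamma> * (l ^ Suc n * g (real b ^ Suc n * x))) sums (\<gamma> * (G.f x - g x))"
        by (rule sums_mult)
      have s2: "(\<lambda>n. c * l ^ n) sums (c * (1 / (1 - l)))"
        using l by (intro sums_mult geometric_sums) auto
      have "(\<lambda>n. \<gamma> * (l ^ Suc n * g (real b ^ Suc n * x)) - l ^ n * g (real b ^ n * x) + c * l ^ n) sums
          (\<gamma> * (G.f x - g x) - G.f x + c * (1 / (1 - l)))"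
        by (intro sums_add sums_diff s0 s1 s2)
      moreover have "\<gamma> * (l ^ Suc n * g (real b ^ Suc n * x)) - l ^ n * g (real b ^ n * x) + c * l ^ n =
          l ^ n * \<phi> (real b ^ n * x)" for n
        unfolding cob \<gamma>_def using l b_pos by (simp add: field_simps)
      ultimately show ?thesis
        unfolding weierstrass_fun_def by (simp add: sums_iff algebra_simps)
    qed
    show ?thesis
    proof (rule graph_frostman_bilipschitz[OF K0(2)[OF l] G.f_continuous])
      show "0 \<le> (1 + M) / (1 - \<gamma>)" using \<gamma> G.M(1) by simp
      fix x y
      have "(1 - \<gamma>) * (G.f x - G.f y) = - (weierstrass_fun \<phi> l b x - weierstrass_fun \<phi> l b y) - \<gamma> * (g x - g y)"
        unfolding eq by (simp add: algebra_simps)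
      then have "\<bar>(1 - \<gamma>) * (G.f x - G.f y)\<bar> \<le> \<bar>weierstrass_fun \<phi> l b x - weierstrass_fun \<phi> l b y\<bar> + \<bar>\<gamma> * (g x - g y)\<bar>"
        by linarith
      also have "\<bar>\<gamma> * (g x - g y)\<bar> \<le> 1 * (M * \<bar>x - y\<bar>)"
        unfolding abs_mult using \<gamma> by (intro mult_mono G.lip_phi) auto
      also have "\<bar>weierstrass_fun \<phi> l b x - weierstrass_fun \<phi> l b y\<bar> + 1 * (M * \<bar>x - y\<bar>) \<le>
          (1 + M) * (\<bar>x - y\<bar> + \<bar>weierstrass_fun \<phi> l b x - weierstrass_fun \<phi> l b y\<bar>)"
        using G.M(1) by (simp add: algebra_simps)
      finally show "\<bar>G.f x - G.f y\<bar> \<le> (1 + M) / (1 - \<gamma>) *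
          (\<bar>x - y\<bar> + \<bar>weierstrass_fun \<phi> l b x - weierstrass_fun \<phi> l b y\<bar>)"
        using \<gamma> by (simp add: abs_mult pos_le_divide_eq mult.commute)
    qed
  qed
  then show ?thesis unfolding near_critical_frostman_def using K0(1) by blast
qed

end

text \<open>A counterexample cannot be nondegenerate, so it is a coboundary of some
  \<open>g\<close>, which is again a counterexample. Choosing repeatedly gives an endless chain,
  whose first member must be constant.\<close>

lemma near_critical_frostman_if_nonconstant:
  assumes c2: "c2_periodic \<phi> \<psi> \<theta> b" and nonconst: "\<phi> x \<noteq> \<phi> y"
  shows "near_critical_frostman \<phi> b"
proof (rule ccontr)
  assume neg: "\<not> near_critical_frostman \<phi> b"
  define P where "P t \<longleftrightarrow> c2_periodic (fst t) (fst (snd t)) (snd (snd t)) b \<and> \<not> near_critical_frostman (fst t) b"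
    for t :: "(real \<Rightarrow> real) \<times> (real \<Rightarrow> real) \<times> (real \<Rightarrow> real)"
  define Q where "Q t t' \<longleftrightarrow> (\<exists>c. \<forall>x. fst t x = fst t' (real b * x) / real b - fst t' x + c)"
    for t t' :: "(real \<Rightarrow> real) \<times> (real \<Rightarrow> real) \<times> (real \<Rightarrow> real)"
  have step: "\<exists>t'. P t' \<and> Q t t'" if "P t" for t
  proof -
    interpret T: c2_periodic "fst t" "fst (snd t)" "snd (snd t)" b using that by (simp add: P_def)
    have "\<exists>u. T.degenerate_at u"
      using T.near_critical_frostman_if_nondegenerate that unfolding P_def by blast
    then obtain g v c where g: "c2_periodic g v T.curv b" "\<And>x. fst t x = g (real b * x) / real b - g x + c"
      using T.coboundary_if_degenerate by blast
    have "P (g, v, T.curv)"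
      using that g(1) T.near_critical_frostman_coboundary[OF g] by (auto simp: P_def)
    moreover have "Q t (g, v, T.curv)" using g(2) by (auto simp: Q_def)
    ultimately show ?thesis by blast
  qed
  define F where "F k = ((\<lambda>t. SOME t'. P t' \<and> Q t t') ^^ k) (\<phi>, \<psi>, \<theta>)" for k
  have F: "P (F k)" for k
  proof (induction k)
    case 0
    then show ?case using c2 neg by (simp add: F_def P_def)
  next
    case (Suc k)
    then show ?case using someI_ex[OF step[OF Suc]] by (simp add: F_def)
  qed
  have "Q (F k) (F (Suc k))" for k
    using someI_ex[OF step[OF F[of k]]] by (simp add: F_def)
  then obtain c where "\<And>k x. fst (F k) x = fst (F (Suc k)) (real b * x) / real b - fst (F (Suc k)) x + c k"
    unfolding Q_def by metis
  then have "fst (F 0) x = fst (F 0) y"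
    by (rule coboundary_chain_constant[rotated]) (use F in \<open>auto simp: P_def\<close>)
  then show False using nonconst by (simp add: F_def)
qed

theorem theorem1p1:
  fixes \<phi> :: "real \<Rightarrow> real" and b :: nat
  assumes periodic: "\<forall>x. \<phi> (x + 1) = \<phi> x"
    and nonconst: "\<exists>x y. \<phi> x \<noteq> \<phi> y"
    and C1: "\<forall>x. \<phi> differentiable (at x)"
    and C2: "\<forall>x. deriv \<phi> differentiable (at x)"
    and C2_cont: "continuous_on UNIV (deriv (deriv \<phi>))"
    and b: "b \<ge> 2"
  shows "\<exists>K0 > 1. \<forall>l::real. 0 < l \<and> l < 1 \<and> 1 < l * real b \<and> l * real b < K0 \<longrightarrow>
           hausdorff_dim (graph_of (weierstrass_fun \<phi> l b)) = 2 + ln l / ln (real b)"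
proof -
  have c2: "c2_periodic \<phi> (deriv \<phi>) (deriv (deriv \<phi>)) b"
  proof
    show "(\<phi> has_real_derivative deriv \<phi> x) (at x)" "(deriv \<phi> has_real_derivative deriv (deriv \<phi>) x) (at x)" for x
      using C1 C2 DERIV_deriv_iff_real_differentiable by blast+
  qed (use periodic C2_cont b in auto)
  obtain x y where "\<phi> x \<noteq> \<phi> y" using nonconst by blast
  from near_critical_frostman_if_nonconstant[OF c2 this]
  obtain K0 where K0: "K0 > 1" "\<And>l. 0 < l \<Longrightarrow> l < 1 \<Longrightarrow> 1 < l * real b \<Longrightarrow> l * real b < K0 \<Longrightarrow>
     graph_frostman (weierstrass_fun \<phi> l b) (2 + ln l / ln (real b))"
    unfolding near_critical_frostman_def by blast
  have "hausdorff_dim (graph_of (weierstrass_fun \<phi> l b)) = 2 + ln l / ln (real b)"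
    if l: "0 < l" "l < 1" "1 < l * real b" "l * real b < K0" for l
  proof -
    obtain M where "weierstrass \<phi> (deriv \<phi>) (deriv (deriv \<phi>)) b l M"
      using c2_periodic.weierstrass_locale[OF c2 l(1-3)] by blast
    then interpret W: weierstrass \<phi> "deriv \<phi>" "deriv (deriv \<phi>)" b l M .
    show ?thesis
      by (rule hausdorff_dim_graph_eq[OF W.f_continuous b l(1,3) W.f_holder K0(2)[OF l]])
  qed
  then show ?thesis using K0(1) by blast
qed

end
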